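(* Let $V$ be a complete and cocomplete closed symmetric monoidal category. Let $$\begin{array}{ccc}\mathtt R&\xrightarrow{\ r\ }&\mathtt O\\ {\scriptstyle\varpi}\downarrow& &\downarrow{\scriptstyle\pi}\\ \mathtt Q&\xrightarrow{\ p\ }&\mathtt P\end{array}$$ be a pullback of operadic categories and operadic functors in which $\pi:\mathtt O\to\mathtt P$ is a discrete operadic fibration. Then the induced functors between the associated categories of operads satisfy the Beck–Chevalley condition: there is a natural isomorphism $$\varpi_!(r^*(\mathcal P))\cong p^*(\pi_!(\mathcal P))$$ for any $\mathtt O$-operad $\mathcal P$ in $V$.
   Context: **Operadic category.** $\mathtt{sFSet}$ is the category of the sets $\bar n=\{1,\dots,n\}$, $n\ge0$, and all maps; the fiber $f^{-1}(i)$ of a map is the object $\bar n_i$ order-isomorphic to the preimage of $i$. A (strict) operadic category is a category $\mathtt O$ with a functor $|\cdot|:\mathtt O\to\mathtt{sFSet}$, a chosen terminal object $U_c$ in each connected component $c\in\pi_0(\mathtt O)$ and, for each $f:T\to S$ and $i\in|S|$, an object $f^{-1}(i)$ (the $i$-th fiber) with $|f^{-1}(i)|=|f|^{-1}(i)$, such that: - (i) $|U_c|=\bar1$. - (ii) All fibers of identities are chosen terminal objects. - (iii) For $f:T\to S$, $g:S\to R$, $h=gf$, $i\in|R|$ there is given $f_i:h^{-1}(i)\to g^{-1}(i)$ with $|f_i|$ the map induced by $|f|$, forming a functor $\mathrm{Fib}_i:\mathtt O/R\to\mathtt O$; for $R=U_c$, $\mathrm{Fib}_1$ is the domain functor. -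 (iv) $f^{-1}(j)=f_{|g|(j)}^{-1}(j)$ for $j\in|S|$. - (v) For $f:T\to S$, $a:S\to Q$, $c:Q\to R$, $b=af$, $g=ca$, $h=cb$, $j\in|Q|$, $i=|c|(j)$, one has $(f_i)_j=f_j:b^{-1}(j)\to a^{-1}(j)$, where $f_j$ is induced by the triangle over $Q$ and $(f_i)_j$ by the triangle $h^{-1}(i)\to g^{-1}(i)\to c^{-1}(i)$. An operadic functor is a functor over $\mathtt{sFSet}$ preserving fibers, $F(f^{-1}(i))=F(f)^{-1}(i)$, the induced maps, $F(f_i)=F(f)_i$, and the chosen terminal objects. The pullback $\mathtt R$ is the ordinary pullback of categories, with fibers, chosen terminal objects and cardinalities defined componentwise. **Operads.** An $\mathtt O$-operad $\mathcal P$ in $V$ consists of objects $\mathcal P(T)$, $T\in\mathtt O$, units $I\to\mathcal P(U_c)$ and maps $\mu(f):\mathcal P(f)\otimes\mathcal P(S)\to\mathcal P(T)$ for $f:T\to S$, where $\mathcal P(f)=\bigotimes_{i\in|S|}\mathcal P(f^{-1}(i))$. Axioms: for $T\xrightarrow fS\xrightarrow gR$, $h=gf$, $\mu(f)\circ(\mathrm{id}\otimes\mu(g))=\mu(h)\circ(\bigotimes_{i\in|R|}\mu(f_i)\otimes\mathrm{id})$ on $\bigotimes_i\mathcal P(f_i)\otimes\mathcal P(g)\otimes\mathcal P(R)$ (using $\bigotimes_i\mathcal P(f_i)\cong\mathcal P(f)$); and the composites $\mathcal P(T)\to\mathcal P(\mathrm{id}_T)\otimes\mathcal P(T)\xrightarrow{\mu(\mathrm{id})}\mathcal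 P(T)$ and $\mathcal P(T)\to\mathcal P(T)\otimes\mathcal P(U_c)\xrightarrow{\mu(T\to U_c)}\mathcal P(T)$, formed with the units, are identities. Morphisms are families of maps commuting with all structure. For an operadic functor $F:\mathtt O\to\mathtt P$, $F^*\mathcal P(t)=\mathcal P(F(t))$ is the restriction functor from $\mathtt P$-operads to $\mathtt O$-operads. **Discrete operadic fibration.** An operadic functor $F:\mathtt O\to\mathtt P$ such that (i) $F$ induces a surjection $\pi_0(\mathtt O)\to\pi_0(\mathtt P)$; (ii) for any $f:T\to S$ in $\mathtt P$ and $s,t_i\in\mathtt O$ ($i\in|S|$) with $F(s)=S$, $F(t_i)=f^{-1}(i)$, there is a unique $\sigma:t\to s$ in $\mathtt O$ with $F(\sigma)=f$ and $\sigma^{-1}(i)=t_i$ for all $i$. A pullback of a discrete operadic fibration is a discrete operadic fibration. For a discrete operadic fibration $F$, $F_!$ denotes the left adjoint of $F^*$ on categories of operads; it is given by $F_!\mathcal O(T)=\coprod_{F(t)=T}\mathcal O(t)$, with structure maps induced by those of $\mathcal O$ along the unique lifts in (ii). *)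

theory Defs
  imports Main "HOL-Library.FuncSet"
begin

section \<open>Categories, functors, adjunctions\<close>

record ('o, 'a) cat =
  Obj :: "'o set"
  Arr :: "'a set"
  Dom :: "'a \<Rightarrow> 'o"
  Cod :: "'a \<Rightarrow> 'o"
  Id :: "'o \<Rightarrow> 'a"
  Comp :: "'a \<Rightarrow> 'a \<Rightarrow> 'a"  (* Comp C g f is "g after f" *)

definition Hom :: "('o, 'a, 'z) cat_scheme \<Rightarrow> 'o \<Rightarrow> 'o \<Rightarrow> 'a set" where
  "Hom C x y = {f \<in> Arr C. Dom C f = x \<and> Cod C f = y}"

locale category =
  fixes C :: "('o, 'a, 'z) cat_scheme"
  assumes dom_in: "f \<in> Arr C \<Longrightarrow> Dom C f \<in> Obj C"
    and cod_in: "f \<in> Arr C \<Longrightarrow> Cod C f \<in> Obj C"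
    and id_in: "x \<in> Obj C \<Longrightarrow> Id C x \<in> Hom C x x"
    and comp_in: "f \<in> Hom C x y \<Longrightarrow> g \<in> Hom C y z \<Longrightarrow> Comp C g f \<in> Hom C x z"
    and comp_id_left: "f \<in> Hom C x y \<Longrightarrow> Comp C (Id C y) f = f"
    and comp_id_right: "f \<in> Hom C x y \<Longrightarrow> Comp C f (Id C x) = f"
    and comp_assoc: "f \<in> Hom C w x \<Longrightarrow> g \<in> Hom C x y \<Longrightarrow> h \<in> Hom C y z
      \<Longrightarrow> Comp C h (Comp C g f) = Comp C (Comp C h g) f"

definition inverse_arrows :: "('o, 'a, 'z) cat_scheme \<Rightarrow> 'a \<Rightarrow> 'a \<Rightarrow> bool" where
  "inverse_arrows C f g \<longleftrightarrow>
     f \<in> Hom C (Dom C f) (Cod C f) \<and> g \<in> Hom C (Cod C f) (Dom C f) \<and>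
     Comp C g f = Id C (Dom C f) \<and> Comp C f g = Id C (Cod C f)"

definition iso_arrow :: "('o, 'a, 'z) cat_scheme \<Rightarrow> 'a \<Rightarrow> bool" where
  "iso_arrow C f \<longleftrightarrow> (\<exists>g. inverse_arrows C f g)"

definition inv_arrow :: "('o, 'a, 'z) cat_scheme \<Rightarrow> 'a \<Rightarrow> 'a" where
  "inv_arrow C f = (THE g. inverse_arrows C f g)"

record ('o, 'a, 'p, 'b) ftor =
  ObjMap :: "'o \<Rightarrow> 'p"
  ArrMap :: "'a \<Rightarrow> 'b"

locale cat_functor =
  dom_cat: category C + cod_cat: category D
  for C :: "('o, 'a, 'y) cat_scheme" and D :: "('p, 'b, 'z) cat_scheme"
    and F :: "('o, 'a, 'p, 'b) ftor" +
  assumes obj_in: "x \<in> Obj C \<Longrightarrow> ObjMap F x \<in> Obj D"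
    and arr_in: "f \<in> Hom C x y \<Longrightarrow> ArrMap F f \<in> Hom D (ObjMap F x) (ObjMap F y)"
    and map_id: "x \<in> Obj C \<Longrightarrow> ArrMap F (Id C x) = Id D (ObjMap F x)"
    and map_comp: "f \<in> Hom C x y \<Longrightarrow> g \<in> Hom C y z
      \<Longrightarrow> ArrMap F (Comp C g f) = Comp D (ArrMap F g) (ArrMap F f)"

definition id_ftor :: "('o, 'a, 'o, 'a) ftor" where
  "id_ftor = \<lparr>ObjMap = (\<lambda>x. x), ArrMap = (\<lambda>f. f)\<rparr>"

definition comp_ftor ::
  "('p, 'b, 'q, 'c) ftor \<Rightarrow> ('o, 'a, 'p, 'b) ftor \<Rightarrow> ('o, 'a, 'q, 'c) ftor" where
  "comp_ftor G F = \<lparr>ObjMap = (\<lambda>x. ObjMap G (ObjMap F x)), ArrMap = (\<lambda>f. ArrMap G (ArrMap F f))\<rparr>"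

definition nat_trans :: "('o, 'a, 'y) cat_scheme \<Rightarrow> ('p, 'b, 'z) cat_scheme
    \<Rightarrow> ('o, 'a, 'p, 'b) ftor \<Rightarrow> ('o, 'a, 'p, 'b) ftor \<Rightarrow> ('o \<Rightarrow> 'b) \<Rightarrow> bool" where
  "nat_trans C D F G \<tau> \<longleftrightarrow>
     cat_functor C D F \<and> cat_functor C D G \<and>
     (\<forall>x \<in> Obj C. \<tau> x \<in> Hom D (ObjMap F x) (ObjMap G x)) \<and>
     (\<forall>f \<in> Arr C. Comp D (\<tau> (Cod C f)) (ArrMap F f) = Comp D (ArrMap G f) (\<tau> (Dom C f)))"

definition nat_iso :: "('o, 'a, 'y) cat_scheme \<Rightarrow> ('p, 'b, 'z) cat_scheme
    \<Rightarrow> ('o, 'a, 'p, 'b) ftor \<Rightarrow> ('o, 'a, 'p, 'b) ftor \<Rightarrow> ('o \<Rightarrow> 'b) \<Rightarrow> bool" where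
  "nat_iso C D F G \<tau> \<longleftrightarrow> nat_trans C D F G \<tau> \<and> (\<forall>x \<in> Obj C. iso_arrow D (\<tau> x))"

text \<open>\<open>adjunction C D L G \<eta> \<epsilon>\<close>: \<open>L : C \<rightarrow> D\<close> is left adjoint to \<open>G : D \<rightarrow> C\<close>.\<close>

definition adjunction :: "('o, 'a, 'y) cat_scheme \<Rightarrow> ('p, 'b, 'z) cat_scheme
    \<Rightarrow> ('o, 'a, 'p, 'b) ftor \<Rightarrow> ('p, 'b, 'o, 'a) ftor \<Rightarrow> ('o \<Rightarrow> 'a) \<Rightarrow> ('p \<Rightarrow> 'b) \<Rightarrow> bool" where
  "adjunction C D L G \<eta> \<epsilon> \<longleftrightarrow>
     cat_functor C D L \<and> cat_functor D C G \<and>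
     nat_trans C C id_ftor (comp_ftor G L) \<eta> \<and>
     nat_trans D D (comp_ftor L G) id_ftor \<epsilon> \<and>
     (\<forall>x \<in> Obj C. Comp D (\<epsilon> (ObjMap L x)) (ArrMap L (\<eta> x)) = Id D (ObjMap L x)) \<and>
     (\<forall>y \<in> Obj D. Comp C (ArrMap G (\<epsilon> y)) (\<eta> (ObjMap G y)) = Id C (ObjMap G y))"

definition left_adjoint :: "('o, 'a, 'y) cat_scheme \<Rightarrow> ('p, 'b, 'z) cat_scheme
    \<Rightarrow> ('p, 'b, 'o, 'a) ftor \<Rightarrow> ('o, 'a, 'p, 'b) ftor \<times> ('o \<Rightarrow> 'a) \<times> ('p \<Rightarrow> 'b)" where
  "left_adjoint C D G = (SOME T. case T of (L, \<eta>, \<epsilon>) \<Rightarrow> adjunction C D L G \<eta> \<epsilon>)"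

definition slice :: "('o, 'a, 'z) cat_scheme \<Rightarrow> 'o \<Rightarrow> ('a, 'a \<times> 'a) cat" where
  \<comment> \<open>the arrow \<open>(f, g)\<close> is \<open>f\<close> seen as a map from \<open>g \<circ> f\<close> to \<open>g\<close> over \<open>R\<close>\<close>
  "slice C R = \<lparr>
     Obj = {g \<in> Arr C. Cod C g = R},
     Arr = {(f, g). g \<in> Arr C \<and> Cod C g = R \<and> f \<in> Arr C \<and> Cod C f = Dom C g},
     Dom = (\<lambda>(f, g). Comp C g f),
     Cod = (\<lambda>(f, g). g),
     Id = (\<lambda>g. (Id C (Dom C g), g)),
     Comp = (\<lambda>(f', g') (f, g). (Comp C f' f, g'))\<rparr>"

definition connected_rel :: "('o, 'a, 'z) cat_scheme \<Rightarrow> ('o \<times> 'o) set" where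
  "connected_rel C =
     {(x, y). x \<in> Obj C \<and> (x, y) \<in> ({(x, y). Hom C x y \<noteq> {}} \<union> {(x, y). Hom C y x \<noteq> {}})\<^sup>*}"

definition pi0 :: "('o, 'a, 'z) cat_scheme \<Rightarrow> 'o set set" where
  "pi0 C = Obj C // connected_rel C"

definition pi0_map :: "('p, 'b, 'z) cat_scheme \<Rightarrow> ('o \<Rightarrow> 'p) \<Rightarrow> 'o set \<Rightarrow> 'p set" where
  "pi0_map D F c = connected_rel D `` (F ` c)"


section \<open>Limits and colimits\<close>

definition is_cone :: "('i, 'j, 'y) cat_scheme \<Rightarrow> ('o, 'a, 'z) cat_scheme
    \<Rightarrow> ('i, 'j, 'o, 'a) ftor \<Rightarrow> 'o \<Rightarrow> ('i \<Rightarrow> 'a) \<Rightarrow> bool" where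
  "is_cone J C D x l \<longleftrightarrow> x \<in> Obj C \<and> (\<forall>i \<in> Obj J. l i \<in> Hom C x (ObjMap D i)) \<and>
     (\<forall>u \<in> Arr J. Comp C (ArrMap D u) (l (Dom J u)) = l (Cod J u))"

definition is_limit :: "('i, 'j, 'y) cat_scheme \<Rightarrow> ('o, 'a, 'z) cat_scheme
    \<Rightarrow> ('i, 'j, 'o, 'a) ftor \<Rightarrow> 'o \<Rightarrow> ('i \<Rightarrow> 'a) \<Rightarrow> bool" where
  "is_limit J C D x l \<longleftrightarrow> is_cone J C D x l \<and>
     (\<forall>y m. is_cone J C D y m \<longrightarrow> (\<exists>!h. h \<in> Hom C y x \<and> (\<forall>i \<in> Obj J. Comp C (l i) h = m i)))"

definition is_cocone :: "('i, 'j, 'y) cat_scheme \<Rightarrow> ('o, 'a, 'z) cat_scheme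
    \<Rightarrow> ('i, 'j, 'o, 'a) ftor \<Rightarrow> 'o \<Rightarrow> ('i \<Rightarrow> 'a) \<Rightarrow> bool" where
  "is_cocone J C D x l \<longleftrightarrow> x \<in> Obj C \<and> (\<forall>i \<in> Obj J. l i \<in> Hom C (ObjMap D i) x) \<and>
     (\<forall>u \<in> Arr J. Comp C (l (Cod J u)) (ArrMap D u) = l (Dom J u))"

definition is_colimit :: "('i, 'j, 'y) cat_scheme \<Rightarrow> ('o, 'a, 'z) cat_scheme
    \<Rightarrow> ('i, 'j, 'o, 'a) ftor \<Rightarrow> 'o \<Rightarrow> ('i \<Rightarrow> 'a) \<Rightarrow> bool" where
  "is_colimit J C D x l \<longleftrightarrow> is_cocone J C D x l \<and>
     (\<forall>y m. is_cocone J C D y m \<longrightarrow> (\<exists>!h. h \<in> Hom C x y \<and> (\<forall>i \<in> Obj J. Comp C h (l i) = m i)))"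

text \<open>
  A type \<open>'u\<close> plays the role of the universe of small sets: a small category is one whose objects
  and arrows are elements of \<open>'u\<close>.  The ambient category need not be small (a category with all
  limits of the size of its own set of arrows would be a preorder).
\<close>

definition complete_cat :: "'u itself \<Rightarrow> ('o, 'a, 'z) cat_scheme \<Rightarrow> bool" where
  "complete_cat _ C \<longleftrightarrow> (\<forall>(J :: ('u, 'u) cat) D. cat_functor J C D \<longrightarrow> (\<exists>x l. is_limit J C D x l))"

definition cocomplete_cat :: "'u itself \<Rightarrow> ('o, 'a, 'z) cat_scheme \<Rightarrow> bool" where
  "cocomplete_cat _ C \<longleftrightarrow>
     (\<forall>(J :: ('u, 'u) cat) D. cat_functor J C D \<longrightarrow> (\<exists>x l. is_colimit J C D x l))"


section \<open>Closed symmetric monoidal categories\<close>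

record ('o, 'a) smcat = "('o, 'a) cat" +
  Ten :: "'o \<Rightarrow> 'o \<Rightarrow> 'o"
  TenA :: "'a \<Rightarrow> 'a \<Rightarrow> 'a"
  Unit :: "'o"
  Assoc :: "'o \<Rightarrow> 'o \<Rightarrow> 'o \<Rightarrow> 'a"
  LUnit :: "'o \<Rightarrow> 'a"
  RUnit :: "'o \<Rightarrow> 'a"
  Symm :: "'o \<Rightarrow> 'o \<Rightarrow> 'a"

locale symmetric_monoidal_category = category V
  for V :: "('v, 'w, 'z) smcat_scheme" +
  assumes ten_obj: "x \<in> Obj V \<Longrightarrow> y \<in> Obj V \<Longrightarrow> Ten V x y \<in> Obj V"
    and ten_arr: "f \<in> Hom V x x' \<Longrightarrow> g \<in> Hom V y y'
      \<Longrightarrow> TenA V f g \<in> Hom V (Ten V x y) (Ten V x' y')"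
    and ten_id: "x \<in> Obj V \<Longrightarrow> y \<in> Obj V \<Longrightarrow> TenA V (Id V x) (Id V y) = Id V (Ten V x y)"
    and ten_comp: "f \<in> Hom V x x' \<Longrightarrow> f' \<in> Hom V x' x'' \<Longrightarrow> g \<in> Hom V y y' \<Longrightarrow> g' \<in> Hom V y' y''
      \<Longrightarrow> TenA V (Comp V f' f) (Comp V g' g) = Comp V (TenA V f' g') (TenA V f g)"
    and unit_obj: "Unit V \<in> Obj V"
    and assoc_in: "x \<in> Obj V \<Longrightarrow> y \<in> Obj V \<Longrightarrow> z \<in> Obj V
      \<Longrightarrow> Assoc V x y z \<in> Hom V (Ten V (Ten V x y) z) (Ten V x (Ten V y z))"
    and assoc_iso: "x \<in> Obj V \<Longrightarrow> y \<in> Obj V \<Longrightarrow> z \<in> Obj V \<Longrightarrow> iso_arrow V (Assoc V x y z)"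
    and assoc_nat: "f \<in> Hom V x x' \<Longrightarrow> g \<in> Hom V y y' \<Longrightarrow> h \<in> Hom V z z'
      \<Longrightarrow> Comp V (Assoc V x' y' z') (TenA V (TenA V f g) h)
        = Comp V (TenA V f (TenA V g h)) (Assoc V x y z)"
    and lunit_in: "x \<in> Obj V \<Longrightarrow> LUnit V x \<in> Hom V (Ten V (Unit V) x) x"
    and lunit_iso: "x \<in> Obj V \<Longrightarrow> iso_arrow V (LUnit V x)"
    and lunit_nat: "f \<in> Hom V x x'
      \<Longrightarrow> Comp V (LUnit V x') (TenA V (Id V (Unit V)) f) = Comp V f (LUnit V x)"
    and runit_in: "x \<in> Obj V \<Longrightarrow> RUnit V x \<in> Hom V (Ten V x (Unit V)) x"
    and runit_iso: "x \<in> Obj V \<Longrightarrow> iso_arrow V (RUnit V x)"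
    and runit_nat: "f \<in> Hom V x x'
      \<Longrightarrow> Comp V (RUnit V x') (TenA V f (Id V (Unit V))) = Comp V f (RUnit V x)"
    and symm_in: "x \<in> Obj V \<Longrightarrow> y \<in> Obj V \<Longrightarrow> Symm V x y \<in> Hom V (Ten V x y) (Ten V y x)"
    and symm_nat: "f \<in> Hom V x x' \<Longrightarrow> g \<in> Hom V y y'
      \<Longrightarrow> Comp V (Symm V x' y') (TenA V f g) = Comp V (TenA V g f) (Symm V x y)"
    and symm_symm: "x \<in> Obj V \<Longrightarrow> y \<in> Obj V
      \<Longrightarrow> Comp V (Symm V y x) (Symm V x y) = Id V (Ten V x y)"
    and pentagon: "w \<in> Obj V \<Longrightarrow> x \<in> Obj V \<Longrightarrow> y \<in> Obj V \<Longrightarrow> z \<in> Obj V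
      \<Longrightarrow> Comp V (Assoc V w x (Ten V y z)) (Assoc V (Ten V w x) y z)
        = Comp V (TenA V (Id V w) (Assoc V x y z))
            (Comp V (Assoc V w (Ten V x y) z) (TenA V (Assoc V w x y) (Id V z)))"
    and triangle: "x \<in> Obj V \<Longrightarrow> y \<in> Obj V
      \<Longrightarrow> Comp V (TenA V (Id V x) (LUnit V y)) (Assoc V x (Unit V) y)
        = TenA V (RUnit V x) (Id V y)"
    and hexagon: "x \<in> Obj V \<Longrightarrow> y \<in> Obj V \<Longrightarrow> z \<in> Obj V
      \<Longrightarrow> Comp V (Assoc V y z x) (Comp V (Symm V x (Ten V y z)) (Assoc V x y z))
        = Comp V (TenA V (Id V y) (Symm V x z))
            (Comp V (Assoc V y x z) (TenA V (Symm V x y) (Id V z)))"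

definition closed_monoidal :: "('v, 'w, 'z) smcat_scheme \<Rightarrow> bool" where
  "closed_monoidal V \<longleftrightarrow> (\<forall>x \<in> Obj V. \<forall>y \<in> Obj V. \<exists>e \<in> Obj V. \<exists>ev \<in> Hom V (Ten V e x) y.
     \<forall>z \<in> Obj V. \<forall>f \<in> Hom V (Ten V z x) y.
       \<exists>!g. g \<in> Hom V z e \<and> Comp V ev (TenA V g (Id V x)) = f)"

subsection \<open>Iterated tensor products and their coherence isomorphisms\<close>

text \<open>
  Finite tensor products are bracketed to the right and end in the unit.  Each of the isomorphisms
  below is composed of the structure isomorphisms of \<open>V\<close>, so by Mac Lane's coherence theorem it is
  the canonical one for the permutation of factors that it realises.
\<close>

fun tens :: "('v, 'w, 'z) smcat_scheme \<Rightarrow> 'v list \<Rightarrow> 'v" where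
  "tens V [] = Unit V"
| "tens V (x # xs) = Ten V x (tens V xs)"

fun tensA :: "('v, 'w, 'z) smcat_scheme \<Rightarrow> 'w list \<Rightarrow> 'w" where
  "tensA V [] = Id V (Unit V)"
| "tensA V (f # fs) = TenA V f (tensA V fs)"

text \<open>\<open>I \<rightarrow> I \<otimes> \<dots> \<otimes> I\<close>\<close>

fun unit_iso :: "('v, 'w, 'z) smcat_scheme \<Rightarrow> nat \<Rightarrow> 'w" where
  "unit_iso V 0 = Id V (Unit V)"
| "unit_iso V (Suc n) =
     Comp V (TenA V (Id V (Unit V)) (unit_iso V n)) (inv_arrow V (LUnit V (Unit V)))"

text \<open>\<open>(\<Otimes> xs) \<otimes> (\<Otimes> ys) \<rightarrow> \<Otimes> (xs @ ys)\<close>\<close>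

fun append_iso :: "('v, 'w, 'z) smcat_scheme \<Rightarrow> 'v list \<Rightarrow> 'v list \<Rightarrow> 'w" where
  "append_iso V [] ys = LUnit V (tens V ys)"
| "append_iso V (x # xs) ys =
     Comp V (TenA V (Id V x) (append_iso V xs ys)) (Assoc V x (tens V xs) (tens V ys))"

text \<open>\<open>\<Otimes> (map \<Otimes> xss) \<rightarrow> \<Otimes> (concat xss)\<close>\<close>

fun concat_iso :: "('v, 'w, 'z) smcat_scheme \<Rightarrow> 'v list list \<Rightarrow> 'w" where
  "concat_iso V [] = Id V (Unit V)"
| "concat_iso V (xs # xss) =
     Comp V (append_iso V xs (concat xss)) (TenA V (Id V (tens V xs)) (concat_iso V xss))"

text \<open>\<open>x \<otimes> (y \<otimes> z) \<rightarrow> y \<otimes> (x \<otimes> z)\<close>\<close>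

definition swap_iso :: "('v, 'w, 'z) smcat_scheme \<Rightarrow> 'v \<Rightarrow> 'v \<Rightarrow> 'v \<Rightarrow> 'w" where
  "swap_iso V x y z =
     Comp V (Assoc V y x z) (Comp V (TenA V (Symm V x y) (Id V z)) (inv_arrow V (Assoc V x y z)))"

text \<open>\<open>X k \<otimes> (\<Otimes> (map X ks)) \<rightarrow> \<Otimes> (map X (insort k ks))\<close>\<close>

fun insort_iso :: "('v, 'w, 'z) smcat_scheme \<Rightarrow> (nat \<Rightarrow> 'v) \<Rightarrow> nat \<Rightarrow> nat list \<Rightarrow> 'w" where
  "insort_iso V X k [] = Id V (tens V [X k])"
| "insort_iso V X k (l # ls) =
     (if k \<le> l then Id V (tens V (map X (k # l # ls)))
      else Comp V (TenA V (Id V (X l)) (insort_iso V X k ls)) (swap_iso V (X k) (X l) (tens V (map X ls))))"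

text \<open>\<open>\<Otimes> (map X ks) \<rightarrow> \<Otimes> (map X (sort ks))\<close>\<close>

fun sort_iso :: "('v, 'w, 'z) smcat_scheme \<Rightarrow> (nat \<Rightarrow> 'v) \<Rightarrow> nat list \<Rightarrow> 'w" where
  "sort_iso V X [] = Id V (Unit V)"
| "sort_iso V X (k # ks) =
     Comp V (insort_iso V X k (sort ks)) (TenA V (Id V (X k)) (sort_iso V X ks))"

text \<open>\<open>(\<Otimes>\<^sub>i x\<^sub>i) \<otimes> (\<Otimes>\<^sub>i y\<^sub>i) \<rightarrow> \<Otimes>\<^sub>i (x\<^sub>i \<otimes> y\<^sub>i)\<close> for lists of equal length\<close>

fun zip_iso :: "('v, 'w, 'z) smcat_scheme \<Rightarrow> 'v list \<Rightarrow> 'v list \<Rightarrow> 'w" where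
  "zip_iso V (x # xs) (y # ys) =
     Comp V (TenA V (Id V (Ten V x y)) (zip_iso V xs ys))
       (Comp V (inv_arrow V (Assoc V x y (Ten V (tens V xs) (tens V ys))))
         (Comp V (TenA V (Id V x) (swap_iso V (tens V xs) y (tens V ys)))
           (Assoc V x (tens V xs) (Ten V y (tens V ys)))))"
| "zip_iso V _ _ = LUnit V (Unit V)"


section \<open>Operadic categories\<close>

text \<open>
  The object \<open>n\<close> of \<open>sFSet\<close> is the set \<open>{1..n}\<close>; an arrow is a triple \<open>(m, \<phi>, n)\<close> with
  \<open>\<phi> : {1..m} \<rightarrow> {1..n}\<close>.
\<close>

type_synonym sfarr = "nat \<times> (nat \<Rightarrow> nat) \<times> nat"

definition sFSet :: "(nat, sfarr) cat" where
  "sFSet = \<lparr>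
     Obj = UNIV,
     Arr = {(m, \<phi>, n). \<phi> \<in> {1..m} \<rightarrow>\<^sub>E {1..n}},
     Dom = (\<lambda>(m, \<phi>, n). m),
     Cod = (\<lambda>(m, \<phi>, n). n),
     Id = (\<lambda>n. (n, \<lambda>k\<in>{1..n}. k, n)),
     Comp = (\<lambda>(m', \<psi>, n') (m, \<phi>, n). (m, \<lambda>k\<in>{1..m}. \<psi> (\<phi> k), n'))\<rparr>"

text \<open>
  The preimage of \<open>i\<close> in increasing order, so that its \<open>k\<close>-th entry corresponds to the point \<open>k\<close> of
  the fiber, and conversely the point of the fiber over \<open>\<phi> j\<close> that corresponds to \<open>j\<close>.
\<close>

fun sfib_list :: "sfarr \<Rightarrow> nat \<Rightarrow> nat list" where
  "sfib_list (m, \<phi>, n) i = filter (\<lambda>k. \<phi> k = i) [1..<Suc m]"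

fun sfib_pos :: "sfarr \<Rightarrow> nat \<Rightarrow> nat" where
  "sfib_pos (m, \<phi>, n) j = card {k \<in> {1..j}. \<phi> k = \<phi> j}"

definition sfib :: "sfarr \<Rightarrow> nat \<Rightarrow> nat" where
  "sfib a i = length (sfib_list a i)"

definition sfib_map :: "sfarr \<Rightarrow> sfarr \<Rightarrow> nat \<Rightarrow> sfarr" where
  "sfib_map a b i =
     (let ks = sfib_list (Comp sFSet b a) i
      in (length ks, \<lambda>k\<in>{1..length ks}. sfib_pos b (fst (snd a) (ks ! (k - 1))), sfib b i))"

record ('o, 'a) opcat = "('o, 'a) cat" +
  Card :: "('o, 'a, nat, sfarr) ftor"
  Term :: "'o set \<Rightarrow> 'o"  (* the chosen terminal object of a component *)
  Fib :: "'a \<Rightarrow> nat \<Rightarrow> 'o"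
  FibMap :: "'a \<Rightarrow> 'a \<Rightarrow> nat \<Rightarrow> 'a"  (* FibMap f g i is the map from (gf)^{-1}(i) to g^{-1}(i) *)

abbreviation size_of :: "('o, 'a, 'z) opcat_scheme \<Rightarrow> 'o \<Rightarrow> nat" where
  "size_of A T \<equiv> ObjMap (Card A) T"

definition pts :: "('o, 'a, 'z) opcat_scheme \<Rightarrow> 'o \<Rightarrow> nat set" where
  "pts A T = {1..size_of A T}"

definition pts_list :: "('o, 'a, 'z) opcat_scheme \<Rightarrow> 'o \<Rightarrow> nat list" where
  "pts_list A T = [1..<Suc (size_of A T)]"

definition pt_map :: "('o, 'a, 'z) opcat_scheme \<Rightarrow> 'a \<Rightarrow> nat \<Rightarrow> nat" where
  "pt_map A f = fst (snd (ArrMap (Card A) f))"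

definition pt_pos :: "('o, 'a, 'z) opcat_scheme \<Rightarrow> 'a \<Rightarrow> nat \<Rightarrow> nat" where
  "pt_pos A f = sfib_pos (ArrMap (Card A) f)"

locale operadic_category = category A
  for A :: "('o, 'a, 'z) opcat_scheme" +
  assumes card_functor: "cat_functor A sFSet (Card A)"
    and term_in: "c \<in> pi0 A \<Longrightarrow> Term A c \<in> c"
    and term_terminal: "c \<in> pi0 A \<Longrightarrow> T \<in> c \<Longrightarrow> \<exists>!f. f \<in> Hom A T (Term A c)"
    and term_card: "c \<in> pi0 A \<Longrightarrow> size_of A (Term A c) = 1"
    and fib_obj: "f \<in> Hom A T S \<Longrightarrow> i \<in> pts A S \<Longrightarrow> Fib A f i \<in> Obj A"
    and fib_card: "f \<in> Hom A T S \<Longrightarrow> i \<in> pts A S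
      \<Longrightarrow> size_of A (Fib A f i) = sfib (ArrMap (Card A) f) i"
    and fib_id: "T \<in> Obj A \<Longrightarrow> i \<in> pts A T \<Longrightarrow> Fib A (Id A T) i \<in> Term A ` pi0 A"
    and fibmap_card: "f \<in> Hom A T S \<Longrightarrow> g \<in> Hom A S R \<Longrightarrow> i \<in> pts A R
      \<Longrightarrow> ArrMap (Card A) (FibMap A f g i) = sfib_map (ArrMap (Card A) f) (ArrMap (Card A) g) i"
    and fib_functor: "R \<in> Obj A \<Longrightarrow> i \<in> pts A R
      \<Longrightarrow> cat_functor (slice A R) A
            \<lparr>ObjMap = (\<lambda>g. Fib A g i), ArrMap = (\<lambda>(f, g). FibMap A f g i)\<rparr>"
    and fib_term: "c \<in> pi0 A \<Longrightarrow> g \<in> Hom A S (Term A c) \<Longrightarrow> Fib A g 1 = S"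
    and fibmap_term: "c \<in> pi0 A \<Longrightarrow> f \<in> Hom A T S \<Longrightarrow> g \<in> Hom A S (Term A c)
      \<Longrightarrow> FibMap A f g 1 = f"
    \<comment> \<open>A point \<open>j\<close> of \<open>S\<close> is the point \<open>pt_pos A g j\<close> of the fiber of \<open>g\<close> containing it.\<close>
    and fib_fib: "f \<in> Hom A T S \<Longrightarrow> g \<in> Hom A S R \<Longrightarrow> j \<in> pts A S
      \<Longrightarrow> Fib A f j = Fib A (FibMap A f g (pt_map A g j)) (pt_pos A g j)"
    and fibmap_fibmap: "f \<in> Hom A T S \<Longrightarrow> a \<in> Hom A S Q \<Longrightarrow> b \<in> Hom A Q R \<Longrightarrow> j \<in> pts A Q
      \<Longrightarrow> FibMap A (FibMap A f (Comp A b a) (pt_map A b j)) (FibMap A a b (pt_map A b j)) (pt_pos A b j)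
        = FibMap A f a j"

locale operadic_functor =
  cat_functor A B F + dom_op: operadic_category A + cod_op: operadic_category B
  for A :: "('o, 'a, 'y) opcat_scheme" and B :: "('p, 'b, 'z) opcat_scheme"
    and F :: "('o, 'a, 'p, 'b) ftor" +
  assumes over_obj: "T \<in> Obj A \<Longrightarrow> size_of B (ObjMap F T) = size_of A T"
    and over_arr: "f \<in> Arr A \<Longrightarrow> ArrMap (Card B) (ArrMap F f) = ArrMap (Card A) f"
    and map_fib: "f \<in> Hom A T S \<Longrightarrow> i \<in> pts A S \<Longrightarrow> ObjMap F (Fib A f i) = Fib B (ArrMap F f) i"
    and map_fibmap: "f \<in> Hom A T S \<Longrightarrow> g \<in> Hom A S R \<Longrightarrow> i \<in> pts A R
      \<Longrightarrow> ArrMap F (FibMap A f g i) = FibMap B (ArrMap F f) (ArrMap F g) i"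
    and map_term: "c \<in> pi0 A \<Longrightarrow> ObjMap F (Term A c) = Term B (pi0_map B (ObjMap F) c)"

locale discrete_operadic_fibration = operadic_functor A B F
  for A :: "('o, 'a, 'y) opcat_scheme" and B :: "('p, 'b, 'z) opcat_scheme"
    and F :: "('o, 'a, 'p, 'b) ftor" +
  assumes pi0_surj: "pi0_map B (ObjMap F) ` pi0 A = pi0 B"
    and unique_lift: "f \<in> Hom B T S \<Longrightarrow> s \<in> Obj A \<Longrightarrow> ObjMap F s = S
      \<Longrightarrow> (\<And>i. i \<in> pts B S \<Longrightarrow> t i \<in> Obj A \<and> ObjMap F (t i) = Fib B f i)
      \<Longrightarrow> \<exists>!\<sigma>. \<sigma> \<in> Arr A \<and> Cod A \<sigma> = s \<and> ArrMap F \<sigma> = f \<and> (\<forall>i \<in> pts B S. Fib A \<sigma> i = t i)"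

definition opcat_pullback :: "('o, 'a) opcat \<Rightarrow> ('q, 'c) opcat
    \<Rightarrow> ('o, 'a, 'p, 'b) ftor \<Rightarrow> ('q, 'c, 'p, 'b) ftor \<Rightarrow> ('o \<times> 'q, 'a \<times> 'c) opcat" where
  "opcat_pullback A B F G = \<lparr>
     Obj = {(x, y). x \<in> Obj A \<and> y \<in> Obj B \<and> ObjMap F x = ObjMap G y},
     Arr = {(f, g). f \<in> Arr A \<and> g \<in> Arr B \<and> ArrMap F f = ArrMap G g},
     Dom = (\<lambda>(f, g). (Dom A f, Dom B g)),
     Cod = (\<lambda>(f, g). (Cod A f, Cod B g)),
     Id = (\<lambda>(x, y). (Id A x, Id B y)),
     Comp = (\<lambda>(f', g') (f, g). (Comp A f' f, Comp B g' g)),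
     \<comment> \<open>the two components of an object or arrow have the same cardinality\<close>
     Card = \<lparr>ObjMap = (\<lambda>(x, y). ObjMap (Card A) x), ArrMap = (\<lambda>(f, g). ArrMap (Card A) f)\<rparr>,
     Term = (\<lambda>c. (Term A (pi0_map A fst c), Term B (pi0_map B snd c))),
     Fib = (\<lambda>(f, g) i. (Fib A f i, Fib B g i)),
     FibMap = (\<lambda>(f, g) (f', g') i. (FibMap A f f' i, FibMap B g g' i))\<rparr>"

definition pair_ftor :: "('r, 'd, 'o, 'a) ftor \<Rightarrow> ('r, 'd, 'q, 'c) ftor
    \<Rightarrow> ('r, 'd, 'o \<times> 'q, 'a \<times> 'c) ftor" where
  "pair_ftor F G =
     \<lparr>ObjMap = (\<lambda>x. (ObjMap F x, ObjMap G x)), ArrMap = (\<lambda>f. (ArrMap F f, ArrMap G f))\<rparr>"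

definition operadic_iso :: "('o, 'a, 'y) opcat_scheme \<Rightarrow> ('p, 'b, 'z) opcat_scheme
    \<Rightarrow> ('o, 'a, 'p, 'b) ftor \<Rightarrow> bool" where
  "operadic_iso A B F \<longleftrightarrow> operadic_functor A B F \<and>
     bij_betw (ObjMap F) (Obj A) (Obj B) \<and> bij_betw (ArrMap F) (Arr A) (Arr B)"

text \<open>
  \<open>pullback_square R A B P r s F G\<close>: the square with top \<open>r : R \<rightarrow> A\<close>, left \<open>s : R \<rightarrow> B\<close>, right
  \<open>F : A \<rightarrow> P\<close> and bottom \<open>G : B \<rightarrow> P\<close> commutes and identifies \<open>R\<close> with the pullback.
\<close>

definition pullback_square :: "('r, 'd) opcat \<Rightarrow> ('o, 'a) opcat \<Rightarrow> ('q, 'c) opcat \<Rightarrow> ('p, 'b) opcat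
    \<Rightarrow> ('r, 'd, 'o, 'a) ftor \<Rightarrow> ('r, 'd, 'q, 'c) ftor
    \<Rightarrow> ('o, 'a, 'p, 'b) ftor \<Rightarrow> ('q, 'c, 'p, 'b) ftor \<Rightarrow> bool" where
  "pullback_square R A B P r s F G \<longleftrightarrow>
     operadic_functor R A r \<and> operadic_functor R B s \<and>
     operadic_functor A P F \<and> operadic_functor B P G \<and>
     (\<forall>x \<in> Obj R. ObjMap F (ObjMap r x) = ObjMap G (ObjMap s x)) \<and>
     (\<forall>f \<in> Arr R. ArrMap F (ArrMap r f) = ArrMap G (ArrMap s f)) \<and>
     operadic_iso R (opcat_pullback A B F G) (pair_ftor r s)"


section \<open>Operads over an operadic category\<close>

record ('o, 'a, 'v, 'w) operad =
  Op :: "'o \<Rightarrow> 'v"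
  Eta :: "'o set \<Rightarrow> 'w"
  Mu :: "'a \<Rightarrow> 'w"

text \<open>The list of factors of \<open>P(f)\<close>\<close>

definition fib_factors :: "('o, 'a, 'z) opcat_scheme \<Rightarrow> ('o, 'a, 'v, 'w) operad \<Rightarrow> 'a \<Rightarrow> 'v list" where
  "fib_factors A P f = map (\<lambda>i. Op P (Fib A f i)) (pts_list A (Cod A f))"

definition op_fib :: "('v, 'w, 'y) smcat_scheme \<Rightarrow> ('o, 'a, 'z) opcat_scheme
    \<Rightarrow> ('o, 'a, 'v, 'w) operad \<Rightarrow> 'a \<Rightarrow> 'v" where
  "op_fib V A P f = tens V (fib_factors A P f)"

text \<open>
  The isomorphism \<open>\<Otimes>\<^sub>i P(f\<^sub>i) \<rightarrow> P(f)\<close>: remove the brackets, which leaves the factors \<open>P(f\<^sup>-\<^sup>1(k))\<close>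
  with the points \<open>k\<close> grouped by their image under \<open>g\<close>, and sort by \<open>k\<close>.
\<close>

definition regroup_iso :: "('v, 'w, 'y) smcat_scheme \<Rightarrow> ('o, 'a, 'z) opcat_scheme
    \<Rightarrow> ('o, 'a, 'v, 'w) operad \<Rightarrow> 'a \<Rightarrow> 'a \<Rightarrow> 'w" where
  "regroup_iso V A P f g =
     (let js = pts_list A (Cod A g) in
      Comp V (sort_iso V (\<lambda>k. Op P (Fib A f k)) (concat (map (sfib_list (ArrMap (Card A) g)) js)))
        (concat_iso V (map (\<lambda>i. fib_factors A P (FibMap A f g i)) js)))"

locale is_operad =
  symmetric_monoidal_category V + base: operadic_category A
  for V :: "('v, 'w, 'y) smcat_scheme" and A :: "('o, 'a, 'z) opcat_scheme"
    and P :: "('o, 'a, 'v, 'w) operad" +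
  assumes op_obj: "T \<in> Obj A \<Longrightarrow> Op P T \<in> Obj V"
    and eta_in: "c \<in> pi0 A \<Longrightarrow> Eta P c \<in> Hom V (Unit V) (Op P (Term A c))"
    and mu_in: "f \<in> Hom A T S \<Longrightarrow> Mu P f \<in> Hom V (Ten V (op_fib V A P f) (Op P S)) (Op P T)"
    \<comment> \<open>an equation between maps out of \<open>(\<Otimes>\<^sub>i P(f\<^sub>i) \<otimes> P(g)) \<otimes> P(R)\<close>\<close>
    and mu_assoc: "f \<in> Hom A T S \<Longrightarrow> g \<in> Hom A S R
      \<Longrightarrow> Comp V (Mu P f)
            (Comp V (TenA V (Id V (op_fib V A P f)) (Mu P g))
              (Comp V (Assoc V (op_fib V A P f) (op_fib V A P g) (Op P R))
                (TenA V (TenA V (regroup_iso V A P f g) (Id V (op_fib V A P g))) (Id V (Op P R)))))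
        = Comp V (Mu P (Comp A g f))
            (Comp V (TenA V (tensA V (map (\<lambda>i. Mu P (FibMap A f g i)) (pts_list A R))) (Id V (Op P R)))
              (TenA V (zip_iso V (map (\<lambda>i. op_fib V A P (FibMap A f g i)) (pts_list A R))
                                 (fib_factors A P g))
                      (Id V (Op P R))))"
    and mu_unit_left: "T \<in> Obj A
      \<Longrightarrow> Comp V (Mu P (Id A T))
            (Comp V (TenA V
                (Comp V
                  (tensA V (map (\<lambda>i. Eta P (connected_rel A `` {Fib A (Id A T) i})) (pts_list A T)))
                  (unit_iso V (size_of A T)))
                (Id V (Op P T)))
              (inv_arrow V (LUnit V (Op P T))))
        = Id V (Op P T)"
    \<comment> \<open>the fiber of \<open>f\<close> is \<open>T\<close> and \<open>P(f)\<close> is \<open>P(T) \<otimes> I\<close>\<close>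
    and mu_unit_right: "c \<in> pi0 A \<Longrightarrow> f \<in> Hom A T (Term A c)
      \<Longrightarrow> Comp V (Mu P f)
            (Comp V (TenA V (inv_arrow V (RUnit V (Op P T))) (Eta P c))
              (inv_arrow V (RUnit V (Op P T))))
        = Id V (Op P T)"
    \<comment> \<open>values off the domains are pinned down so that equality of operads is the intended one\<close>
    and ext: "Op P \<in> extensional (Obj A)" "Eta P \<in> extensional (pi0 A)" "Mu P \<in> extensional (Arr A)"

definition is_operad_map :: "('v, 'w, 'y) smcat_scheme \<Rightarrow> ('o, 'a, 'z) opcat_scheme
    \<Rightarrow> ('o, 'a, 'v, 'w) operad \<Rightarrow> ('o, 'a, 'v, 'w) operad \<Rightarrow> ('o \<Rightarrow> 'w) \<Rightarrow> bool" where
  "is_operad_map V A P P' \<phi> \<longleftrightarrow>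
     \<phi> \<in> extensional (Obj A) \<and>
     (\<forall>T \<in> Obj A. \<phi> T \<in> Hom V (Op P T) (Op P' T)) \<and>
     (\<forall>c \<in> pi0 A. Comp V (\<phi> (Term A c)) (Eta P c) = Eta P' c) \<and>
     (\<forall>f \<in> Arr A. Comp V (\<phi> (Dom A f)) (Mu P f)
        = Comp V (Mu P' f)
            (TenA V (tensA V (map (\<lambda>i. \<phi> (Fib A f i)) (pts_list A (Cod A f)))) (\<phi> (Cod A f))))"

type_synonym ('o, 'a, 'v, 'w) opmap =
  "('o, 'a, 'v, 'w) operad \<times> ('o \<Rightarrow> 'w) \<times> ('o, 'a, 'v, 'w) operad"

definition operad_cat :: "('v, 'w, 'y) smcat_scheme \<Rightarrow> ('o, 'a, 'z) opcat_scheme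
    \<Rightarrow> (('o, 'a, 'v, 'w) operad, ('o, 'a, 'v, 'w) opmap) cat" where
  "operad_cat V A = \<lparr>
     Obj = {P. is_operad V A P},
     Arr = {(P, \<phi>, P'). is_operad V A P \<and> is_operad V A P' \<and> is_operad_map V A P P' \<phi>},
     Dom = (\<lambda>(P, \<phi>, P'). P),
     Cod = (\<lambda>(P, \<phi>, P'). P'),
     Id = (\<lambda>P. (P, \<lambda>T\<in>Obj A. Id V (Op P T), P)),
     Comp = (\<lambda>(Q, \<psi>, Q') (P, \<phi>, P'). (P, \<lambda>T\<in>Obj A. Comp V (\<psi> T) (\<phi> T), Q'))\<rparr>"

definition restrict_operad :: "('o, 'a, 'y) opcat_scheme \<Rightarrow> ('p, 'b, 'z) opcat_scheme
    \<Rightarrow> ('o, 'a, 'p, 'b) ftor \<Rightarrow> ('p, 'b, 'v, 'w) operad \<Rightarrow> ('o, 'a, 'v, 'w) operad" where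
  "restrict_operad A B F P = \<lparr>
     Op = (\<lambda>T\<in>Obj A. Op P (ObjMap F T)),
     Eta = (\<lambda>c\<in>pi0 A. Eta P (pi0_map B (ObjMap F) c)),
     Mu = (\<lambda>f\<in>Arr A. Mu P (ArrMap F f))\<rparr>"

definition restriction :: "('o, 'a, 'y) opcat_scheme \<Rightarrow> ('p, 'b, 'z) opcat_scheme
    \<Rightarrow> ('o, 'a, 'p, 'b) ftor
    \<Rightarrow> (('p, 'b, 'v, 'w) operad, ('p, 'b, 'v, 'w) opmap,
        ('o, 'a, 'v, 'w) operad, ('o, 'a, 'v, 'w) opmap) ftor" where
  "restriction A B F = \<lparr>
     ObjMap = restrict_operad A B F,
     ArrMap = (\<lambda>(P, \<phi>, P').
       (restrict_operad A B F P, \<lambda>T\<in>Obj A. \<phi> (ObjMap F T), restrict_operad A B F P'))\<rparr>"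

text \<open>\<open>F\<^sub>!\<close>, the left adjoint of \<open>F\<^sup>*\<close>, with its unit and counit\<close>

definition shriek_data :: "('v, 'w, 'x) smcat_scheme \<Rightarrow> ('o, 'a, 'y) opcat_scheme
    \<Rightarrow> ('p, 'b, 'z) opcat_scheme \<Rightarrow> ('o, 'a, 'p, 'b) ftor
    \<Rightarrow> (('o, 'a, 'v, 'w) operad, ('o, 'a, 'v, 'w) opmap,
        ('p, 'b, 'v, 'w) operad, ('p, 'b, 'v, 'w) opmap) ftor
     \<times> (('o, 'a, 'v, 'w) operad \<Rightarrow> ('o, 'a, 'v, 'w) opmap)
     \<times> (('p, 'b, 'v, 'w) operad \<Rightarrow> ('p, 'b, 'v, 'w) opmap)" where
  "shriek_data V A B F = left_adjoint (operad_cat V A) (operad_cat V B) (restriction A B F)"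

definition shriek :: "('v, 'w, 'x) smcat_scheme \<Rightarrow> ('o, 'a, 'y) opcat_scheme
    \<Rightarrow> ('p, 'b, 'z) opcat_scheme \<Rightarrow> ('o, 'a, 'p, 'b) ftor
    \<Rightarrow> (('o, 'a, 'v, 'w) operad, ('o, 'a, 'v, 'w) opmap,
        ('p, 'b, 'v, 'w) operad, ('p, 'b, 'v, 'w) opmap) ftor" where
  "shriek V A B F = fst (shriek_data V A B F)"

definition shriek_unit :: "('v, 'w, 'x) smcat_scheme \<Rightarrow> ('o, 'a, 'y) opcat_scheme
    \<Rightarrow> ('p, 'b, 'z) opcat_scheme \<Rightarrow> ('o, 'a, 'p, 'b) ftor
    \<Rightarrow> ('o, 'a, 'v, 'w) operad \<Rightarrow> ('o, 'a, 'v, 'w) opmap" where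
  "shriek_unit V A B F = fst (snd (shriek_data V A B F))"

definition shriek_counit :: "('v, 'w, 'x) smcat_scheme \<Rightarrow> ('o, 'a, 'y) opcat_scheme
    \<Rightarrow> ('p, 'b, 'z) opcat_scheme \<Rightarrow> ('o, 'a, 'p, 'b) ftor
    \<Rightarrow> ('p, 'b, 'v, 'w) operad \<Rightarrow> ('p, 'b, 'v, 'w) opmap" where
  "shriek_counit V A B F = snd (snd (shriek_data V A B F))"

text \<open>
  The Beck--Chevalley transformation of a square \<open>F r = G s\<close>, namely
  \<open>s\<^sub>! r\<^sup>* P \<rightarrow> s\<^sub>! r\<^sup>* F\<^sup>* F\<^sub>! P = s\<^sub>! s\<^sup>* G\<^sup>* F\<^sub>! P \<rightarrow> G\<^sup>* F\<^sub>! P\<close>,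
  given by the unit for \<open>F\<close> and the counit for \<open>s\<close>.
\<close>

definition beck_chevalley :: "('v, 'w) smcat
    \<Rightarrow> ('r, 'd) opcat \<Rightarrow> ('o, 'a) opcat \<Rightarrow> ('q, 'c) opcat \<Rightarrow> ('p, 'b) opcat
    \<Rightarrow> ('r, 'd, 'o, 'a) ftor \<Rightarrow> ('r, 'd, 'q, 'c) ftor
    \<Rightarrow> ('o, 'a, 'p, 'b) ftor \<Rightarrow> ('q, 'c, 'p, 'b) ftor
    \<Rightarrow> ('o, 'a, 'v, 'w) operad \<Rightarrow> ('q, 'c, 'v, 'w) opmap" where
  "beck_chevalley V R A B C r s F G P =
     Comp (operad_cat V B)
       (shriek_counit V R B s (ObjMap (restriction B C G) (ObjMap (shriek V A C F) P)))
       (ArrMap (shriek V R B s) (ArrMap (restriction R A r) (shriek_unit V A C F P)))"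

end

theory Submission
  imports Defs
begin

text \<open>
  For a discrete operadic fibration \<open>F : A \<rightarrow> B\<close> a map of operads \<open>P \<rightarrow> F\<^sup>*Q\<close> is universal from \<open>P\<close> to \<open>F\<^sup>*\<close> if
  and only if its components \<open>P(t) \<rightarrow> Q(F t)\<close> exhibit every \<open>Q(T)\<close> as the coproduct of the \<open>P(t)\<close> with \<open>F t = T\<close>.
  Indeed, as the tensor product preserves coproducts in both variables, \<open>Q(f) \<otimes> Q(S)\<close> is then the coproduct of the
  \<open>P(\<sigma>) \<otimes> P(s)\<close> over all \<open>\<sigma> : t \<rightarrow> s\<close> above \<open>f : T \<rightarrow> S\<close>, since such \<open>\<sigma>\<close> amount to a choice of \<open>s\<close> above \<open>S\<close> and of
  objects above the fibers of \<open>f\<close>.  Structure maps on \<open>Q\<close> and the equations between them are therefore determined by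
  those of \<open>P\<close>.  The condition on components is visibly stable under pullback, so the restriction of the unit
  \<open>P \<rightarrow> \<pi>\<^sup>*\<pi>\<^sub>!P\<close> along \<open>r\<close> is again universal, and the Beck--Chevalley map is the comparison of two universal arrows.
\<close>

section \<open>Commutative squares\<close>

text \<open>The obstacle is that the axioms are long composites of coherence isomorphisms and that
  the operad built on coproducts is known to satisfy them only at the end. Each side of an axiom is
  therefore treated as one formula in the operad, meaningful for structure maps without axioms
  (\<open>pre_operad\<close>), and shown to be natural in maps \<open>P(t) -> Q(F t)\<close> over
  \<open>F\<close>. An axiom for \<open>P\<close> then gives the one for \<open>Q\<close> after
  precomposition with jointly epic maps. For associativity the joint epicity takes most care:
  objects chosen above \<open>R\<close>, above the fibers of \<open>g\<close> and above the fibers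
  of all \<open>f_i\<close> must come from a composable pair of lifts. Units are indexed by
  components, so the fibration must be injective on components as well; this is extracted from lifts
  of identities of chosen terminal objects. Moreover \<open>shriek\<close> is a chosen adjoint, so
  its unit is known only up to comparison with an explicit coproduct; and \<open>\<R>\<close> has
  types of its own, so its coproducts are indexed in \<open>'u\<close> through the bijection of its
  fibers with fibers of \<open>\<pi>\<close>.\<close>

lemma hom_iff: "f \<in> Hom C x y \<longleftrightarrow> f \<in> Arr C \<and> Dom C f = x \<and> Cod C f = y"
  by (simp add: Hom_def)

context category
begin

lemma comp_arr: "\<lbrakk>f \<in> Arr C; g \<in> Arr C; Cod C f = Dom C g\<rbrakk> \<Longrightarrow> Comp C g f \<in> Arr C"
  and dom_comp: "\<lbrakk>f \<in> Arr C; g \<in> Arr C; Cod C f = Dom C g\<rbrakk> \<Longrightarrow> Dom C (Comp C g f) = Dom C f"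
  and cod_comp: "\<lbrakk>f \<in> Arr C; g \<in> Arr C; Cod C f = Dom C g\<rbrakk> \<Longrightarrow> Cod C (Comp C g f) = Cod C g"
  using comp_in[of f "Dom C f" "Cod C f" g "Cod C g"] by (auto simp: hom_iff)

lemma id_arr: "x \<in> Obj C \<Longrightarrow> Id C x \<in> Arr C"
  and dom_id: "x \<in> Obj C \<Longrightarrow> Dom C (Id C x) = x"
  and cod_id: "x \<in> Obj C \<Longrightarrow> Cod C (Id C x) = x"
  using id_in[of x] by (auto simp: hom_iff)

lemma id_comp: "\<lbrakk>f \<in> Arr C; Cod C f = y\<rbrakk> \<Longrightarrow> Comp C (Id C y) f = f"
  and comp_id: "\<lbrakk>f \<in> Arr C; Dom C f = x\<rbrakk> \<Longrightarrow> Comp C f (Id C x) = f"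
  using comp_id_left[of f x y] comp_id_left comp_id_right by (auto simp: hom_iff)

lemma comp_assoc_right: "\<lbrakk>f \<in> Arr C; g \<in> Arr C; h \<in> Arr C; Cod C f = Dom C g; Cod C g = Dom C h\<rbrakk>
    \<Longrightarrow> Comp C (Comp C h g) f = Comp C h (Comp C g f)"
  using comp_assoc[of f "Dom C f" "Cod C f" g "Cod C g" h "Cod C h"] by (auto simp: hom_iff)

lemmas cat_simps = hom_iff dom_in cod_in comp_arr dom_comp cod_comp id_arr dom_id cod_id id_comp comp_id
  comp_assoc_right

lemma inverse_arrows_unique:
  assumes "inverse_arrows C f g" "inverse_arrows C f h" shows "g = h"
proof -
  have "Comp C g (Comp C f h) = Comp C (Comp C g f) h"
    using assms by (intro comp_assoc) (auto simp: inverse_arrows_def)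
  then show ?thesis using assms by (auto simp: inverse_arrows_def hom_iff id_comp comp_id)
qed

lemma inv_arrow_inverse: "iso_arrow C f \<Longrightarrow> inverse_arrows C f (inv_arrow C f)"
  unfolding iso_arrow_def inv_arrow_def by (metis inverse_arrows_unique the_equality)

lemma iso_arr: "iso_arrow C f \<Longrightarrow> f \<in> Arr C"
  and inv_arrow_in: "iso_arrow C f \<Longrightarrow> inv_arrow C f \<in> Hom C (Cod C f) (Dom C f)"
  and inv_arrow_left: "iso_arrow C f \<Longrightarrow> Comp C (inv_arrow C f) f = Id C (Dom C f)"
  and inv_arrow_right: "iso_arrow C f \<Longrightarrow> Comp C f (inv_arrow C f) = Id C (Cod C f)"
  using inv_arrow_inverse[of f] by (auto simp: inverse_arrows_def hom_iff)

end

text \<open>The pair \<open>(a, b)\<close> is a map from \<open>u\<close> to \<open>v\<close> in the arrow category.  Naturality of a composite of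
  structure maps is then a matter of composing and tensoring squares.\<close>

definition sq :: "('o, 'a, 'z) cat_scheme \<Rightarrow> 'a \<Rightarrow> 'a \<Rightarrow> 'a \<Rightarrow> 'a \<Rightarrow> bool" where
  "sq C a b u v \<longleftrightarrow> a \<in> Arr C \<and> b \<in> Arr C \<and> u \<in> Hom C (Dom C a) (Dom C b)
     \<and> v \<in> Hom C (Cod C a) (Cod C b) \<and> Comp C b u = Comp C v a"

context category
begin

lemma sqI: "\<lbrakk>a \<in> Hom C x x'; b \<in> Hom C y y'; u \<in> Hom C x y; v \<in> Hom C x' y'; Comp C b u = Comp C v a\<rbrakk>
    \<Longrightarrow> sq C a b u v"
  by (auto simp: sq_def hom_iff)

lemma sq_id: "a \<in> Hom C x y \<Longrightarrow> sq C a a (Id C x) (Id C y)"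
  by (auto simp: sq_def cat_simps)

lemma sq_comp:
  assumes "sq C a b u v" "sq C b c u' v'" shows "sq C a c (Comp C u' u) (Comp C v' v)"
proof -
  have h: "a \<in> Arr C" "b \<in> Arr C" "c \<in> Arr C" "u \<in> Hom C (Dom C a) (Dom C b)" "u' \<in> Hom C (Dom C b) (Dom C c)"
    "v \<in> Hom C (Cod C a) (Cod C b)" "v' \<in> Hom C (Cod C b) (Cod C c)"
    and e: "Comp C b u = Comp C v a" "Comp C c u' = Comp C v' b"
    using assms by (auto simp: sq_def)
  have "Comp C c (Comp C u' u) = Comp C (Comp C c u') u"
    using h by (subst comp_assoc_right) (auto simp: hom_iff)
  also have "\<dots> = Comp C v' (Comp C b u)"
    unfolding e(2) using h by (subst comp_assoc_right) (auto simp: hom_iff)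
  also have "\<dots> = Comp C (Comp C v' v) a"
    unfolding e(1) using h by (subst comp_assoc_right) (auto simp: hom_iff)
  finally show ?thesis using h by (auto simp: sq_def hom_iff comp_arr dom_comp cod_comp)
qed

text \<open>Inverses of associators and unitors occur in the coherence maps; a square whose
  structure maps are invertible can be read from \<open>b\<close> back to \<open>a\<close>.\<close>

lemma sq_inv:
  assumes "sq C a b u v" "iso_arrow C u" "iso_arrow C v"
  shows "sq C b a (inv_arrow C u) (inv_arrow C v)"
proof -
  note ui = assms(2)[THEN inv_arrow_in] assms(3)[THEN inv_arrow_in]
  have s: "a \<in> Arr C" "b \<in> Arr C" "u \<in> Hom C (Dom C a) (Dom C b)" "v \<in> Hom C (Cod C a) (Cod C b)"
    "Comp C b u = Comp C v a"
    using assms(1) by (auto simp: sq_def)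
  have "Comp C a (inv_arrow C u) = Comp C (Comp C (inv_arrow C v) v) (Comp C a (inv_arrow C u))"
    using s ui by (subst inv_arrow_left[OF assms(3)]) (auto simp: cat_simps)
  also have "\<dots> = Comp C (inv_arrow C v) (Comp C (Comp C v a) (inv_arrow C u))"
    using s ui by (auto simp: cat_simps)
  also have "\<dots> = Comp C (inv_arrow C v) (Comp C b (Comp C u (inv_arrow C u)))"
    unfolding s(5)[symmetric] using s(1-4) ui by (auto simp: cat_simps)
  also have "\<dots> = Comp C (inv_arrow C v) b"
    using s ui by (subst inv_arrow_right[OF assms(2)]) (auto simp: cat_simps)
  finally show ?thesis using s ui by (auto simp: sq_def hom_iff)
qed

text \<open>For restricted operads the comparison maps are identities, and a square between two
  structure maps then becomes an equation between them.\<close>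

lemma sq_identities_eq:
  assumes "sq C (Id C x) (Id C y) u v" "x \<in> Obj C" "y \<in> Obj C"
  shows "u = v"
proof -
  have "u \<in> Hom C x y" "v \<in> Hom C x y" "Comp C (Id C y) u = Comp C v (Id C x)"
    using assms by (auto simp: sq_def dom_id cod_id)
  then show ?thesis by (simp add: comp_id_left comp_id_right)
qed

end

section \<open>Naturality of iterated tensor products and of the coherence isomorphisms\<close>

context symmetric_monoidal_category
begin

lemma ten_arr_arr: "\<lbrakk>f \<in> Arr V; g \<in> Arr V\<rbrakk> \<Longrightarrow> TenA V f g \<in> Arr V"
  and dom_ten: "\<lbrakk>f \<in> Arr V; g \<in> Arr V\<rbrakk> \<Longrightarrow> Dom V (TenA V f g) = Ten V (Dom V f) (Dom V g)"
  and cod_ten: "\<lbrakk>f \<in> Arr V; g \<in> Arr V\<rbrakk> \<Longrightarrow> Cod V (TenA V f g) = Ten V (Cod V f) (Cod V g)"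
  using ten_arr[of f "Dom V f" "Cod V f" g "Dom V g" "Cod V g"] by (auto simp: hom_iff)

lemma interchange: "\<lbrakk>f \<in> Arr V; f' \<in> Arr V; g \<in> Arr V; g' \<in> Arr V; Cod V f = Dom V f'; Cod V g = Dom V g'\<rbrakk>
    \<Longrightarrow> Comp V (TenA V f' g') (TenA V f g) = TenA V (Comp V f' f) (Comp V g' g)"
  using ten_comp[of f "Dom V f" "Cod V f" f' "Cod V f'" g "Dom V g" "Cod V g" g' "Cod V g'"]
  by (auto simp: hom_iff)

lemmas mon_simps = cat_simps ten_obj unit_obj ten_arr_arr dom_ten cod_ten ten_id

lemma sq_ten:
  assumes "sq V a b u v" "sq V a' b' u' v'"
  shows "sq V (TenA V a a') (TenA V b b') (TenA V u u') (TenA V v v')"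
proof -
  have "Comp V (TenA V b b') (TenA V u u') = TenA V (Comp V b u) (Comp V b' u')"
    "Comp V (TenA V v v') (TenA V a a') = TenA V (Comp V v a) (Comp V v' a')"
    using assms by (auto simp: sq_def hom_iff interchange)
  then show ?thesis using assms by (auto simp: sq_def mon_simps)
qed

lemma inv_lunit_in: "x \<in> Obj V \<Longrightarrow> inv_arrow V (LUnit V x) \<in> Hom V x (Ten V (Unit V) x)"
  using inv_arrow_in[OF lunit_iso] lunit_in by (force simp: hom_iff)

lemma sq_assoc:
  assumes "f \<in> Hom V x x'" "g \<in> Hom V y y'" "h \<in> Hom V z z'"
  shows "sq V (TenA V (TenA V f g) h) (TenA V f (TenA V g h)) (Assoc V x y z) (Assoc V x' y' z')"
  using assms assoc_nat[OF assms] assoc_in[of x y z] assoc_in[of x' y' z']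
  by (auto simp: sq_def mon_simps)

lemma sq_inv_assoc:
  assumes "f \<in> Hom V x x'" "g \<in> Hom V y y'" "h \<in> Hom V z z'"
  shows "sq V (TenA V f (TenA V g h)) (TenA V (TenA V f g) h)
           (inv_arrow V (Assoc V x y z)) (inv_arrow V (Assoc V x' y' z'))"
  using assms by (intro sq_inv sq_assoc assoc_iso) (auto simp: cat_simps)

lemma sq_lunit:
  assumes "f \<in> Hom V x x'"
  shows "sq V (TenA V (Id V (Unit V)) f) f (LUnit V x) (LUnit V x')"
  using assms lunit_nat[OF assms] lunit_in[of x] lunit_in[of x'] by (auto simp: sq_def mon_simps)

lemma sq_inv_lunit:
  assumes "f \<in> Hom V x x'"
  shows "sq V f (TenA V (Id V (Unit V)) f) (inv_arrow V (LUnit V x)) (inv_arrow V (LUnit V x'))"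
  using assms by (intro sq_inv sq_lunit lunit_iso) (auto simp: cat_simps)

lemma sq_runit:
  assumes "f \<in> Hom V x x'"
  shows "sq V (TenA V f (Id V (Unit V))) f (RUnit V x) (RUnit V x')"
  using assms runit_nat[OF assms] runit_in[of x] runit_in[of x'] by (auto simp: sq_def mon_simps)

lemma sq_inv_runit:
  assumes "f \<in> Hom V x x'"
  shows "sq V f (TenA V f (Id V (Unit V))) (inv_arrow V (RUnit V x)) (inv_arrow V (RUnit V x'))"
  using assms by (intro sq_inv sq_runit runit_iso) (auto simp: cat_simps)

lemma sq_symm:
  assumes "f \<in> Hom V x x'" "g \<in> Hom V y y'"
  shows "sq V (TenA V f g) (TenA V g f) (Symm V x y) (Symm V x' y')"
  using assms symm_nat[OF assms] symm_in[of x y] symm_in[of x' y'] by (auto simp: sq_def mon_simps)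

text \<open>The squares follow the factors of \<open>swap_iso\<close> one by one. The later
  coherence maps are treated likewise, along the recursion that defines them: both structure maps
  are the same composite, formed for two families of objects.\<close>

lemma sq_swap_iso:
  assumes "f \<in> Hom V x x'" "g \<in> Hom V y y'" "h \<in> Hom V z z'"
  shows "sq V (TenA V f (TenA V g h)) (TenA V g (TenA V f h)) (swap_iso V x y z) (swap_iso V x' y' z')"
  unfolding swap_iso_def
  by (rule sq_comp[OF sq_comp[OF sq_inv_assoc[OF assms] sq_ten[OF sq_symm[OF assms(1,2)] sq_id[OF assms(3)]]]
        sq_assoc[OF assms(2,1,3)]])

lemma tens_obj: "set xs \<subseteq> Obj V \<Longrightarrow> tens V xs \<in> Obj V"
  by (induction xs) (auto simp: ten_obj unit_obj)

lemma tensA_in: "set fs \<subseteq> Arr V \<Longrightarrow> tensA V fs \<in> Hom V (tens V (map (Dom V) fs)) (tens V (map (Cod V) fs))"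
  by (induction fs) (auto simp: mon_simps)

lemma tensA_map_in:
  assumes "\<And>k. k \<in> set ks \<Longrightarrow> \<phi> k \<in> Hom V (X k) (Y k)"
  shows "tensA V (map \<phi> ks) \<in> Hom V (tens V (map X ks)) (tens V (map Y ks))"
  using assms by (induction ks) (auto simp: mon_simps)

lemma tensA_map_id:
  assumes "\<And>k. k \<in> set ks \<Longrightarrow> X k \<in> Obj V"
  shows "tensA V (map (\<lambda>k. Id V (X k)) ks) = Id V (tens V (map X ks))"
  using assms
proof (induction ks)
  case (Cons k ks)
  have "tens V (map X ks) \<in> Obj V" by (rule tens_obj) (use Cons.prems in auto)
  then show ?case using Cons by (simp add: ten_id)
qed simp

lemma tensA_map_comp:
  assumes "\<And>k. k \<in> set ks \<Longrightarrow> \<phi> k \<in> Hom V (X k) (Y k)" "\<And>k. k \<in> set ks \<Longrightarrow> \<psi> k \<in> Hom V (Y k) (Z k)"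
  shows "tensA V (map (\<lambda>k. Comp V (\<psi> k) (\<phi> k)) ks) = Comp V (tensA V (map \<psi> ks)) (tensA V (map \<phi> ks))"
  using assms
proof (induction ks)
  case (Cons k ks)
  then show ?case
    using tensA_map_in[of ks \<phi> X Y] tensA_map_in[of ks \<psi> Y Z] by (simp add: hom_iff interchange)
qed (simp add: mon_simps)

lemma sq_tensA_map:
  assumes "\<And>k. k \<in> set ks \<Longrightarrow> sq V (a k) (b k) (u k) (v k)"
  shows "sq V (tensA V (map a ks)) (tensA V (map b ks)) (tensA V (map u ks)) (tensA V (map v ks))"
  using assms by (induction ks) (auto intro!: sq_ten sq_id simp: id_in unit_obj)

lemma unit_iso_in: "unit_iso V n \<in> Hom V (Unit V) (tens V (replicate n (Unit V)))"
proof (induction n)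
  case (Suc n)
  then show ?case using inv_lunit_in[OF unit_obj] by (auto simp: mon_simps)
qed (simp add: id_in unit_obj)

lemma sq_append_iso:
  assumes "set fs \<subseteq> Arr V" "set gs \<subseteq> Arr V"
  shows "sq V (TenA V (tensA V fs) (tensA V gs)) (tensA V (fs @ gs))
     (append_iso V (map (Dom V) fs) (map (Dom V) gs)) (append_iso V (map (Cod V) fs) (map (Cod V) gs))"
  using assms
proof (induction fs)
  case Nil
  then show ?case by (auto intro!: sq_lunit tensA_in)
next
  case (Cons f fs)
  then show ?case
    by (auto intro!: sq_comp[OF sq_assoc] sq_ten sq_id tensA_in simp: hom_iff)
qed

lemma sq_concat_iso:
  assumes "\<And>fs. fs \<in> set fss \<Longrightarrow> set fs \<subseteq> Arr V"
  shows "sq V (tensA V (map (tensA V) fss)) (tensA V (concat fss))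
     (concat_iso V (map (map (Dom V)) fss)) (concat_iso V (map (map (Cod V)) fss))"
  using assms
proof (induction fss)
  case Nil
  then show ?case by (auto intro!: sq_id id_in unit_obj)
next
  case (Cons fs fss)
  have "sq V (TenA V (tensA V fs) (tensA V (map (tensA V) fss))) (tensA V (fs @ concat fss))
     (concat_iso V (map (Dom V) fs # map (map (Dom V)) fss)) (concat_iso V (map (Cod V) fs # map (map (Cod V)) fss))"
    unfolding concat_iso.simps map_concat[symmetric]
    by (rule sq_comp[OF sq_ten[OF sq_id[OF tensA_in] Cons.IH] sq_append_iso]) (use Cons.prems in auto)
  then show ?case by simp
qed

lemma sq_zip_iso:
  assumes "set fs \<subseteq> Arr V" "set gs \<subseteq> Arr V" "length fs = length gs"
  shows "sq V (TenA V (tensA V fs) (tensA V gs)) (tensA V (map2 (TenA V) fs gs))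
     (zip_iso V (map (Dom V) fs) (map (Dom V) gs)) (zip_iso V (map (Cod V) fs) (map (Cod V) gs))"
  using assms(3,1,2)
proof (induction fs gs rule: list_induct2)
  case Nil
  then show ?case by (auto intro!: sq_lunit id_in unit_obj)
next
  case (Cons f fs g gs)
  have h: "f \<in> Hom V (Dom V f) (Cod V f)" "g \<in> Hom V (Dom V g) (Cod V g)"
    "tensA V fs \<in> Hom V (tens V (map (Dom V) fs)) (tens V (map (Cod V) fs))"
    "tensA V gs \<in> Hom V (tens V (map (Dom V) gs)) (tens V (map (Cod V) gs))"
    using Cons.prems tensA_in[of fs] tensA_in[of gs] by (auto simp: hom_iff)
  have "sq V (TenA V (TenA V f (tensA V fs)) (TenA V g (tensA V gs)))
     (TenA V (TenA V f g) (tensA V (map2 (TenA V) fs gs)))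
     (zip_iso V (Dom V f # map (Dom V) fs) (Dom V g # map (Dom V) gs))
     (zip_iso V (Cod V f # map (Cod V) fs) (Cod V g # map (Cod V) gs))"
    \<comment> \<open>One square for each factor of \<open>zip_iso\<close>: reassociate, move
      \<open>g\<close> past the tail of \<open>fs\<close>, reassociate back, recurse.\<close>
    unfolding zip_iso.simps
    by (rule sq_comp[OF sq_comp[OF sq_comp[OF sq_assoc[OF h(1,3) ten_arr[OF h(2,4)]]
          sq_ten[OF sq_id[OF h(1)] sq_swap_iso[OF h(3,2,4)]]]
          sq_inv_assoc[OF h(1,2) ten_arr[OF h(3,4)]]] sq_ten[OF sq_id[OF ten_arr[OF h(1,2)]] Cons.IH]])
      (use Cons.prems in auto)
  then show ?case by simp
qed

text \<open>The permutation performed by \<open>insort_iso\<close> depends only on the keys, so the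
  families \<open>X\<close> and \<open>Y\<close> are permuted in the same way.\<close>

lemma sq_insort_iso:
  assumes "\<And>l. l \<in> set (k # ls) \<Longrightarrow> \<phi> l \<in> Hom V (X l) (Y l)"
  shows "sq V (TenA V (\<phi> k) (tensA V (map \<phi> ls))) (tensA V (map \<phi> (insort k ls)))
     (insort_iso V X k ls) (insort_iso V Y k ls)"
  using assms
proof (induction ls)
  case Nil
  then show ?case by (auto intro!: sq_id ten_arr id_in unit_obj)
next
  case (Cons l ls)
  have h: "\<phi> k \<in> Hom V (X k) (Y k)" "\<phi> l \<in> Hom V (X l) (Y l)"
    "tensA V (map \<phi> ls) \<in> Hom V (tens V (map X ls)) (tens V (map Y ls))"
    using Cons.prems by (auto intro!: tensA_map_in)
  show ?case
    using Cons h by (auto intro!: sq_id ten_arr sq_comp[OF sq_swap_iso] sq_ten)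
qed

lemma sq_sort_iso:
  assumes "\<And>k. k \<in> set ks \<Longrightarrow> \<phi> k \<in> Hom V (X k) (Y k)"
  shows "sq V (tensA V (map \<phi> ks)) (tensA V (map \<phi> (sort ks))) (sort_iso V X ks) (sort_iso V Y ks)"
  using assms
proof (induction ks)
  case Nil
  then show ?case by (auto intro!: sq_id id_in unit_obj)
next
  case (Cons k ks)
  have "sq V (TenA V (\<phi> k) (tensA V (map \<phi> ks))) (tensA V (map \<phi> (insort k (sort ks))))
     (sort_iso V X (k # ks)) (sort_iso V Y (k # ks))"
    unfolding sort_iso.simps
    by (rule sq_comp[OF sq_ten[OF sq_id Cons.IH] sq_insort_iso]) (use Cons.prems in auto)
  then show ?case by simp
qed

end

section \<open>Coproducts\<close>

text \<open>The summands are not listed separately; they are the domains of the injections. The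
  index type is arbitrary because the index sets will consist of objects, arrows, pairs and families
  of objects.\<close>

definition is_coprod :: "('o, 'a, 'z) cat_scheme \<Rightarrow> 'i set \<Rightarrow> ('i \<Rightarrow> 'a) \<Rightarrow> 'o \<Rightarrow> bool" where
  "is_coprod C I \<iota> y \<longleftrightarrow> y \<in> Obj C \<and> (\<forall>i\<in>I. \<iota> i \<in> Arr C \<and> Cod C (\<iota> i) = y) \<and>
     (\<forall>z m. z \<in> Obj C \<longrightarrow> (\<forall>i\<in>I. m i \<in> Hom C (Dom C (\<iota> i)) z)
        \<longrightarrow> (\<exists>!h. h \<in> Hom C y z \<and> (\<forall>i\<in>I. Comp C h (\<iota> i) = m i)))"

lemma is_coprodI:
  assumes "y \<in> Obj C" "\<And>i. i \<in> I \<Longrightarrow> \<iota> i \<in> Arr C" "\<And>i. i \<in> I \<Longrightarrow> Cod C (\<iota> i) = y"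
    and "\<And>z m. \<lbrakk>z \<in> Obj C; \<And>i. i \<in> I \<Longrightarrow> m i \<in> Hom C (Dom C (\<iota> i)) z\<rbrakk>
      \<Longrightarrow> \<exists>h. h \<in> Hom C y z \<and> (\<forall>i\<in>I. Comp C h (\<iota> i) = m i)"
    and "\<And>z h h'. \<lbrakk>z \<in> Obj C; h \<in> Hom C y z; h' \<in> Hom C y z; \<And>i. i \<in> I \<Longrightarrow> Comp C h (\<iota> i) = Comp C h' (\<iota> i)\<rbrakk>
      \<Longrightarrow> h = h'"
  shows "is_coprod C I \<iota> y"
  unfolding is_coprod_def
proof (intro conjI allI impI ballI)
  fix z m assume z: "z \<in> Obj C" and m: "\<forall>i\<in>I. m i \<in> Hom C (Dom C (\<iota> i)) z"
  then obtain h where "h \<in> Hom C y z \<and> (\<forall>i\<in>I. Comp C h (\<iota> i) = m i)" using assms(4) by blast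
  then show "\<exists>!h. h \<in> Hom C y z \<and> (\<forall>i\<in>I. Comp C h (\<iota> i) = m i)"
    using assms(5)[OF z] by (intro ex1I[of _ h]) auto
qed (use assms in auto)

lemma coprod_obj: "is_coprod C I \<iota> y \<Longrightarrow> y \<in> Obj C"
  and coprod_in: "is_coprod C I \<iota> y \<Longrightarrow> i \<in> I \<Longrightarrow> \<iota> i \<in> Hom C (Dom C (\<iota> i)) y"
  by (auto simp: is_coprod_def hom_iff)

lemma coprod_ex1:
  assumes "is_coprod C I \<iota> y" "z \<in> Obj C" "\<forall>i\<in>I. m i \<in> Hom C (Dom C (\<iota> i)) z"
  shows "\<exists>!h. h \<in> Hom C y z \<and> (\<forall>i\<in>I. Comp C h (\<iota> i) = m i)"
  using assms by (simp add: is_coprod_def)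

lemma coprod_map:
  assumes "is_coprod C I \<iota> y" "z \<in> Obj C" "\<forall>i\<in>I. m i \<in> Hom C (Dom C (\<iota> i)) z"
  shows "\<exists>h. h \<in> Hom C y z \<and> (\<forall>i\<in>I. Comp C h (\<iota> i) = m i)"
  using coprod_ex1[OF assms] by blast

lemma (in category) coprod_eqI:
  assumes "is_coprod C I \<iota> y" "h \<in> Hom C y z" "h' \<in> Hom C y z"
    "\<And>i. i \<in> I \<Longrightarrow> Comp C h (\<iota> i) = Comp C h' (\<iota> i)"
  shows "h = h'"
proof -
  have "z \<in> Obj C" "\<forall>i\<in>I. Comp C h' (\<iota> i) \<in> Hom C (Dom C (\<iota> i)) z"
    using assms by (auto simp: is_coprod_def cat_simps)
  then have "\<exists>!h. h \<in> Hom C y z \<and> (\<forall>i\<in>I. Comp C h (\<iota> i) = Comp C h' (\<iota> i))"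
    by (rule coprod_ex1[OF assms(1)])
  then show ?thesis using assms by blast
qed

text \<open>Through this lemma the bijection between lifts and choices of objects, and the bijection
  between fibers in a pullback square, act on coproducts.\<close>

lemma is_coprod_reindex:
  assumes "is_coprod C I \<iota> y" "bij_betw b J I" "\<And>j. j \<in> J \<Longrightarrow> \<kappa> j = \<iota> (b j)"
  shows "is_coprod C J \<kappa> y"
  unfolding is_coprod_def
proof (intro conjI allI impI ballI)
  show "y \<in> Obj C" using assms(1) by (rule coprod_obj)
  show "\<kappa> j \<in> Arr C" "Cod C (\<kappa> j) = y" if "j \<in> J" for j
    using assms that bij_betwE[OF assms(2)] by (auto simp: is_coprod_def)
  fix z m assume z: "z \<in> Obj C" and m: "\<forall>j\<in>J. m j \<in> Hom C (Dom C (\<kappa> j)) z"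
  let ?m = "\<lambda>i. m (inv_into J b i)"
  have inv: "inv_into J b (b j) = j" if "j \<in> J" for j using assms(2) that by (simp add: bij_betw_def)
  have eq: "(\<forall>j\<in>J. Comp C h (\<kappa> j) = m j) \<longleftrightarrow> (\<forall>i\<in>I. Comp C h (\<iota> i) = ?m i)" for h
    using assms(2,3) inv by (force simp: bij_betw_def)
  have "\<forall>i\<in>I. ?m i \<in> Hom C (Dom C (\<iota> i)) z"
    using m assms(2,3) inv by (force simp: bij_betw_def)
  then show "\<exists>!h. h \<in> Hom C y z \<and> (\<forall>j\<in>J. Comp C h (\<kappa> j) = m j)"
    unfolding eq by (rule coprod_ex1[OF assms(1) z])
qed

lemma is_coprod_cong:
  assumes "is_coprod C I \<iota> y" "\<And>i. i \<in> I \<Longrightarrow> \<kappa> i = \<iota> i"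
  shows "is_coprod C I \<kappa> y"
  using is_coprod_reindex[OF assms(1) bij_betw_id, of \<kappa>] assms(2) by simp

context category
begin

text \<open>Used for the symmetry of the tensor product, and later to carry a coproduct description
  over to the chosen left adjoint.\<close>

lemma is_coprod_post_iso:
  assumes "is_coprod C I \<iota> y" "iso_arrow C g" "Dom C g = y" "\<And>i. i \<in> I \<Longrightarrow> \<kappa> i = Comp C g (\<iota> i)"
  shows "is_coprod C I \<kappa> (Cod C g)"
proof (rule is_coprodI)
  note g = iso_arr[OF assms(2)] and gi = inv_arrow_in[OF assms(2)]
  note lr = inv_arrow_left[OF assms(2)] inv_arrow_right[OF assms(2)]
  have i: "\<iota> i \<in> Arr C" "Cod C (\<iota> i) = y" if "i \<in> I" for i
    using assms(1) that by (auto simp: is_coprod_def)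
  show "Cod C g \<in> Obj C" using g by (rule cod_in)
  show "\<kappa> i \<in> Arr C" "Cod C (\<kappa> i) = Cod C g" if "i \<in> I" for i
    using that i g assms(3,4) by (auto simp: cat_simps)
  fix z assume z: "z \<in> Obj C"
  show "\<exists>h. h \<in> Hom C (Cod C g) z \<and> (\<forall>i\<in>I. Comp C h (\<kappa> i) = m i)"
    if m: "\<And>i. i \<in> I \<Longrightarrow> m i \<in> Hom C (Dom C (\<kappa> i)) z" for m
  proof -
    have "\<forall>i\<in>I. m i \<in> Hom C (Dom C (\<iota> i)) z" using m i g assms(3,4) by (auto simp: cat_simps)
    then obtain h where h: "h \<in> Hom C y z" "\<And>i. i \<in> I \<Longrightarrow> Comp C h (\<iota> i) = m i"
      using coprod_map[OF assms(1) z] by blast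
    have "Comp C (Comp C h (inv_arrow C g)) (\<kappa> i) = m i" if "i \<in> I" for i
    proof -
      have "Comp C (Comp C h (inv_arrow C g)) (\<kappa> i) = Comp C h (Comp C (Comp C (inv_arrow C g) g) (\<iota> i))"
        using that i g gi h(1) assms(3,4) by (auto simp: cat_simps)
      then show ?thesis using that i h assms(3) by (auto simp: lr cat_simps)
    qed
    moreover have "Comp C h (inv_arrow C g) \<in> Hom C (Cod C g) z" using h(1) gi assms(3) by (auto simp: cat_simps)
    ultimately show ?thesis by blast
  qed
  fix h h' assume h: "h \<in> Hom C (Cod C g) z" "h' \<in> Hom C (Cod C g) z"
    and eq: "\<And>i. i \<in> I \<Longrightarrow> Comp C h (\<kappa> i) = Comp C h' (\<kappa> i)"
  have "Comp C h g = Comp C h' g"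
    by (rule coprod_eqI[OF assms(1), of _ z]) (use h g assms(3,4) i eq in \<open>auto simp: cat_simps\<close>)
  then have "Comp C (Comp C h g) (inv_arrow C g) = Comp C (Comp C h' g) (inv_arrow C g)" by simp
  then show "h = h'" using h g gi by (auto simp: lr cat_simps)
qed

text \<open>A cocone on the pairs is first factored through each inner coproduct and then through
  the outer one. The set \<open>J\<close> is the same for every \<open>i\<close>, as it is for a
  tensor product of two coproducts.\<close>

lemma is_coprod_compose:
  assumes "is_coprod C I \<alpha> y" "\<And>i. i \<in> I \<Longrightarrow> is_coprod C J (\<beta> i) (Dom C (\<alpha> i))"
  shows "is_coprod C (I \<times> J) (\<lambda>(i, j). Comp C (\<alpha> i) (\<beta> i j)) y"
proof (rule is_coprodI)
  have a: "\<alpha> i \<in> Arr C" "Cod C (\<alpha> i) = y" if "i \<in> I" for i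
    using assms(1) that by (auto simp: is_coprod_def)
  have b: "\<beta> i j \<in> Arr C" "Cod C (\<beta> i j) = Dom C (\<alpha> i)" if "i \<in> I" "j \<in> J" for i j
    using assms(2)[OF that(1)] that by (auto simp: is_coprod_def)
  show "y \<in> Obj C" using assms(1) by (rule coprod_obj)
  show "(case p of (i, j) \<Rightarrow> Comp C (\<alpha> i) (\<beta> i j)) \<in> Arr C"
    "Cod C (case p of (i, j) \<Rightarrow> Comp C (\<alpha> i) (\<beta> i j)) = y" if "p \<in> I \<times> J" for p
    using that a b by (auto simp: cat_simps)
  fix z assume z: "z \<in> Obj C"
  show "\<exists>h. h \<in> Hom C y z \<and> (\<forall>p\<in>I \<times> J. Comp C h (case p of (i, j) \<Rightarrow> Comp C (\<alpha> i) (\<beta> i j)) = m p)"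
    if m: "\<And>p. p \<in> I \<times> J \<Longrightarrow> m p \<in> Hom C (Dom C (case p of (i, j) \<Rightarrow> Comp C (\<alpha> i) (\<beta> i j))) z" for m
  proof -
    have mm: "m (i, j) \<in> Hom C (Dom C (\<beta> i j)) z" if "i \<in> I" "j \<in> J" for i j
      using m[of "(i, j)"] that a b by (auto simp: cat_simps)
    have "\<exists>n. n \<in> Hom C (Dom C (\<alpha> i)) z \<and> (\<forall>j\<in>J. Comp C n (\<beta> i j) = m (i, j))" if "i \<in> I" for i
      by (rule coprod_map[OF assms(2)[OF that] z]) (use mm[OF that] in blast)
    then obtain n where n: "\<And>i. i \<in> I \<Longrightarrow> n i \<in> Hom C (Dom C (\<alpha> i)) z"
      "\<And>i j. i \<in> I \<Longrightarrow> j \<in> J \<Longrightarrow> Comp C (n i) (\<beta> i j) = m (i, j)" by metis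
    obtain h where h: "h \<in> Hom C y z" "\<And>i. i \<in> I \<Longrightarrow> Comp C h (\<alpha> i) = n i"
      using coprod_map[OF assms(1) z] n(1) by blast
    have "Comp C h (Comp C (\<alpha> i) (\<beta> i j)) = m (i, j)" if "i \<in> I" "j \<in> J" for i j
      using that h n(2) a b comp_assoc_right[of "\<beta> i j" "\<alpha> i" h] by (auto simp: hom_iff)
    then show ?thesis using h(1) by auto
  qed
  fix h h' assume h: "h \<in> Hom C y z" "h' \<in> Hom C y z"
    and eq: "\<And>p. p \<in> I \<times> J \<Longrightarrow> Comp C h (case p of (i, j) \<Rightarrow> Comp C (\<alpha> i) (\<beta> i j))
      = Comp C h' (case p of (i, j) \<Rightarrow> Comp C (\<alpha> i) (\<beta> i j))"
  show "h = h'"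
  proof (rule coprod_eqI[OF assms(1) h])
    fix i assume i: "i \<in> I"
    show "Comp C h (\<alpha> i) = Comp C h' (\<alpha> i)"
      by (rule coprod_eqI[OF assms(2)[OF i], of _ z])
        (use eq[of "(i, _)"] i h a b in \<open>auto simp: cat_simps\<close>)
  qed
qed

text \<open>Cocompleteness concerns diagrams whose objects and arrows lie in \<open>'u\<close>, so
  the index set is first copied into \<open>'u\<close> along \<open>e\<close>.\<close>

lemma ex_coprod:
  assumes "cocomplete_cat TYPE('u) C" "inj_on (e :: 'i \<Rightarrow> 'u) I" "\<And>i. i \<in> I \<Longrightarrow> X i \<in> Obj C"
  shows "\<exists>\<iota> y. is_coprod C I \<iota> y \<and> (\<forall>i\<in>I. Dom C (\<iota> i) = X i)"
proof -
  \<comment> \<open>The discrete category on the copy of \<open>I\<close>, each object being its own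
    identity arrow; its colimits are coproducts.\<close>
  define J :: "('u, 'u) cat" where "J = \<lparr>Obj = e ` I, Arr = e ` I, Dom = (\<lambda>x. x), Cod = (\<lambda>x. x),
    Id = (\<lambda>x. x), Comp = (\<lambda>x y. x)\<rparr>"
  define D where "D = \<lparr>ObjMap = (\<lambda>x. X (inv_into I e x)), ArrMap = (\<lambda>x. Id C (X (inv_into I e x)))\<rparr>"
  have inv: "inv_into I e (e i) = i" if "i \<in> I" for i using assms(2) that by simp
  have "cat_functor J C D"
    by unfold_locales (use assms(3) inv in \<open>auto simp: J_def D_def cat_simps\<close>)
  then obtain y l where yl: "is_colimit J C D y l"
    using assms(1) unfolding cocomplete_cat_def by blast
  define \<iota> where "\<iota> i = l (e i)" for i
  have i: "\<iota> i \<in> Hom C (X i) y" if "i \<in> I" for i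
    using yl that inv by (auto simp: is_colimit_def is_cocone_def J_def D_def \<iota>_def)
  have y: "y \<in> Obj C" using yl by (auto simp: is_colimit_def is_cocone_def)
  have uni: "\<exists>!h. h \<in> Hom C y z \<and> (\<forall>i\<in>I. Comp C h (\<iota> i) = m i)"
    if z: "z \<in> Obj C" and m: "\<And>i. i \<in> I \<Longrightarrow> m i \<in> Hom C (X i) z" for z m
  proof -
    have "is_cocone J C D z (\<lambda>x. m (inv_into I e x))"
      using z m inv by (auto simp: is_cocone_def J_def D_def hom_iff comp_id)
    then have "\<exists>!h. h \<in> Hom C y z \<and> (\<forall>x\<in>Obj J. Comp C h (l x) = m (inv_into I e x))"
      using yl[unfolded is_colimit_def, THEN conjunct2, rule_format] by simp
    moreover have "(\<forall>x\<in>Obj J. Comp C h (l x) = m (inv_into I e x)) \<longleftrightarrow> (\<forall>i\<in>I. Comp C h (\<iota> i) = m i)" for h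
      using inv by (auto simp: J_def \<iota>_def)
    ultimately show ?thesis by simp
  qed
  have D: "Dom C (\<iota> i) = X i" if "i \<in> I" for i using i[OF that] by (simp add: hom_iff)
  have "is_coprod C I \<iota> y"
    unfolding is_coprod_def using y i uni D by (auto simp: hom_iff)
  then show ?thesis using D by blast
qed

end

section \<open>Tensor products of coproducts\<close>

context symmetric_monoidal_category
begin

text \<open>By closedness, tensoring with \<open>x\<close> on the right is a left adjoint: a cocone
  from the \<open>\<iota> i\<close> tensored with \<open>x\<close> to \<open>z\<close> is curried to
  a cocone on the summands of \<open>y\<close> with tip the internal hom \<open>e\<close> of
  \<open>x\<close> and \<open>z\<close>.\<close>

lemma is_coprod_ten_right:
  assumes cl: "closed_monoidal V" and c: "is_coprod V I \<iota> y" and x: "x \<in> Obj V"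
  shows "is_coprod V I (\<lambda>i. TenA V (\<iota> i) (Id V x)) (Ten V y x)"
proof (rule is_coprodI)
  have y: "y \<in> Obj V" using c by (rule coprod_obj)
  have i: "\<iota> i \<in> Arr V" "Cod V (\<iota> i) = y" "Dom V (\<iota> i) \<in> Obj V" if "i \<in> I" for i
    using c that by (auto simp: is_coprod_def dom_in)
  show "Ten V y x \<in> Obj V" using x y by (simp add: ten_obj)
  show "TenA V (\<iota> i) (Id V x) \<in> Arr V" "Cod V (TenA V (\<iota> i) (Id V x)) = Ten V y x" if "i \<in> I" for i
    using i that x by (auto simp: mon_simps)
  fix z assume z: "z \<in> Obj V"
  have "\<exists>e \<in> Obj V. \<exists>ev \<in> Hom V (Ten V e x) z. \<forall>w \<in> Obj V. \<forall>f \<in> Hom V (Ten V w x) z.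
       \<exists>!g. g \<in> Hom V w e \<and> Comp V ev (TenA V g (Id V x)) = f"
    using cl x z by (simp add: closed_monoidal_def)
  then obtain e ev where e: "e \<in> Obj V" "ev \<in> Hom V (Ten V e x) z"
    and cur': "\<forall>w \<in> Obj V. \<forall>f \<in> Hom V (Ten V w x) z.
       \<exists>!g. g \<in> Hom V w e \<and> Comp V ev (TenA V g (Id V x)) = f"
    by (elim bexE)
  have cur: "\<exists>!g. g \<in> Hom V w e \<and> Comp V ev (TenA V g (Id V x)) = f"
    if "w \<in> Obj V" "f \<in> Hom V (Ten V w x) z" for w f
    using cur' that by simp
  \<comment> \<open>Naturality of uncurrying in its first argument.\<close>
  have pre: "Comp V ev (TenA V (Comp V g f) (Id V x)) = Comp V (Comp V ev (TenA V g (Id V x))) (TenA V f (Id V x))"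
    if "f \<in> Hom V w w'" "g \<in> Hom V w' e" for f g w w'
    using that x e interchange[of f g "Id V x" "Id V x"] by (auto simp: mon_simps)
  have evg: "Comp V ev (TenA V g (Id V x)) \<in> Hom V (Ten V w x) z" if "g \<in> Hom V w e" for g w
    using that x e by (auto simp: mon_simps)
  show "\<exists>h. h \<in> Hom V (Ten V y x) z \<and> (\<forall>i\<in>I. Comp V h (TenA V (\<iota> i) (Id V x)) = m i)"
    if m: "\<And>i. i \<in> I \<Longrightarrow> m i \<in> Hom V (Dom V (TenA V (\<iota> i) (Id V x))) z" for m
  proof -
    have "\<exists>n. n \<in> Hom V (Dom V (\<iota> i)) e \<and> Comp V ev (TenA V n (Id V x)) = m i" if "i \<in> I" for i
      using cur[of "Dom V (\<iota> i)" "m i"] m[OF that] i[OF that] x by (auto simp: mon_simps)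
    then obtain n where n: "\<And>i. i \<in> I \<Longrightarrow> n i \<in> Hom V (Dom V (\<iota> i)) e"
      "\<And>i. i \<in> I \<Longrightarrow> Comp V ev (TenA V (n i) (Id V x)) = m i" by metis
    obtain g where g: "g \<in> Hom V y e" "\<And>i. i \<in> I \<Longrightarrow> Comp V g (\<iota> i) = n i"
      using coprod_map[OF c e(1)] n(1) by blast
    have "Comp V (Comp V ev (TenA V g (Id V x))) (TenA V (\<iota> i) (Id V x)) = m i" if "i \<in> I" for i
      using pre[OF coprod_in[OF c that] g(1)] g(2)[OF that] n(2)[OF that] by simp
    then show ?thesis using evg[OF g(1)] by blast
  qed
  fix h h' assume h: "h \<in> Hom V (Ten V y x) z" "h' \<in> Hom V (Ten V y x) z"
    and eq: "\<And>i. i \<in> I \<Longrightarrow> Comp V h (TenA V (\<iota> i) (Id V x)) = Comp V h' (TenA V (\<iota> i) (Id V x))"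
  obtain g where g: "g \<in> Hom V y e" "Comp V ev (TenA V g (Id V x)) = h" using cur[OF y h(1)] by blast
  obtain g' where g': "g' \<in> Hom V y e" "Comp V ev (TenA V g' (Id V x)) = h'" using cur[OF y h(2)] by blast
  have "g = g'"
  proof (rule coprod_eqI[OF c g(1) g'(1)])
    fix j assume j: "j \<in> I"
    have gj: "Comp V g (\<iota> j) \<in> Hom V (Dom V (\<iota> j)) e" "Comp V g' (\<iota> j) \<in> Hom V (Dom V (\<iota> j)) e"
      using g(1) g'(1) i[OF j] by (auto simp: cat_simps)
    have "Comp V ev (TenA V (Comp V g (\<iota> j)) (Id V x)) = Comp V ev (TenA V (Comp V g' (\<iota> j)) (Id V x))"
      using pre[OF coprod_in[OF c j] g(1)] pre[OF coprod_in[OF c j] g'(1)] g(2) g'(2) eq[OF j] by simp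
    then show "Comp V g (\<iota> j) = Comp V g' (\<iota> j)"
      using cur[OF i(3)[OF j] evg[OF gj(2)]] gj by blast
  qed
  then show "h = h'" using g(2) g'(2) by simp
qed

lemma symm_iso: "x \<in> Obj V \<Longrightarrow> y \<in> Obj V \<Longrightarrow> iso_arrow V (Symm V x y)"
  unfolding iso_arrow_def inverse_arrows_def
  using symm_in[of x y] symm_in[of y x] symm_symm[of x y] symm_symm[of y x]
  by (intro exI[of _ "Symm V y x"]) (auto simp: hom_iff)

text \<open>An isomorphism exhibits its codomain as a coproduct with one summand, so this is a
  composition of coproducts with \<open>{()}\<close> as inner index set.\<close>

lemma is_coprod_pre_iso:
  assumes "is_coprod V I \<iota> y" "\<And>i. i \<in> I \<Longrightarrow> iso_arrow V (s i)"
    "\<And>i. i \<in> I \<Longrightarrow> Cod V (s i) = Dom V (\<iota> i)" "\<And>i. i \<in> I \<Longrightarrow> \<kappa> i = Comp V (\<iota> i) (s i)"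
  shows "is_coprod V I \<kappa> y"
proof -
  have one: "is_coprod V {()} (\<lambda>_. s i) (Dom V (\<iota> i))" if "i \<in> I" for i
  proof -
    have "is_coprod V {()} (\<lambda>_. Id V (Dom V (s i))) (Dom V (s i))"
      using iso_arr[OF assms(2)[OF that]] by (auto intro!: is_coprodI simp: mon_simps)
    from is_coprod_post_iso[OF this assms(2)[OF that] refl, of "\<lambda>_. s i"] show ?thesis
      using assms(3)[OF that] iso_arr[OF assms(2)[OF that]] by (simp add: mon_simps)
  qed
  have "bij_betw (\<lambda>i. (i, ())) I (I \<times> {()})" by (auto intro!: bij_betwI[of _ _ _ fst])
  from is_coprod_reindex[OF is_coprod_compose[OF assms(1) one] this, of \<kappa>] show ?thesis
    using assms(4) by simp
qed

text \<open>The internal hom is given for tensoring on the right; the other side follows by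
  conjugating with the symmetry, postcomposed on the coproduct and precomposed on each
  summand.\<close>

lemma is_coprod_ten_left:
  assumes cl: "closed_monoidal V" and c: "is_coprod V I \<iota> y" and x: "x \<in> Obj V"
  shows "is_coprod V I (\<lambda>i. TenA V (Id V x) (\<iota> i)) (Ten V x y)"
proof -
  have y: "y \<in> Obj V" using c by (rule coprod_obj)
  have i: "\<iota> i \<in> Hom V (Dom V (\<iota> i)) y" "Dom V (\<iota> i) \<in> Obj V" if "i \<in> I" for i
    using c that by (auto simp: is_coprod_def dom_in hom_iff)
  have *: "is_coprod V I (\<lambda>i. Comp V (Symm V y x) (TenA V (\<iota> i) (Id V x))) (Ten V x y)"
    using is_coprod_post_iso[OF is_coprod_ten_right[OF cl c x] symm_iso[OF y x]] symm_in[OF y x]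
    by (auto simp: hom_iff)
  show ?thesis
  proof (rule is_coprod_pre_iso[OF *, of "\<lambda>i. Symm V x (Dom V (\<iota> i))"])
    fix j assume j: "j \<in> I"
    note i = i[OF j]
    note s = symm_in[OF y x] symm_in[OF x y] symm_in[OF x i(2)] symm_in[OF i(2) x]
    have "Comp V (Comp V (Symm V y x) (TenA V (\<iota> j) (Id V x))) (Symm V x (Dom V (\<iota> j)))
      = Comp V (TenA V (Id V x) (\<iota> j)) (Comp V (Symm V (Dom V (\<iota> j)) x) (Symm V x (Dom V (\<iota> j))))"
      using symm_nat[OF i(1) id_in[OF x]] i x y s comp_assoc_right by (auto simp: mon_simps)
    then show "TenA V (Id V x) (\<iota> j) = Comp V (Comp V (Symm V y x) (TenA V (\<iota> j) (Id V x))) (Symm V x (Dom V (\<iota> j)))"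
      using symm_symm[OF x i(2)] i x by (simp add: mon_simps)
    show "iso_arrow V (Symm V x (Dom V (\<iota> j)))" using x i by (simp add: symm_iso)
    show "Cod V (Symm V x (Dom V (\<iota> j))) = Dom V (Comp V (Symm V y x) (TenA V (\<iota> j) (Id V x)))"
      using s i x by (auto simp: mon_simps)
  qed
qed

text \<open>The injection for \<open>(i, j)\<close> factors as \<open>\<iota> i\<close> tensored
  with an identity after an identity tensored with \<open>\<kappa> j\<close>, which makes it a
  coproduct of coproducts.\<close>

lemma is_coprod_ten:
  assumes cl: "closed_monoidal V" and c: "is_coprod V I \<iota> y" "is_coprod V J \<kappa> z"
  shows "is_coprod V (I \<times> J) (\<lambda>(i, j). TenA V (\<iota> i) (\<kappa> j)) (Ten V y z)"
proof -
  have o: "y \<in> Obj V" "z \<in> Obj V" using c by (auto intro: coprod_obj)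
  have i: "\<iota> i \<in> Arr V" "Cod V (\<iota> i) = y" if "i \<in> I" for i using c(1) that by (auto simp: is_coprod_def)
  have j: "\<kappa> j \<in> Arr V" "Cod V (\<kappa> j) = z" if "j \<in> J" for j using c(2) that by (auto simp: is_coprod_def)
  have d: "Dom V (TenA V (\<iota> i) (Id V z)) = Ten V (Dom V (\<iota> i)) z" if "i \<in> I" for i
    using i[OF that] o by (simp add: mon_simps)
  have "is_coprod V (I \<times> J) (\<lambda>(i, j). Comp V (TenA V (\<iota> i) (Id V z)) (TenA V (Id V (Dom V (\<iota> i))) (\<kappa> j))) (Ten V y z)"
    by (rule is_coprod_compose[OF is_coprod_ten_right[OF cl c(1) o(2)]])
      (use d i is_coprod_ten_left[OF cl c(2)] dom_in in auto)
  then show ?thesis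
    by (rule is_coprod_cong) (use i j o in \<open>auto simp: interchange mon_simps\<close>)
qed

text \<open>Distributivity: a summand of the tensor product is given by one summand of each factor.
  Distinctness of \<open>ks\<close> lets a function on \<open>set ks\<close> record an independent
  choice at each position. For the empty list there is exactly one choice, and the unit object is
  the coproduct of itself.\<close>

lemma is_coprod_tensA:
  assumes cl: "closed_monoidal V" and "distinct ks" "\<And>k. k \<in> set ks \<Longrightarrow> is_coprod V (I k) (\<iota> k) (Y k)"
  shows "is_coprod V (PiE (set ks) I) (\<lambda>t. tensA V (map (\<lambda>k. \<iota> k (t k)) ks)) (tens V (map Y ks))"
  using assms(2,3)
proof (induction ks)
  case Nil
  show ?case by (auto intro!: is_coprodI simp: mon_simps)
next
  case (Cons k ks)
  have k: "k \<notin> set ks" using Cons.prems by simp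
  have "is_coprod V (I k \<times> PiE (set ks) I) (\<lambda>(i, t). TenA V (\<iota> k i) (tensA V (map (\<lambda>k. \<iota> k (t k)) ks)))
     (Ten V (Y k) (tens V (map Y ks)))"
    by (rule is_coprod_ten[OF cl]) (use Cons in auto)
  \<comment> \<open>Splits a family into its value at \<open>k\<close> and the rest; the inverse is
    function update, which leaves the rest intact because \<open>k\<close> is not in
    \<open>ks\<close>.\<close>
  moreover have "bij_betw (\<lambda>t. (t k, restrict t (set ks))) (PiE (set (k # ks)) I) (I k \<times> PiE (set ks) I)"
    by (rule bij_betwI[of _ _ _ "\<lambda>(i, t). t(k := i)"])
      (use k in \<open>auto simp: PiE_iff extensional_def fun_eq_iff split: if_splits\<close>)
  ultimately have "is_coprod V (PiE (set (k # ks)) I) (\<lambda>t. tensA V (map (\<lambda>k. \<iota> k (t k)) (k # ks)))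
     (Ten V (Y k) (tens V (map Y ks)))"
    by (rule is_coprod_reindex) (use k in \<open>auto intro!: arg_cong2[where f = "TenA V"] arg_cong[where f = "tensA V"] map_cong\<close>)
  then show ?case by simp
qed

end

section \<open>Universal arrows and adjunctions\<close>

definition universal_arrow :: "('o, 'a, 'y) cat_scheme \<Rightarrow> ('p, 'b, 'z) cat_scheme
    \<Rightarrow> ('p, 'b, 'o, 'a) ftor \<Rightarrow> 'o \<Rightarrow> 'p \<Rightarrow> 'a \<Rightarrow> bool" where
  "universal_arrow C D G x y \<eta> \<longleftrightarrow> y \<in> Obj D \<and> \<eta> \<in> Hom C x (ObjMap G y) \<and>
     (\<forall>y' \<in> Obj D. \<forall>f \<in> Hom C x (ObjMap G y'). \<exists>!g. g \<in> Hom D y y' \<and> Comp C (ArrMap G g) \<eta> = f)"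

text \<open>The transpose of \<open>f\<close> is the counit after \<open>L f\<close>. One triangle
  identity shows that it is a solution, the other that every solution equals it.\<close>

lemma adjunction_universal:
  assumes "adjunction C D L G \<eta> \<epsilon>" "x \<in> Obj C"
  shows "universal_arrow C D G x (ObjMap L x) (\<eta> x)"
proof -
  interpret L: cat_functor C D L using assms by (simp add: adjunction_def)
  interpret G: cat_functor D C G using assms by (simp add: adjunction_def)
  have e: "\<And>z. z \<in> Obj C \<Longrightarrow> \<eta> z \<in> Hom C z (ObjMap G (ObjMap L z))"
    "\<And>f. f \<in> Arr C \<Longrightarrow> Comp C (\<eta> (Cod C f)) f = Comp C (ArrMap G (ArrMap L f)) (\<eta> (Dom C f))"
    "\<And>z. z \<in> Obj D \<Longrightarrow> \<epsilon> z \<in> Hom D (ObjMap L (ObjMap G z)) z"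
    "\<And>f. f \<in> Arr D \<Longrightarrow> Comp D (\<epsilon> (Cod D f)) (ArrMap L (ArrMap G f)) = Comp D f (\<epsilon> (Dom D f))"
    "\<And>x. x \<in> Obj C \<Longrightarrow> Comp D (\<epsilon> (ObjMap L x)) (ArrMap L (\<eta> x)) = Id D (ObjMap L x)"
    "\<And>y. y \<in> Obj D \<Longrightarrow> Comp C (ArrMap G (\<epsilon> y)) (\<eta> (ObjMap G y)) = Id C (ObjMap G y)"
    using assms(1) by (auto simp: adjunction_def nat_trans_def id_ftor_def comp_ftor_def)
  have "\<exists>!g. g \<in> Hom D (ObjMap L x) y \<and> Comp C (ArrMap G g) (\<eta> x) = f"
    if y: "y \<in> Obj D" and f: "f \<in> Hom C x (ObjMap G y)" for y f
  proof (rule ex1I)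
    note Lf = L.arr_in[OF f] and ey = e(3)[OF y]
    have "Comp C (ArrMap G (Comp D (\<epsilon> y) (ArrMap L f))) (\<eta> x)
        = Comp C (ArrMap G (\<epsilon> y)) (Comp C (ArrMap G (ArrMap L f)) (\<eta> x))"
      using G.map_comp[OF Lf ey] G.arr_in[OF Lf] G.arr_in[OF ey] e(1)[OF assms(2)]
      by (simp add: L.dom_cat.comp_assoc)
    also have "\<dots> = Comp C (Comp C (ArrMap G (\<epsilon> y)) (\<eta> (ObjMap G y))) f"
      using e(2)[of f] f L.dom_cat.comp_assoc[OF f e(1)[OF G.obj_in[OF y]] G.arr_in[OF ey]]
      by (simp add: hom_iff)
    also have "\<dots> = f" using e(6)[OF y] f by (simp add: L.dom_cat.comp_id_left)
    finally show "Comp D (\<epsilon> y) (ArrMap L f) \<in> Hom D (ObjMap L x) y \<and> Comp C (ArrMap G (Comp D (\<epsilon> y) (ArrMap L f))) (\<eta> x) = f"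
      using L.cod_cat.comp_in[OF Lf ey] by blast
    fix g assume g: "g \<in> Hom D (ObjMap L x) y \<and> Comp C (ArrMap G g) (\<eta> x) = f"
    then have g: "g \<in> Hom D (ObjMap L x) y" and f: "f = Comp C (ArrMap G g) (\<eta> x)" by auto
    note Gg = G.arr_in[OF g] and ex = e(1)[OF assms(2)]
    have "Comp D (\<epsilon> y) (ArrMap L f) = Comp D (Comp D (\<epsilon> y) (ArrMap L (ArrMap G g))) (ArrMap L (\<eta> x))"
      unfolding f using L.map_comp[OF ex Gg] L.cod_cat.comp_assoc[OF L.arr_in[OF ex] L.arr_in[OF Gg] ey] by simp
    also have "\<dots> = Comp D g (Comp D (\<epsilon> (ObjMap L x)) (ArrMap L (\<eta> x)))"
      using e(4)[of g] g L.cod_cat.comp_assoc[OF L.arr_in[OF ex] e(3)[OF L.obj_in[OF assms(2)]] g]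
      by (simp add: hom_iff)
    also have "\<dots> = g" using e(5)[OF assms(2)] g by (simp add: L.cod_cat.comp_id_right)
    finally show "g = Comp D (\<epsilon> y) (ArrMap L f)" by simp
  qed
  then show ?thesis unfolding universal_arrow_def using L.obj_in e(1) assms(2) by blast
qed

lemma universal_arrow_comparison_iso:
  assumes G: "cat_functor D C G" and u: "universal_arrow C D G x y \<eta>" "universal_arrow C D G x y' \<eta>'"
    and g: "g \<in> Hom D y y'" "Comp C (ArrMap G g) \<eta> = \<eta>'"
  shows "iso_arrow D g"
proof -
  interpret G: cat_functor D C G by fact
  have y: "y \<in> Obj D" "y' \<in> Obj D" and h: "\<eta> \<in> Hom C x (ObjMap G y)" "\<eta>' \<in> Hom C x (ObjMap G y')"
    using u by (auto simp: universal_arrow_def)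
  obtain k where k: "k \<in> Hom D y' y" "Comp C (ArrMap G k) \<eta>' = \<eta>"
    using u(2) y h unfolding universal_arrow_def by blast
  have "Comp C (ArrMap G (Comp D k g)) \<eta> = \<eta>"
    using k g G.map_comp[OF g(1) k(1)] G.cod_cat.comp_assoc[OF h(1) G.arr_in[OF g(1)] G.arr_in[OF k(1)]] by simp
  moreover have "Comp C (ArrMap G (Id D y)) \<eta> = \<eta>" using h G.map_id[OF y(1)] G.cod_cat.comp_id_left by simp
  ultimately have 1: "Comp D k g = Id D y"
    using u(1) y(1) h(1) G.dom_cat.comp_in[OF g(1) k(1)] G.dom_cat.id_in[OF y(1)] unfolding universal_arrow_def by blast
  have "Comp C (ArrMap G (Comp D g k)) \<eta>' = \<eta>'"
    using k g G.map_comp[OF k(1) g(1)] G.cod_cat.comp_assoc[OF h(2) G.arr_in[OF k(1)] G.arr_in[OF g(1)]] by simp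
  moreover have "Comp C (ArrMap G (Id D y')) \<eta>' = \<eta>'" using h G.map_id[OF y(2)] G.cod_cat.comp_id_left by simp
  ultimately have 2: "Comp D g k = Id D y'"
    using u(2) y(2) h(2) G.dom_cat.comp_in[OF k(1) g(1)] G.dom_cat.id_in[OF y(2)] unfolding universal_arrow_def by blast
  show ?thesis unfolding iso_arrow_def inverse_arrows_def using 1 2 g(1) k(1) by (auto simp: hom_iff)
qed

lemma comp_ftor_functor:
  assumes "cat_functor C D F" "cat_functor D E G" shows "cat_functor C E (comp_ftor G F)"
proof -
  interpret F: cat_functor C D F by fact
  interpret G: cat_functor D E G by fact
  show ?thesis
    by unfold_locales (auto simp: comp_ftor_def F.obj_in G.obj_in F.map_id G.map_id
        intro: G.arr_in F.arr_in F.map_comp[THEN arg_cong, THEN trans] G.map_comp)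
qed

text \<open>Universal arrows are chosen objectwise, and \<open>L\<close> on arrows and the counit
  are defined as transposes. Functoriality, naturality and the triangle identity on \<open>L\<close>
  are then instances of uniqueness of transposes.\<close>

lemma universal_arrows_adjunction:
  assumes G: "cat_functor D C G" and u: "\<And>x. x \<in> Obj C \<Longrightarrow> \<exists>y \<eta>. universal_arrow C D G x y \<eta>"
  shows "\<exists>L \<eta> \<epsilon>. adjunction C D L G \<eta> \<epsilon>"
proof -
  interpret G: cat_functor D C G by fact
  obtain l \<eta> where l: "\<And>x. x \<in> Obj C \<Longrightarrow> universal_arrow C D G x (l x) (\<eta> x)" using u by metis
  have lo: "\<And>x. x \<in> Obj C \<Longrightarrow> l x \<in> Obj D" and e: "\<And>x. x \<in> Obj C \<Longrightarrow> \<eta> x \<in> Hom C x (ObjMap G (l x))"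
    using l by (auto simp: universal_arrow_def)
  define tr where "tr x y f = (THE g. g \<in> Hom D (l x) y \<and> Comp C (ArrMap G g) (\<eta> x) = f)" for x y f
  have tr: "tr x y f \<in> Hom D (l x) y \<and> Comp C (ArrMap G (tr x y f)) (\<eta> x) = f"
    if "x \<in> Obj C" "y \<in> Obj D" "f \<in> Hom C x (ObjMap G y)" for x y f
    unfolding tr_def by (rule theI') (use l[OF that(1)] that in \<open>auto simp: universal_arrow_def\<close>)
  note tr_in = tr[THEN conjunct1] and tr_eq = tr[THEN conjunct2]
  \<comment> \<open>The cancellation rule behind all equations below: maps out of \<open>l x\<close>
    agree once they agree under \<open>G\<close> after precomposition with
    \<open>\<eta> x\<close>.\<close>
  have ueq: "g = g'" if "x \<in> Obj C" "g \<in> Hom D (l x) y" "g' \<in> Hom D (l x) y"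
      "Comp C (ArrMap G g) (\<eta> x) = Comp C (ArrMap G g') (\<eta> x)" for x y g g'
  proof -
    have "y \<in> Obj D" using that by (auto simp: hom_iff G.dom_cat.cod_in)
    then show ?thesis using l[OF that(1)] that(2-)
        G.cod_cat.comp_in[OF e[OF that(1)] G.arr_in[OF that(3)]] unfolding universal_arrow_def by blast
  qed
  have Gcomp: "Comp C (ArrMap G (Comp D g f)) (\<eta> x) = Comp C (ArrMap G g) (Comp C (ArrMap G f) (\<eta> x))"
    if "x \<in> Obj C" "f \<in> Hom D (l x) y" "g \<in> Hom D y z" for x y z f g
    using G.map_comp[OF that(2,3)] G.cod_cat.comp_assoc[OF e[OF that(1)] G.arr_in[OF that(2)] G.arr_in[OF that(3)]] by simp
  define La where "La f = tr (Dom C f) (l (Cod C f)) (Comp C (\<eta> (Cod C f)) f)" for f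
  define L where "L = \<lparr>ObjMap = l, ArrMap = La\<rparr>"
  define \<epsilon> where "\<epsilon> y = tr (ObjMap G y) y (Id C (ObjMap G y))" for y
  have ef: "Comp C (\<eta> y) f \<in> Hom C x (ObjMap G (l y))" "x \<in> Obj C" "y \<in> Obj C" if "f \<in> Hom C x y" for f x y
  proof -
    show "x \<in> Obj C" and y: "y \<in> Obj C" using that by (auto simp: G.cod_cat.cat_simps)
    show "Comp C (\<eta> y) f \<in> Hom C x (ObjMap G (l y))" using G.cod_cat.comp_in[OF that e[OF y]] .
  qed
  have La: "La f \<in> Hom D (l x) (l y)" "Comp C (ArrMap G (La f)) (\<eta> x) = Comp C (\<eta> y) f" if "f \<in> Hom C x y" for f x y
    using tr[OF ef(2)[OF that] lo[OF ef(3)[OF that]] ef(1)[OF that]] that by (auto simp: La_def hom_iff)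
  have Lf: "cat_functor C D L"
  proof
    show "ObjMap L x \<in> Obj D" if "x \<in> Obj C" for x using that lo by (simp add: L_def)
    show "ArrMap L f \<in> Hom D (ObjMap L x) (ObjMap L y)" if "f \<in> Hom C x y" for f x y
      using La(1)[OF that] by (simp add: L_def)
    show "ArrMap L (Id C x) = Id D (ObjMap L x)" if x: "x \<in> Obj C" for x
      unfolding L_def ftor.simps
      by (rule ueq[OF x La(1)[OF G.cod_cat.id_in[OF x]] G.dom_cat.id_in[OF lo[OF x]]])
        (use La(2)[OF G.cod_cat.id_in[OF x]] e[OF x] G.map_id[OF lo[OF x]] in
          \<open>simp add: G.cod_cat.comp_id_left G.cod_cat.comp_id_right\<close>)
    show "ArrMap L (Comp C g f) = Comp D (ArrMap L g) (ArrMap L f)"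
      if f: "f \<in> Hom C x y" and g: "g \<in> Hom C y z" for f g x y z
      unfolding L_def ftor.simps
    proof (rule ueq[OF ef(2)[OF f] La(1)[OF G.cod_cat.comp_in[OF f g]] G.dom_cat.comp_in[OF La(1)[OF f] La(1)[OF g]]])
      have "Comp C (ArrMap G (Comp D (La g) (La f))) (\<eta> x) = Comp C (ArrMap G (La g)) (Comp C (\<eta> y) f)"
        using Gcomp[OF ef(2)[OF f] La(1)[OF f] La(1)[OF g]] La(2)[OF f] by simp
      also have "\<dots> = Comp C (\<eta> z) (Comp C g f)"
        using G.cod_cat.comp_assoc[OF f e[OF ef(3)[OF f]] G.arr_in[OF La(1)[OF g]]] La(2)[OF g]
          G.cod_cat.comp_assoc[OF f g e[OF ef(3)[OF g]]] by simp
      finally show "Comp C (ArrMap G (La (Comp C g f))) (\<eta> x) = Comp C (ArrMap G (Comp D (La g) (La f))) (\<eta> x)"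
        using La(2)[OF G.cod_cat.comp_in[OF f g]] by simp
    qed
  qed
  interpret L: cat_functor C D L by fact
  have ep: "\<epsilon> y \<in> Hom D (l (ObjMap G y)) y" "Comp C (ArrMap G (\<epsilon> y)) (\<eta> (ObjMap G y)) = Id C (ObjMap G y)"
    if "y \<in> Obj D" for y
    using tr[OF G.obj_in[OF that] that G.cod_cat.id_in[OF G.obj_in[OF that]]] by (auto simp: \<epsilon>_def)
  have n1: "nat_trans C C id_ftor (comp_ftor G L) \<eta>"
    unfolding nat_trans_def
  proof (intro conjI ballI)
    show "cat_functor C C id_ftor" by unfold_locales (auto simp: id_ftor_def)
    show "cat_functor C C (comp_ftor G L)" by (rule comp_ftor_functor[OF Lf G])
    show "\<eta> x \<in> Hom C (ObjMap id_ftor x) (ObjMap (comp_ftor G L) x)" if "x \<in> Obj C" for x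
      using e[OF that] by (simp add: id_ftor_def comp_ftor_def L_def)
    show "Comp C (\<eta> (Cod C f)) (ArrMap id_ftor f) = Comp C (ArrMap (comp_ftor G L) f) (\<eta> (Dom C f))"
      if "f \<in> Arr C" for f
      using La(2)[of f "Dom C f" "Cod C f"] that by (simp add: id_ftor_def comp_ftor_def L_def hom_iff)
  qed
  have n2: "nat_trans D D (comp_ftor L G) id_ftor \<epsilon>"
    unfolding nat_trans_def
  proof (intro conjI ballI)
    show "cat_functor D D id_ftor" by unfold_locales (auto simp: id_ftor_def)
    show "cat_functor D D (comp_ftor L G)" by (rule comp_ftor_functor[OF G Lf])
    show "\<epsilon> x \<in> Hom D (ObjMap (comp_ftor L G) x) (ObjMap id_ftor x)" if "x \<in> Obj D" for x
      using ep(1)[OF that] by (simp add: id_ftor_def comp_ftor_def L_def)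
    show "Comp D (\<epsilon> (Cod D f)) (ArrMap (comp_ftor L G) f) = Comp D (ArrMap id_ftor f) (\<epsilon> (Dom D f))"
      if fa: "f \<in> Arr D" for f
    proof -
      define x y where "x = Dom D f" and "y = Cod D f"
      have f: "f \<in> Hom D x y" and x: "x \<in> Obj D" and y: "y \<in> Obj D"
        using fa by (auto simp: x_def y_def hom_iff G.dom_cat.dom_in G.dom_cat.cod_in)
      note Gf = G.arr_in[OF f] and Gx = G.obj_in[OF x] and Gy = G.obj_in[OF y]
      have "Comp D (\<epsilon> y) (La (ArrMap G f)) = Comp D f (\<epsilon> x)"
      proof (rule ueq[OF Gx G.dom_cat.comp_in[OF La(1)[OF Gf] ep(1)[OF y]] G.dom_cat.comp_in[OF ep(1)[OF x] f]])
        have "Comp C (ArrMap G (Comp D (\<epsilon> y) (La (ArrMap G f)))) (\<eta> (ObjMap G x))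
          = Comp C (ArrMap G (\<epsilon> y)) (Comp C (\<eta> (ObjMap G y)) (ArrMap G f))"
          using Gcomp[OF Gx La(1)[OF Gf] ep(1)[OF y]] La(2)[OF Gf] by simp
        also have "\<dots> = ArrMap G f"
          using G.cod_cat.comp_assoc[OF Gf e[OF Gy] G.arr_in[OF ep(1)[OF y]]] ep(2)[OF y] Gf
          by (simp add: G.cod_cat.comp_id_left)
        finally show "Comp C (ArrMap G (Comp D (\<epsilon> y) (La (ArrMap G f)))) (\<eta> (ObjMap G x))
          = Comp C (ArrMap G (Comp D f (\<epsilon> x))) (\<eta> (ObjMap G x))"
          using Gcomp[OF Gx ep(1)[OF x] f] ep(2)[OF x] Gf by (simp add: G.cod_cat.comp_id_right)
      qed
      then show ?thesis by (simp add: id_ftor_def comp_ftor_def L_def x_def y_def)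
    qed
  qed
  have t1: "Comp D (\<epsilon> (ObjMap L x)) (ArrMap L (\<eta> x)) = Id D (ObjMap L x)" if x: "x \<in> Obj C" for x
  proof -
    note ex = e[OF x] and ll = lo[OF x]
    note gl = G.obj_in[OF ll]
    have "Comp D (\<epsilon> (l x)) (La (\<eta> x)) = Id D (l x)"
    proof (rule ueq[OF x G.dom_cat.comp_in[OF La(1)[OF ex] ep(1)[OF ll]] G.dom_cat.id_in[OF ll]])
      have "Comp C (ArrMap G (Comp D (\<epsilon> (l x)) (La (\<eta> x)))) (\<eta> x)
        = Comp C (ArrMap G (\<epsilon> (l x))) (Comp C (\<eta> (ObjMap G (l x))) (\<eta> x))"
        using Gcomp[OF x La(1)[OF ex] ep(1)[OF ll]] La(2)[OF ex] by simp
      also have "\<dots> = \<eta> x"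
        using G.cod_cat.comp_assoc[OF ex e[OF gl] G.arr_in[OF ep(1)[OF ll]]] ep(2)[OF ll] ex
        by (simp add: G.cod_cat.comp_id_left)
      finally show "Comp C (ArrMap G (Comp D (\<epsilon> (l x)) (La (\<eta> x)))) (\<eta> x) = Comp C (ArrMap G (Id D (l x))) (\<eta> x)"
        using G.map_id[OF ll] ex by (simp add: G.cod_cat.comp_id_left)
    qed
    then show ?thesis by (simp add: L_def)
  qed
  show ?thesis
    unfolding adjunction_def using Lf G n1 n2 t1 ep(2) by blast
qed

text \<open>The triple is picked by Hilbert choice, so existence of some adjunction is what turns
  the picked data into one; no formula for it becomes available.\<close>

lemma left_adjoint_adjunction:
  assumes "adjunction C D L G \<eta> \<epsilon>" "left_adjoint C D G = (L', \<eta>', \<epsilon>')"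
  shows "adjunction C D L' G \<eta>' \<epsilon>'"
  using assms someI[of "\<lambda>T. case T of (L, \<eta>, \<epsilon>) \<Rightarrow> adjunction C D L G \<eta> \<epsilon>" "(L, \<eta>, \<epsilon>)"]
  by (simp add: left_adjoint_def)

text \<open>The mate of the square is the map that corresponds to \<open>r \<eta>\<^sub>f\<close> under the adjunction for \<open>s\<close>, so it compares
  two universal arrows.\<close>

lemma mate_nat_iso:
  assumes f: "adjunction CA CC Lf f \<eta>f \<epsilon>f" and s: "adjunction CR CB Ls s \<eta>s \<epsilon>s"
    and r: "cat_functor CA CR r" and g: "cat_functor CC CB g"
    and obj: "\<And>y. y \<in> Obj CC \<Longrightarrow> ObjMap r (ObjMap f y) = ObjMap s (ObjMap g y)"
    and arr: "\<And>h. h \<in> Arr CC \<Longrightarrow> ArrMap r (ArrMap f h) = ArrMap s (ArrMap g h)"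
    and univ: "\<And>x. x \<in> Obj CA \<Longrightarrow> universal_arrow CR CB s (ObjMap r x) (ObjMap g (ObjMap Lf x)) (ArrMap r (\<eta>f x))"
  shows "nat_iso CA CB (comp_ftor Ls r) (comp_ftor g Lf)
     (\<lambda>x. Comp CB (\<epsilon>s (ObjMap g (ObjMap Lf x))) (ArrMap Ls (ArrMap r (\<eta>f x))))"
proof -
  interpret f: cat_functor CC CA f using f by (simp add: adjunction_def)
  interpret Lf: cat_functor CA CC Lf using f by (simp add: adjunction_def)
  interpret s: cat_functor CB CR s using s by (simp add: adjunction_def)
  interpret Ls: cat_functor CR CB Ls using s by (simp add: adjunction_def)
  interpret r: cat_functor CA CR r by fact
  interpret g: cat_functor CC CB g by fact
  have ef: "\<And>z. z \<in> Obj CA \<Longrightarrow> \<eta>f z \<in> Hom CA z (ObjMap f (ObjMap Lf z))"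
    "\<And>h. h \<in> Arr CA \<Longrightarrow> Comp CA (\<eta>f (Cod CA h)) h = Comp CA (ArrMap f (ArrMap Lf h)) (\<eta>f (Dom CA h))"
    using f by (auto simp: adjunction_def nat_trans_def id_ftor_def comp_ftor_def)
  have es: "\<And>z. z \<in> Obj CB \<Longrightarrow> \<epsilon>s z \<in> Hom CB (ObjMap Ls (ObjMap s z)) z"
    "\<And>z. z \<in> Obj CR \<Longrightarrow> \<eta>s z \<in> Hom CR z (ObjMap s (ObjMap Ls z))"
    "\<And>h. h \<in> Arr CB \<Longrightarrow> Comp CB (\<epsilon>s (Cod CB h)) (ArrMap Ls (ArrMap s h)) = Comp CB h (\<epsilon>s (Dom CB h))"
    "\<And>h. h \<in> Arr CR \<Longrightarrow> Comp CR (\<eta>s (Cod CR h)) h = Comp CR (ArrMap s (ArrMap Ls h)) (\<eta>s (Dom CR h))"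
    "\<And>y. y \<in> Obj CB \<Longrightarrow> Comp CR (ArrMap s (\<epsilon>s y)) (\<eta>s (ObjMap s y)) = Id CR (ObjMap s y)"
    using s by (auto simp: adjunction_def nat_trans_def id_ftor_def comp_ftor_def)
  define \<eta> where "\<eta> x = ArrMap r (\<eta>f x)" for x
  have e: "\<eta> x \<in> Hom CR (ObjMap r x) (ObjMap s (ObjMap g (ObjMap Lf x)))" if "x \<in> Obj CA" for x
    using r.arr_in[OF ef(1)[OF that]] obj[OF Lf.obj_in[OF that]] by (simp add: \<eta>_def)
  define \<beta> where "\<beta> x = Comp CB (\<epsilon>s (ObjMap g (ObjMap Lf x))) (ArrMap Ls (\<eta> x))" for x
  have b: "\<beta> x \<in> Hom CB (ObjMap Ls (ObjMap r x)) (ObjMap g (ObjMap Lf x))" if "x \<in> Obj CA" for x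
    unfolding \<beta>_def by (rule s.dom_cat.comp_in[OF Ls.arr_in[OF e[OF that]] es(1)[OF g.obj_in[OF Lf.obj_in[OF that]]]])
  \<comment> \<open>The transpose of \<open>\<beta> x\<close> under the adjunction for
    \<open>s\<close> is \<open>\<eta> x\<close>: naturality of \<open>\<eta>s\<close>, then the
    triangle identity for \<open>s\<close>.\<close>
  have bu: "Comp CR (ArrMap s (\<beta> x)) (\<eta>s (ObjMap r x)) = \<eta> x" if x: "x \<in> Obj CA" for x
  proof -
    define y where "y = ObjMap g (ObjMap Lf x)"
    have y: "y \<in> Obj CB" using x by (simp add: y_def g.obj_in Lf.obj_in)
    note ex = e[OF x, folded y_def] and ey = es(1)[OF y]
    have rx: "ObjMap r x \<in> Obj CR" using x by (rule r.obj_in)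
    have "Comp CR (ArrMap s (\<beta> x)) (\<eta>s (ObjMap r x))
      = Comp CR (ArrMap s (\<epsilon>s y)) (Comp CR (ArrMap s (ArrMap Ls (\<eta> x))) (\<eta>s (ObjMap r x)))"
      unfolding \<beta>_def y_def[symmetric]
      using s.map_comp[OF Ls.arr_in[OF ex] ey]
        s.cod_cat.comp_assoc[OF es(2)[OF rx] s.arr_in[OF Ls.arr_in[OF ex]] s.arr_in[OF ey]] by simp
    also have "\<dots> = Comp CR (Comp CR (ArrMap s (\<epsilon>s y)) (\<eta>s (ObjMap s y))) (\<eta> x)"
      using es(4)[of "\<eta> x"] ex s.cod_cat.comp_assoc[OF ex es(2)[OF s.obj_in[OF y]] s.arr_in[OF ey]]
      by (simp add: hom_iff)
    finally show ?thesis using es(5)[OF y] ex by (simp add: s.cod_cat.comp_id_left)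
  qed
  have "nat_trans CA CB (comp_ftor Ls r) (comp_ftor g Lf) \<beta>"
    unfolding nat_trans_def
  proof (intro conjI ballI)
    show "cat_functor CA CB (comp_ftor Ls r)" "cat_functor CA CB (comp_ftor g Lf)"
      by (intro comp_ftor_functor; unfold_locales)+
    show "\<beta> x \<in> Hom CB (ObjMap (comp_ftor Ls r) x) (ObjMap (comp_ftor g Lf) x)" if "x \<in> Obj CA" for x
      using b[OF that] by (simp add: comp_ftor_def)
    show "Comp CB (\<beta> (Cod CA h)) (ArrMap (comp_ftor Ls r) h) = Comp CB (ArrMap (comp_ftor g Lf) h) (\<beta> (Dom CA h))"
      if ha: "h \<in> Arr CA" for h
    proof -
      define x y where "x = Dom CA h" and "y = Cod CA h"
      define k where "k = ArrMap g (ArrMap Lf h)"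
      have h: "h \<in> Hom CA x y" and x: "x \<in> Obj CA" and y: "y \<in> Obj CA"
        using ha by (auto simp: x_def y_def hom_iff f.cod_cat.dom_in f.cod_cat.cod_in)
      have k: "k \<in> Hom CB (ObjMap g (ObjMap Lf x)) (ObjMap g (ObjMap Lf y))"
        unfolding k_def by (rule g.arr_in[OF Lf.arr_in[OF h]])
      have "Lf_arr": "ArrMap Lf h \<in> Arr CC" using Lf.arr_in[OF h] by (simp add: hom_iff)
      \<comment> \<open>Naturality of \<open>\<eta>f\<close>, carried along \<open>r\<close> and
        rewritten by \<open>r f = s g\<close> on arrows.\<close>
      have nat: "Comp CR (\<eta> y) (ArrMap r h) = Comp CR (ArrMap s k) (\<eta> x)"
        using arg_cong[OF ef(2)[OF ha], of "ArrMap r"] r.map_comp[OF h ef(1)[OF y]]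
          r.map_comp[OF ef(1)[OF x] f.arr_in[OF Lf.arr_in[OF h]]] arr[OF Lf_arr]
        by (simp add: x_def[symmetric] y_def[symmetric] \<eta>_def k_def)
      note rh = r.arr_in[OF h] and ex = e[OF x] and ey = e[OF y]
      note zx = g.obj_in[OF Lf.obj_in[OF x]] and zy = g.obj_in[OF Lf.obj_in[OF y]]
      have "Comp CB (\<beta> y) (ArrMap Ls (ArrMap r h))
        = Comp CB (\<epsilon>s (ObjMap g (ObjMap Lf y))) (ArrMap Ls (Comp CR (\<eta> y) (ArrMap r h)))"
        unfolding \<beta>_def using s.dom_cat.comp_assoc[OF Ls.arr_in[OF rh] Ls.arr_in[OF ey] es(1)[OF zy]]
          Ls.map_comp[OF rh ey] by simp
      also have "\<dots> = Comp CB (Comp CB (\<epsilon>s (ObjMap g (ObjMap Lf y))) (ArrMap Ls (ArrMap s k))) (ArrMap Ls (\<eta> x))"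
        unfolding nat using Ls.map_comp[OF ex s.arr_in[OF k]]
          s.dom_cat.comp_assoc[OF Ls.arr_in[OF ex] Ls.arr_in[OF s.arr_in[OF k]] es(1)[OF zy]] by simp
      also have "\<dots> = Comp CB k (\<beta> x)"
        unfolding \<beta>_def using es(3)[of k] k s.dom_cat.comp_assoc[OF Ls.arr_in[OF ex] es(1)[OF zx] k]
        by (simp add: hom_iff)
      finally show ?thesis by (simp add: comp_ftor_def x_def y_def k_def)
    qed
  qed
  moreover have "iso_arrow CB (\<beta> x)" if x: "x \<in> Obj CA" for x
    using universal_arrow_comparison_iso[OF _ adjunction_universal[OF s r.obj_in[OF x]] univ[OF x] b[OF x]]
      bu[OF x] s.cat_functor_axioms by (simp add: \<eta>_def)
  ultimately show ?thesis unfolding nat_iso_def \<beta>_def[abs_def] \<eta>_def by blast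
qed

section \<open>Connected components and fibers\<close>

context category
begin

lemma connected_refl: "x \<in> Obj C \<Longrightarrow> (x, x) \<in> connected_rel C"
  by (simp add: connected_rel_def)

lemma connected_obj: assumes "(x, y) \<in> connected_rel C" shows "x \<in> Obj C" "y \<in> Obj C"
proof -
  show "x \<in> Obj C" using assms by (simp add: connected_rel_def)
  have "(x, y) \<in> ({(x, y). Hom C x y \<noteq> {}} \<union> {(x, y). Hom C y x \<noteq> {}})\<^sup>*" using assms by (simp add: connected_rel_def)
  then show "y \<in> Obj C"
    by (induction rule: rtrancl_induct) (use assms in \<open>auto simp: connected_rel_def hom_iff dom_in cod_in\<close>)
qed

lemma connected_sym: assumes "(x, y) \<in> connected_rel C" shows "(y, x) \<in> connected_rel C"
proof -
  let ?S = "{(x, y). Hom C x y \<noteq> {}} \<union> {(x, y). Hom C y x \<noteq> {}}"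
  have "sym (?S\<^sup>*)" by (rule sym_rtrancl) (auto simp: sym_def)
  then show ?thesis using assms connected_obj[OF assms] by (simp add: connected_rel_def symD)
qed

lemma connected_trans: "\<lbrakk>(x, y) \<in> connected_rel C; (y, z) \<in> connected_rel C\<rbrakk> \<Longrightarrow> (x, z) \<in> connected_rel C"
  by (auto simp: connected_rel_def intro: rtrancl_trans)

lemma connected_hom: "f \<in> Hom C x y \<Longrightarrow> (x, y) \<in> connected_rel C"
  unfolding connected_rel_def by (auto simp: hom_iff dom_in intro!: r_into_rtrancl)

lemma component_eq: "(x, y) \<in> connected_rel C \<Longrightarrow> connected_rel C `` {x} = connected_rel C `` {y}"
  using connected_sym connected_trans by blast

lemma component_in_pi0: "x \<in> Obj C \<Longrightarrow> connected_rel C `` {x} \<in> pi0 C"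
  by (simp add: pi0_def quotientI)

lemma pi0_component: "\<lbrakk>c \<in> pi0 C; x \<in> c\<rbrakk> \<Longrightarrow> connected_rel C `` {x} = c"
  using component_eq by (auto simp: pi0_def quotient_def)

lemma pi0_obj: "\<lbrakk>c \<in> pi0 C; x \<in> c\<rbrakk> \<Longrightarrow> x \<in> Obj C"
  using connected_obj by (auto simp: pi0_def quotient_def)

lemma pi0_hom_eq: "\<lbrakk>c \<in> pi0 C; d \<in> pi0 C; f \<in> Hom C x y; x \<in> c; y \<in> d\<rbrakk> \<Longrightarrow> c = d"
  using pi0_component component_eq[OF connected_hom] by metis

end

context cat_functor
begin

lemma map_connected: assumes "(x, y) \<in> connected_rel C" shows "(ObjMap F x, ObjMap F y) \<in> connected_rel D"
proof -
  have x: "x \<in> Obj C" using assms by (rule dom_cat.connected_obj)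
  have "(x, y) \<in> ({(x, y). Hom C x y \<noteq> {}} \<union> {(x, y). Hom C y x \<noteq> {}})\<^sup>*" using assms by (simp add: connected_rel_def)
  then show ?thesis
  proof (induction rule: rtrancl_induct)
    case base
    show ?case using x by (intro cod_cat.connected_refl obj_in)
  next
    case (step y z)
    have "(ObjMap F y, ObjMap F z) \<in> connected_rel D"
      using step(2) arr_in cod_cat.connected_hom cod_cat.connected_sym by blast
    then show ?case using step(3) cod_cat.connected_trans by blast
  qed
qed

text \<open>Although \<open>pi0_map\<close> is a union over all points of \<open>c\<close>, functors
  preserve connectedness, so each point contributes the same component.\<close>

lemma pi0_map_component: assumes "c \<in> pi0 C" "x \<in> c" shows "pi0_map D (ObjMap F) c = connected_rel D `` {ObjMap F x}"
proof -
  have "connected_rel D `` {ObjMap F y} = connected_rel D `` {ObjMap F x}" if "y \<in> c" for y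
    using dom_cat.pi0_component[OF assms] that map_connected cod_cat.component_eq by blast
  then show ?thesis using assms(2) unfolding pi0_map_def by blast
qed

lemma pi0_map_in: assumes "c \<in> pi0 C" "x \<in> c" shows "pi0_map D (ObjMap F) c \<in> pi0 D"
  using pi0_map_component[OF assms] dom_cat.pi0_obj[OF assms] by (simp add: cod_cat.component_in_pi0 obj_in)

lemma map_in_pi0_map: assumes "c \<in> pi0 C" "x \<in> c" shows "ObjMap F x \<in> pi0_map D (ObjMap F) c"
  using pi0_map_component[OF assms] dom_cat.pi0_obj[OF assms] by (simp add: cod_cat.connected_refl obj_in)

end

section \<open>Enumeration of the fibers of maps between finite ordinals\<close>

lemma card_le_nth_strict_sorted:
  assumes "sorted_wrt (<) (xs :: nat list)" "k < length xs"
  shows "card {x \<in> set xs. x \<le> xs ! k} = Suc k"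
proof -
  have "{x \<in> set xs. x \<le> xs ! k} = (!) xs ` {..k}"
  proof (intro set_eqI iffI)
    fix x assume x: "x \<in> {x \<in> set xs. x \<le> xs ! k}"
    then obtain l where l: "l < length xs" "xs ! l = x" by (auto simp: in_set_conv_nth)
    then have "l \<le> k" using x sorted_wrt_nth_less[OF assms(1), of k l] by force
    then show "x \<in> (!) xs ` {..k}" using l by auto
  next
    fix x assume "x \<in> (!) xs ` {..k}"
    then obtain l where l: "l \<le> k" "x = xs ! l" by auto
    then have "xs ! l \<le> xs ! k" using sorted_wrt_nth_less[OF assms(1), of l k] assms(2) by (cases "l = k") auto
    then show "x \<in> {x \<in> set xs. x \<le> xs ! k}" using l assms(2) by auto
  qed
  moreover have "inj_on ((!) xs) {..k}"
    using assms by (intro inj_on_nth) (auto simp: strict_sorted_iff)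
  ultimately show ?thesis by (simp add: card_image)
qed

lemma set_sfib_list: "set (sfib_list (m, \<phi>, n) i) = {k \<in> {1..m}. \<phi> k = i}"
  by (auto simp del: upt_Suc)

text \<open>Listing a fiber and ranking a point within it are mutually inverse. Ranks count from 1
  and list indices from 0, whence \<open>Suc k\<close>.\<close>

lemma sfib_pos_nth:
  assumes "k < length (sfib_list (m, \<phi>, n) i)"
  shows "sfib_list (m, \<phi>, n) i ! k \<in> {1..m}" "\<phi> (sfib_list (m, \<phi>, n) i ! k) = i"
    "sfib_pos (m, \<phi>, n) (sfib_list (m, \<phi>, n) i ! k) = Suc k"
proof -
  let ?xs = "sfib_list (m, \<phi>, n) i"
  have "?xs ! k \<in> set ?xs" using assms by (rule nth_mem)
  then show 1: "?xs ! k \<in> {1..m}" "\<phi> (?xs ! k) = i" unfolding set_sfib_list by (auto simp del: sfib_list.simps)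
  have "{l \<in> {1..?xs ! k}. \<phi> l = \<phi> (?xs ! k)} = {x \<in> set ?xs. x \<le> ?xs ! k}"
    unfolding set_sfib_list using 1 by (auto simp del: sfib_list.simps)
  moreover have "sorted_wrt (<) ?xs" by (simp add: sorted_wrt_filter del: upt_Suc)
  ultimately show "sfib_pos (m, \<phi>, n) (?xs ! k) = Suc k"
    using card_le_nth_strict_sorted[of ?xs k] assms by (simp del: sfib_list.simps)
qed

lemma sfib_pos_in:
  assumes "j \<in> {1..m}"
  shows "sfib_pos (m, \<phi>, n) j \<in> {1..sfib (m, \<phi>, n) (\<phi> j)}"
proof -
  have "j \<in> set (sfib_list (m, \<phi>, n) (\<phi> j))" using assms unfolding set_sfib_list by simp
  then obtain k where k: "k < length (sfib_list (m, \<phi>, n) (\<phi> j))" "sfib_list (m, \<phi>, n) (\<phi> j) ! k = j"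
    by (metis in_set_conv_nth)
  show ?thesis using sfib_pos_nth(3)[OF k(1)] k unfolding sfib_def by simp
qed

lemma distinct_concat_filter:
  assumes "distinct js" "distinct ks"
  shows "distinct (concat (map (\<lambda>i. filter (\<lambda>k. \<phi> k = i) ks) js))"
  using assms by (induction js) auto

context operadic_category
begin

lemma set_pts_list: "set (pts_list A T) = pts A T"
  by (auto simp: pts_list_def pts_def)

lemma length_pts_list: "length (pts_list A T) = size_of A T"
  by (simp add: pts_list_def)

lemma distinct_pts_list: "distinct (pts_list A T)"
  by (simp add: pts_list_def)

lemma card_arr:
  assumes "g \<in> Hom A S R"
  shows "ArrMap (Card A) g = (size_of A S, pt_map A g, size_of A R)" "pt_map A g \<in> pts A S \<rightarrow>\<^sub>E pts A R"
proof -
  interpret Card: cat_functor A sFSet "Card A" by (rule card_functor)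
  have "ArrMap (Card A) g \<in> Hom sFSet (size_of A S) (size_of A R)" using Card.arr_in[OF assms] .
  then show "ArrMap (Card A) g = (size_of A S, pt_map A g, size_of A R)" "pt_map A g \<in> pts A S \<rightarrow>\<^sub>E pts A R"
    by (auto simp: hom_iff sFSet_def pt_map_def pts_def)
qed

lemma pt_map_in: "\<lbrakk>g \<in> Hom A S R; j \<in> pts A S\<rbrakk> \<Longrightarrow> pt_map A g j \<in> pts A R"
  using card_arr(2) by fastforce

lemma pt_pos_in:
  assumes "g \<in> Hom A S R" "j \<in> pts A S"
  shows "pt_pos A g j \<in> pts A (Fib A g (pt_map A g j))"
  using sfib_pos_in[of j "size_of A S" "pt_map A g" "size_of A R"] assms fib_card[OF assms(1) pt_map_in[OF assms]]
    card_arr(1)[OF assms(1)]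
  by (simp add: pts_def pt_pos_def)

lemma length_sfib_list:
  "\<lbrakk>g \<in> Hom A S R; i \<in> pts A R\<rbrakk> \<Longrightarrow> length (sfib_list (ArrMap (Card A) g) i) = size_of A (Fib A g i)"
  using fib_card by (simp add: sfib_def)

lemma nth_sfib_list:
  assumes "g \<in> Hom A S R" "i \<in> pts A R" "k < size_of A (Fib A g i)"
  shows "sfib_list (ArrMap (Card A) g) i ! k \<in> pts A S" "pt_map A g (sfib_list (ArrMap (Card A) g) i ! k) = i"
    "pt_pos A g (sfib_list (ArrMap (Card A) g) i ! k) = Suc k"
proof -
  have k: "k < length (sfib_list (size_of A S, pt_map A g, size_of A R) i)"
    using assms length_sfib_list[OF assms(1,2)] card_arr(1)[OF assms(1)] by simp
  show "sfib_list (ArrMap (Card A) g) i ! k \<in> pts A S" "pt_map A g (sfib_list (ArrMap (Card A) g) i ! k) = i"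
    "pt_pos A g (sfib_list (ArrMap (Card A) g) i ! k) = Suc k"
    using sfib_pos_nth[OF k] by (simp_all add: pts_def pt_pos_def card_arr(1)[OF assms(1)] del: sfib_list.simps)
qed

text \<open>Every point of a fiber of \<open>g\<close> comes from a point of \<open>S\<close>. This
  permits statements about the fibers of \<open>f_i\<close>, indexed by pairs \<open>(i, k)\<close>,
  to be deduced from statements about the fibers of \<open>f\<close>, indexed by
  \<open>j\<close>.\<close>

lemma fib_position:
  assumes "g \<in> Hom A S R" "i \<in> pts A R" "k \<in> pts A (Fib A g i)"
  obtains j where "j \<in> pts A S" "pt_map A g j = i" "pt_pos A g j = k"
proof -
  have k: "k - 1 < size_of A (Fib A g i)" "Suc (k - 1) = k" using assms(3) by (auto simp: pts_def)
  show ?thesis using that nth_sfib_list[OF assms(1,2) k(1)] k(2) by simp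
qed

lemma fibmap_in:
  assumes "f \<in> Hom A T S" "g \<in> Hom A S R" "i \<in> pts A R"
  shows "FibMap A f g i \<in> Hom A (Fib A (Comp A g f) i) (Fib A g i)"
proof -
  have R: "R \<in> Obj A" using assms(2) by (auto simp: hom_iff cod_in)
  interpret fib: cat_functor "slice A R" A "\<lparr>ObjMap = (\<lambda>g. Fib A g i), ArrMap = (\<lambda>(f, g). FibMap A f g i)\<rparr>"
    by (rule fib_functor[OF R assms(3)])
  have "(f, g) \<in> Hom (slice A R) (Comp A g f) g" using assms by (auto simp: slice_def hom_iff)
  from fib.arr_in[OF this] show ?thesis by simp
qed

text \<open>The axiom \<open>fib_fib\<close> in the form of lists: in increasing order, the fibers
  of \<open>f_i\<close> are the fibers of \<open>f\<close> over the preimage of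
  \<open>i\<close>.\<close>

lemma map_fib_fibmap:
  assumes "f \<in> Hom A T S" "g \<in> Hom A S R" "i \<in> pts A R"
  shows "map (\<lambda>k. X (Fib A (FibMap A f g i) k)) (pts_list A (Fib A g i))
    = map (\<lambda>j. X (Fib A f j)) (sfib_list (ArrMap (Card A) g) i)"
proof (rule nth_equalityI)
  show "length (map (\<lambda>k. X (Fib A (FibMap A f g i) k)) (pts_list A (Fib A g i)))
    = length (map (\<lambda>j. X (Fib A f j)) (sfib_list (ArrMap (Card A) g) i))"
    using length_sfib_list[OF assms(2,3)] by (simp add: length_pts_list)
  fix k assume "k < length (map (\<lambda>k. X (Fib A (FibMap A f g i) k)) (pts_list A (Fib A g i)))"
  then have k: "k < size_of A (Fib A g i)" by (simp add: length_pts_list)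
  note n = nth_sfib_list[OF assms(2,3) k]
  have "pts_list A (Fib A g i) ! k = Suc k" using k by (simp add: pts_list_def del: upt_Suc)
  then show "map (\<lambda>k. X (Fib A (FibMap A f g i) k)) (pts_list A (Fib A g i)) ! k
    = map (\<lambda>j. X (Fib A f j)) (sfib_list (ArrMap (Card A) g) i) ! k"
    using k fib_fib[OF assms(1,2) n(1)] n(2,3) length_sfib_list[OF assms(2,3)] by (simp add: length_pts_list)
qed

lemma set_regrouped:
  assumes "g \<in> Hom A S R"
  shows "set (concat (map (sfib_list (ArrMap (Card A) g)) (pts_list A R))) = pts A S"
  using pt_map_in[OF assms] unfolding card_arr(1)[OF assms] set_concat set_map
  by (auto simp: set_sfib_list set_pts_list pts_def simp del: sfib_list.simps)

text \<open>Each point of \<open>S\<close> lies over exactly one point of \<open>R\<close>, so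
  grouping by image neither repeats nor loses points. Hence \<open>regroup_iso\<close> does end in
  \<open>P(f)\<close>.\<close>

lemma sort_regrouped:
  assumes "g \<in> Hom A S R"
  shows "sort (concat (map (sfib_list (ArrMap (Card A) g)) (pts_list A R))) = pts_list A S"
proof (rule sorted_distinct_set_unique)
  show "distinct (sort (concat (map (sfib_list (ArrMap (Card A) g)) (pts_list A R))))"
    using distinct_concat_filter[where \<phi> = "pt_map A g" and js = "pts_list A R" and ks = "[1..<Suc (size_of A S)]",
        OF distinct_pts_list distinct_upt]
    by (simp add: card_arr(1)[OF assms] del: upt_Suc cong: map_cong)
  show "set (sort (concat (map (sfib_list (ArrMap (Card A) g)) (pts_list A R)))) = set (pts_list A S)"
    unfolding set_sort set_pts_list by (rule set_regrouped[OF assms])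
qed (auto simp: pts_list_def distinct_pts_list[unfolded pts_list_def] simp del: upt_Suc)

lemma term_obj: "c \<in> pi0 A \<Longrightarrow> Term A c \<in> Obj A"
  using pi0_obj term_in by blast

lemma component_term: "c \<in> pi0 A \<Longrightarrow> connected_rel A `` {Term A c} = c"
  using pi0_component term_in by blast

lemma pts_list_term: "c \<in> pi0 A \<Longrightarrow> pts_list A (Term A c) = [1]"
  by (simp add: pts_list_def term_card)

lemma pts_term: "c \<in> pi0 A \<Longrightarrow> pts A (Term A c) = {1}"
  by (simp add: pts_def term_card)

text \<open>Units are indexed by components; this says that the unit of the component of a fiber of
  an identity lands in the value of the operad at that very fiber.\<close>

lemma fib_id_term:
  assumes "T \<in> Obj A" "i \<in> pts A T"
  shows "connected_rel A `` {Fib A (Id A T) i} \<in> pi0 A"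
    "Term A (connected_rel A `` {Fib A (Id A T) i}) = Fib A (Id A T) i"
  using fib_id[OF assms] component_term by auto

end

context operadic_functor
begin

lemma pts_list_map: "T \<in> Obj A \<Longrightarrow> pts_list B (ObjMap F T) = pts_list A T"
  by (simp add: pts_list_def over_obj)

lemma pts_map: "T \<in> Obj A \<Longrightarrow> pts B (ObjMap F T) = pts A T"
  by (simp add: pts_def over_obj)

lemma pi0_in: "c \<in> pi0 A \<Longrightarrow> pi0_map B (ObjMap F) c \<in> pi0 B"
  using pi0_map_in dom_op.term_in by blast

end

section \<open>Maps of operads over an operadic functor\<close>

text \<open>Operad data with correct sources and targets but without equations. The operad on
  coproducts has this form until its axioms are derived, and all naturality statements below apply
  to it already.\<close>

locale pre_operad = symmetric_monoidal_category V + base: operadic_category A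
  for V :: "('v, 'w, 'y) smcat_scheme" and A :: "('o, 'a, 'z) opcat_scheme"
    and P :: "('o, 'a, 'v, 'w) operad" +
  assumes op_obj: "T \<in> Obj A \<Longrightarrow> Op P T \<in> Obj V"
    and eta_in: "c \<in> pi0 A \<Longrightarrow> Eta P c \<in> Hom V (Unit V) (Op P (Term A c))"
    and mu_in: "f \<in> Hom A T S \<Longrightarrow> Mu P f \<in> Hom V (Ten V (op_fib V A P f) (Op P S)) (Op P T)"

text \<open>The sides of the axioms are named as functions of the operad, so that one formula can be
  compared for \<open>P\<close> and for \<open>Q\<close>.\<close>

definition mu_assoc_lhs :: "('v, 'w, 'y) smcat_scheme \<Rightarrow> ('o, 'a, 'z) opcat_scheme
    \<Rightarrow> ('o, 'a, 'v, 'w) operad \<Rightarrow> 'a \<Rightarrow> 'a \<Rightarrow> 'w" where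
  "mu_assoc_lhs V A P f g = Comp V (Mu P f)
     (Comp V (TenA V (Id V (op_fib V A P f)) (Mu P g))
       (Comp V (Assoc V (op_fib V A P f) (op_fib V A P g) (Op P (Cod A g)))
         (TenA V (TenA V (regroup_iso V A P f g) (Id V (op_fib V A P g))) (Id V (Op P (Cod A g))))))"

definition mu_assoc_rhs :: "('v, 'w, 'y) smcat_scheme \<Rightarrow> ('o, 'a, 'z) opcat_scheme
    \<Rightarrow> ('o, 'a, 'v, 'w) operad \<Rightarrow> 'a \<Rightarrow> 'a \<Rightarrow> 'w" where
  "mu_assoc_rhs V A P f g = Comp V (Mu P (Comp A g f))
     (Comp V (TenA V (tensA V (map (\<lambda>i. Mu P (FibMap A f g i)) (pts_list A (Cod A g)))) (Id V (Op P (Cod A g))))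
       (TenA V (zip_iso V (map (\<lambda>i. op_fib V A P (FibMap A f g i)) (pts_list A (Cod A g))) (fib_factors A P g))
          (Id V (Op P (Cod A g)))))"

definition mu_unit_left_map :: "('v, 'w, 'y) smcat_scheme \<Rightarrow> ('o, 'a, 'z) opcat_scheme
    \<Rightarrow> ('o, 'a, 'v, 'w) operad \<Rightarrow> 'o \<Rightarrow> 'w" where
  "mu_unit_left_map V A P T = Comp V (Mu P (Id A T))
     (Comp V (TenA V
         (Comp V (tensA V (map (\<lambda>i. Eta P (connected_rel A `` {Fib A (Id A T) i})) (pts_list A T)))
           (unit_iso V (size_of A T)))
         (Id V (Op P T)))
       (inv_arrow V (LUnit V (Op P T))))"

definition mu_unit_right_map :: "('v, 'w, 'y) smcat_scheme \<Rightarrow> ('o, 'a, 'z) opcat_scheme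
    \<Rightarrow> ('o, 'a, 'v, 'w) operad \<Rightarrow> 'o set \<Rightarrow> 'a \<Rightarrow> 'w" where
  "mu_unit_right_map V A P c f = Comp V (Mu P f)
     (Comp V (TenA V (inv_arrow V (RUnit V (Op P (Dom A f)))) (Eta P c)) (inv_arrow V (RUnit V (Op P (Dom A f)))))"

lemma is_operad_iff:
  "is_operad V A P \<longleftrightarrow> pre_operad V A P \<and>
     (\<forall>T S R f g. f \<in> Hom A T S \<longrightarrow> g \<in> Hom A S R \<longrightarrow> mu_assoc_lhs V A P f g = mu_assoc_rhs V A P f g) \<and>
     (\<forall>T\<in>Obj A. mu_unit_left_map V A P T = Id V (Op P T)) \<and>
     (\<forall>T c f. c \<in> pi0 A \<longrightarrow> f \<in> Hom A T (Term A c) \<longrightarrow> mu_unit_right_map V A P c f = Id V (Op P T)) \<and>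
     Op P \<in> extensional (Obj A) \<and> Eta P \<in> extensional (pi0 A) \<and> Mu P \<in> extensional (Arr A)"
proof -
  have c: "f \<in> Hom A S R \<Longrightarrow> Cod A f = R" "f \<in> Hom A S R \<Longrightarrow> Dom A f = S" for f S R by (auto simp: hom_iff)
  show ?thesis
    unfolding is_operad_def is_operad_axioms_def pre_operad_def pre_operad_axioms_def
      mu_assoc_lhs_def mu_assoc_rhs_def mu_unit_left_map_def mu_unit_right_map_def
    by (auto simp: c)
qed

text \<open>A map from \<open>P\<close> to the restriction of \<open>Q\<close>, phrased with the
  structure maps of \<open>Q\<close> itself, so that no restricted operad intervenes in the
  squares.\<close>

locale operad_map_over = operadic_functor A B F + P: pre_operad V A P + Q: pre_operad V B Q
  for V :: "('v, 'w, 'x) smcat_scheme" and A :: "('o, 'a, 'y) opcat_scheme"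
    and B :: "('p, 'b, 'z) opcat_scheme" and F :: "('o, 'a, 'p, 'b) ftor"
    and P :: "('o, 'a, 'v, 'w) operad" and Q :: "('p, 'b, 'v, 'w) operad" and \<phi> :: "'o \<Rightarrow> 'w" +
  assumes over_in: "T \<in> Obj A \<Longrightarrow> \<phi> T \<in> Hom V (Op P T) (Op Q (ObjMap F T))"
    and over_eta: "c \<in> pi0 A \<Longrightarrow> Comp V (\<phi> (Term A c)) (Eta P c) = Eta Q (pi0_map B (ObjMap F) c)"
    and over_mu: "f \<in> Arr A \<Longrightarrow> Comp V (\<phi> (Dom A f)) (Mu P f) = Comp V (Mu Q (ArrMap F f))
      (TenA V (tensA V (map (\<lambda>i. \<phi> (Fib A f i)) (pts_list A (Cod A f)))) (\<phi> (Cod A f)))"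
begin

definition fib_map where "fib_map f = tensA V (map (\<lambda>i. \<phi> (Fib A f i)) (pts_list A (Cod A f)))"

lemma hom_obj: "f \<in> Hom A T S \<Longrightarrow> T \<in> Obj A \<and> S \<in> Obj A"
  by (auto simp: hom_iff dom_cat.dom_in dom_cat.cod_in)

lemma fib_in: "\<lbrakk>f \<in> Hom A T S; i \<in> set (pts_list A S)\<rbrakk> \<Longrightarrow> \<phi> (Fib A f i) \<in> Hom V (Op P (Fib A f i)) (Op Q (Fib B (ArrMap F f) i))"
  using over_in[OF dom_op.fib_obj] map_fib by (simp add: dom_op.set_pts_list)

lemma fib_factors_source: "f \<in> Hom A T S \<Longrightarrow> fib_factors A P f = map (\<lambda>i. Op P (Fib A f i)) (pts_list A S)"
  by (simp add: fib_factors_def hom_iff)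

lemma fib_factors_target:
  assumes "f \<in> Hom A T S" shows "fib_factors B Q (ArrMap F f) = map (\<lambda>i. Op Q (Fib B (ArrMap F f) i)) (pts_list A S)"
  using arr_in[OF assms] hom_obj[OF assms] by (simp add: fib_factors_def hom_iff pts_list_map)

lemma fib_map_in:
  assumes "f \<in> Hom A T S"
  shows "fib_map f \<in> Hom V (op_fib V A P f) (op_fib V B Q (ArrMap F f))"
proof -
  have "Cod A f = S" using assms by (simp add: hom_iff)
  then show ?thesis
    unfolding fib_map_def op_fib_def fib_factors_source[OF assms] fib_factors_target[OF assms]
    using fib_in[OF assms] by (auto intro!: P.tensA_map_in)
qed

lemma sq_mu:
  assumes "f \<in> Hom A T S"
  shows "sq V (TenA V (fib_map f) (\<phi> S)) (\<phi> T) (Mu P f) (Mu Q (ArrMap F f))"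
  by (rule P.sqI[OF P.ten_arr[OF fib_map_in[OF assms] over_in] over_in P.mu_in[OF assms] Q.mu_in[OF arr_in[OF assms]]])
    (use over_mu[of f] hom_obj[OF assms] assms in \<open>auto simp: fib_map_def hom_iff\<close>)

lemma sq_eta:
  assumes "c \<in> pi0 A"
  shows "sq V (Id V (Unit V)) (\<phi> (Term A c)) (Eta P c) (Eta Q (pi0_map B (ObjMap F) c))"
proof (rule P.sqI[OF P.id_in[OF P.unit_obj] over_in P.eta_in[OF assms]])
  show e: "Eta Q (pi0_map B (ObjMap F) c) \<in> Hom V (Unit V) (Op Q (ObjMap F (Term A c)))"
    using Q.eta_in[OF pi0_in[OF assms]] map_term[OF assms] by simp
  show "Comp V (\<phi> (Term A c)) (Eta P c) = Comp V (Eta Q (pi0_map B (ObjMap F) c)) (Id V (Unit V))"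
    using over_eta[OF assms] P.comp_id_right[OF e] by simp
qed (use assms dom_op.term_obj in auto)

text \<open>Both isomorphisms are governed by the same list of points, because \<open>F\<close>
  preserves the underlying map of \<open>g\<close>; only the families of objects differ. Naturality
  of \<open>concat_iso\<close> and of \<open>sort_iso\<close> then applies.\<close>

lemma sq_regroup:
  assumes f: "f \<in> Hom A T S" and g: "g \<in> Hom A S R"
  shows "sq V (tensA V (map (\<lambda>i. fib_map (FibMap A f g i)) (pts_list A R))) (fib_map f)
     (regroup_iso V A P f g) (regroup_iso V B Q (ArrMap F f) (ArrMap F g))"
proof -
  define js where "js = pts_list A R"
  define ks where "ks = concat (map (sfib_list (ArrMap (Card A) g)) js)"
  define fss where "fss = map (\<lambda>i. map (\<lambda>k. \<phi> (Fib A (FibMap A f g i) k)) (pts_list A (Fib A g i))) js"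
  have R: "R \<in> Obj A" and cg: "Cod A g = R" "Cod A f = S" "g \<in> Arr A" using g f hom_obj by (auto simp: hom_iff)
  have cB: "Cod B (ArrMap F g) = ObjMap F R" using arr_in[OF g] by (simp add: hom_iff)
  have fm: "FibMap A f g i \<in> Hom A (Fib A (Comp A g f) i) (Fib A g i)" if "i \<in> set js" for i
    using that by (intro dom_op.fibmap_in[OF f g]) (simp add: js_def dom_op.set_pts_list)
  have FM: "FibMap B (ArrMap F f) (ArrMap F g) i = ArrMap F (FibMap A f g i)" if "i \<in> set js" for i
    using that map_fibmap[OF f g] by (simp add: js_def dom_op.set_pts_list)
  note fi = fib_in[OF fm]
  \<comment> \<open>Removing the brackets turns the components at fibers of the \<open>f_i\<close>
    into components at fibers of \<open>f\<close>, grouped by their image under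
    \<open>g\<close>.\<close>
  have conc: "concat fss = map (\<lambda>j. \<phi> (Fib A f j)) ks"
    unfolding fss_def ks_def map_concat map_map comp_def
    by (intro arg_cong[where f = concat] map_cong refl dom_op.map_fib_fibmap[OF f g])
      (simp add: js_def dom_op.set_pts_list)
  have tens: "map (tensA V) fss = map (\<lambda>i. fib_map (FibMap A f g i)) js"
    unfolding fss_def map_map comp_def fib_map_def using fm by (auto simp: hom_iff)
  have dom: "map (map (Dom V)) fss = map (\<lambda>i. fib_factors A P (FibMap A f g i)) js"
    unfolding fss_def map_map comp_def using fm fi by (auto simp: hom_iff fib_factors_def)
  have cod: "map (map (Cod V)) fss = map (\<lambda>i. fib_factors B Q (FibMap B (ArrMap F f) (ArrMap F g) i)) js"
    unfolding fss_def map_map comp_def using fi FM fib_factors_target[OF fm] by (auto simp: hom_iff)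
  have ks: "set ks = pts A S" "sort ks = pts_list A S"
    using dom_op.set_regrouped[OF g] dom_op.sort_regrouped[OF g] by (auto simp: ks_def js_def)
  have 1: "sq V (tensA V (map (\<lambda>i. fib_map (FibMap A f g i)) js)) (tensA V (map (\<lambda>j. \<phi> (Fib A f j)) ks))
     (concat_iso V (map (\<lambda>i. fib_factors A P (FibMap A f g i)) js))
     (concat_iso V (map (\<lambda>i. fib_factors B Q (FibMap B (ArrMap F f) (ArrMap F g) i)) js))"
  proof -
    have "set fs \<subseteq> Arr V" if "fs \<in> set fss" for fs using that fi by (auto simp: fss_def hom_iff)
    then show ?thesis using P.sq_concat_iso[of fss] unfolding dom cod tens conc by blast
  qed
  have 2: "sq V (tensA V (map (\<lambda>j. \<phi> (Fib A f j)) ks)) (tensA V (map (\<lambda>j. \<phi> (Fib A f j)) (sort ks)))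
     (sort_iso V (\<lambda>j. Op P (Fib A f j)) ks) (sort_iso V (\<lambda>j. Op Q (Fib B (ArrMap F f) j)) ks)"
    by (rule P.sq_sort_iso) (use fib_in[OF f] ks in \<open>auto simp: dom_op.set_pts_list\<close>)
  have "fib_map f = tensA V (map (\<lambda>j. \<phi> (Fib A f j)) (sort ks))" by (simp add: fib_map_def ks(2) cg)
  moreover have "regroup_iso V A P f g = Comp V (sort_iso V (\<lambda>j. Op P (Fib A f j)) ks)
      (concat_iso V (map (\<lambda>i. fib_factors A P (FibMap A f g i)) js))"
    by (simp add: regroup_iso_def Let_def js_def ks_def cg)
  moreover have "regroup_iso V B Q (ArrMap F f) (ArrMap F g) = Comp V (sort_iso V (\<lambda>j. Op Q (Fib B (ArrMap F f) j)) ks)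
      (concat_iso V (map (\<lambda>i. fib_factors B Q (FibMap B (ArrMap F f) (ArrMap F g) i)) js))"
    by (simp add: regroup_iso_def Let_def js_def ks_def cB pts_list_map[OF R] over_arr[OF cg(3)])
  ultimately show ?thesis using P.sq_comp[OF 1 2] by (simp only: js_def)
qed

text \<open>The map induced by \<open>\<phi>\<close> between the sources of the associativity
  equations for \<open>P\<close> and \<open>Q\<close>; it is common to the squares for both
  sides.\<close>

definition assoc_map where
  "assoc_map f g = TenA V (TenA V (tensA V (map (\<lambda>i. fib_map (FibMap A f g i)) (pts_list A (Cod A g)))) (fib_map g))
     (\<phi> (Cod A g))"

text \<open>Naturality of the entire formula, composed from one square per factor. No operad
  equation enters, so that together with the square for the other side it transports associativity
  from \<open>P\<close> to \<open>Q\<close>.\<close>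

lemma sq_assoc_lhs:
  assumes f: "f \<in> Hom A T S" and g: "g \<in> Hom A S R"
  shows "sq V (assoc_map f g) (\<phi> T) (mu_assoc_lhs V A P f g) (mu_assoc_lhs V B Q (ArrMap F f) (ArrMap F g))"
proof -
  have R: "\<phi> R \<in> Hom V (Op P R) (Op Q (ObjMap F R))" and c: "Cod A g = R" "Cod B (ArrMap F g) = ObjMap F R"
    using over_in hom_obj[OF g] g arr_in[OF g] by (auto simp: hom_iff)
  note F = fib_map_in[OF f] and G = fib_map_in[OF g]
  show ?thesis unfolding mu_assoc_lhs_def assoc_map_def c
    by (rule P.sq_comp[OF P.sq_comp[OF P.sq_comp[OF
        P.sq_ten[OF P.sq_ten[OF sq_regroup[OF f g] P.sq_id[OF G]] P.sq_id[OF R]]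
        P.sq_assoc[OF F G R]] P.sq_ten[OF P.sq_id[OF F] sq_mu[OF g]]] sq_mu[OF f]])
qed

lemma sq_assoc_rhs:
  assumes f: "f \<in> Hom A T S" and g: "g \<in> Hom A S R"
  shows "sq V (assoc_map f g) (\<phi> T) (mu_assoc_rhs V A P f g) (mu_assoc_rhs V B Q (ArrMap F f) (ArrMap F g))"
proof -
  define js where "js = pts_list A R"
  have R: "\<phi> R \<in> Hom V (Op P R) (Op Q (ObjMap F R))" and c: "Cod A g = R" "Cod B (ArrMap F g) = ObjMap F R"
    and Ro: "R \<in> Obj A"
    using over_in hom_obj[OF g] g arr_in[OF g] by (auto simp: hom_iff)
  have fm: "FibMap A f g i \<in> Hom A (Fib A (Comp A g f) i) (Fib A g i)" if "i \<in> set js" for i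
    using that by (intro dom_op.fibmap_in[OF f g]) (simp add: js_def dom_op.set_pts_list)
  have FM: "FibMap B (ArrMap F f) (ArrMap F g) i = ArrMap F (FibMap A f g i)" if "i \<in> set js" for i
    using that map_fibmap[OF f g] by (simp add: js_def dom_op.set_pts_list)
  have fi: "fib_map (FibMap A f g i) \<in> Hom V (op_fib V A P (FibMap A f g i)) (op_fib V B Q (ArrMap F (FibMap A f g i)))"
    if "i \<in> set js" for i using fib_map_in[OF fm[OF that]] .
  have gi: "\<phi> (Fib A g i) \<in> Hom V (Op P (Fib A g i)) (Op Q (Fib B (ArrMap F g) i))" if "i \<in> set js" for i
    using fib_in[OF g] that by (simp add: js_def)
  let ?fs = "map (\<lambda>i. fib_map (FibMap A f g i)) js" and ?gs = "map (\<lambda>i. \<phi> (Fib A g i)) js"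
  have "sq V (TenA V (tensA V ?fs) (tensA V ?gs)) (tensA V (map2 (TenA V) ?fs ?gs))
     (zip_iso V (map (Dom V) ?fs) (map (Dom V) ?gs)) (zip_iso V (map (Cod V) ?fs) (map (Cod V) ?gs))"
    by (rule P.sq_zip_iso) (use fi gi in \<open>auto simp: hom_iff\<close>)
  moreover have "map (Dom V) ?fs = map (\<lambda>i. op_fib V A P (FibMap A f g i)) js"
    "map (Cod V) ?fs = map (\<lambda>i. op_fib V B Q (FibMap B (ArrMap F f) (ArrMap F g) i)) js"
    "map (Dom V) ?gs = fib_factors A P g" "map (Cod V) ?gs = fib_factors B Q (ArrMap F g)"
    "map2 (TenA V) ?fs ?gs = map (\<lambda>i. TenA V (fib_map (FibMap A f g i)) (\<phi> (Fib A g i))) js"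
    unfolding fib_factors_source[OF g] fib_factors_target[OF g]
    using fi gi FM by (auto simp: hom_iff js_def[symmetric] zip_map_map zip_same_conv_map comp_def)
  moreover have "tensA V ?gs = fib_map g" by (simp add: fib_map_def c js_def)
  \<comment> \<open>Zipping pairs the map on \<open>P(f_i)\<close> with the component at the
    \<open>i\<close>-th fiber of \<open>g\<close>, which is exactly the source map of the square for
    \<open>Mu P\<close> at \<open>f_i\<close>.\<close>
  ultimately have z: "sq V (TenA V (tensA V ?fs) (fib_map g)) (tensA V (map (\<lambda>i. TenA V (fib_map (FibMap A f g i)) (\<phi> (Fib A g i))) js))
     (zip_iso V (map (\<lambda>i. op_fib V A P (FibMap A f g i)) js) (fib_factors A P g))
     (zip_iso V (map (\<lambda>i. op_fib V B Q (FibMap B (ArrMap F f) (ArrMap F g) i)) js) (fib_factors B Q (ArrMap F g)))"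
    by (simp only:)
  have "sq V (TenA V (fib_map (FibMap A f g i)) (\<phi> (Fib A g i))) (\<phi> (Fib A (Comp A g f) i))
     (Mu P (FibMap A f g i)) (Mu Q (FibMap B (ArrMap F f) (ArrMap F g) i))" if "i \<in> set js" for i
    using sq_mu[OF fm[OF that]] FM[OF that] by simp
  from P.sq_tensA_map[of js, OF this]
  have m: "sq V (tensA V (map (\<lambda>i. TenA V (fib_map (FibMap A f g i)) (\<phi> (Fib A g i))) js)) (fib_map (Comp A g f))
     (tensA V (map (\<lambda>i. Mu P (FibMap A f g i)) js)) (tensA V (map (\<lambda>i. Mu Q (FibMap B (ArrMap F f) (ArrMap F g) i)) js))"
    using dom_cat.comp_in[OF f g] by (simp add: fib_map_def js_def hom_iff)
  show ?thesis unfolding mu_assoc_rhs_def assoc_map_def c pts_list_map[OF Ro] js_def[symmetric] map_comp[OF f g, symmetric]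
    by (rule P.sq_comp[OF P.sq_comp[OF P.sq_ten[OF z P.sq_id[OF R]] P.sq_ten[OF m P.sq_id[OF R]]]
        sq_mu[OF dom_cat.comp_in[OF f g]]])
qed

lemma sq_unit_left:
  assumes T: "T \<in> Obj A"
  shows "sq V (\<phi> T) (\<phi> T) (mu_unit_left_map V A P T) (mu_unit_left_map V B Q (ObjMap F T))"
proof -
  note i = dom_cat.id_in[OF T]
  let ?c = "\<lambda>i. connected_rel A `` {Fib A (Id A T) i}"
  have sz: "size_of B (ObjMap F T) = size_of A T" using over_obj[OF T] .
  \<comment> \<open>The unit at a fiber of the identity is indexed by the component of that fiber,
    and \<open>F\<close> carries this component to that of the corresponding fiber in
    \<open>B\<close>.\<close>
  have "sq V (Id V (Unit V)) (\<phi> (Fib A (Id A T) i)) (Eta P (?c i)) (Eta Q (connected_rel B `` {Fib B (Id B (ObjMap F T)) i}))"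
    if "i \<in> set (pts_list A T)" for i
  proof -
    have p: "i \<in> pts A T" using that by (simp add: dom_op.set_pts_list)
    note c = dom_op.fib_id_term[OF T p]
    have "pi0_map B (ObjMap F) (?c i) = connected_rel B `` {Fib B (Id B (ObjMap F T)) i}"
      using pi0_map_component[OF c(1) dom_op.term_in[OF c(1)]] c(2) map_fib[OF i p] map_id[OF T] by simp
    then show ?thesis using sq_eta[OF c(1)] c(2) by simp
  qed
  from P.sq_tensA_map[of "pts_list A T", OF this]
  have e: "sq V (tensA V (map (\<lambda>i. Id V (Unit V)) (pts_list A T))) (fib_map (Id A T))
     (tensA V (map (\<lambda>i. Eta P (?c i)) (pts_list A T)))
     (tensA V (map (\<lambda>i. Eta Q (connected_rel B `` {Fib B (Id B (ObjMap F T)) i})) (pts_list A T)))"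
    using i by (simp add: fib_map_def hom_iff)
  \<comment> \<open>On a tensor power of the unit object the comparison map is an identity, so the
    square for \<open>unit_iso\<close> compares it with itself.\<close>
  have "tensA V (map (\<lambda>i. Id V (Unit V)) (pts_list A T)) = Id V (tens V (replicate (size_of A T) (Unit V)))"
    using P.tensA_map_id[of "pts_list A T" "\<lambda>_. Unit V"] P.unit_obj
    by (simp add: map_replicate_const dom_op.length_pts_list)
  moreover have "tens V (replicate (size_of A T) (Unit V)) \<in> Obj V"
    using P.unit_obj by (intro P.tens_obj) auto
  ultimately have u: "sq V (Id V (Unit V)) (tensA V (map (\<lambda>i. Id V (Unit V)) (pts_list A T)))
     (unit_iso V (size_of A T)) (unit_iso V (size_of A T))"
    using P.unit_iso_in[of "size_of A T"] P.unit_obj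
    by (auto intro!: P.sqI P.id_in simp: P.comp_id_left P.comp_id_right)
  show ?thesis unfolding mu_unit_left_map_def pts_list_map[OF T] sz map_id[OF T, symmetric]
    using P.sq_comp[OF P.sq_comp[OF P.sq_inv_lunit[OF over_in[OF T]] P.sq_ten[OF P.sq_comp[OF u e] P.sq_id[OF over_in[OF T]]]]
        sq_mu[OF i]] by (simp add: map_id[OF T])
qed

lemma sq_unit_right:
  assumes c: "c \<in> pi0 A" and f: "f \<in> Hom A T (Term A c)"
  shows "sq V (\<phi> T) (\<phi> T) (mu_unit_right_map V A P c f) (mu_unit_right_map V B Q (pi0_map B (ObjMap F) c) (ArrMap F f))"
proof -
  have T: "T \<in> Obj A" and d: "Dom A f = T" "Dom B (ArrMap F f) = ObjMap F T"
    using hom_obj[OF f] f arr_in[OF f] by (auto simp: hom_iff)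
  note t = over_in[OF T]
  \<comment> \<open>The only fiber of a map to a chosen terminal object is its domain; the second
    factor comes from the unit that ends every iterated tensor product.\<close>
  have "fib_map f = TenA V (\<phi> T) (Id V (Unit V))"
    using f dom_op.pts_list_term[OF c] dom_op.fib_term[OF c f] by (simp add: fib_map_def hom_iff)
  then have m: "sq V (TenA V (TenA V (\<phi> T) (Id V (Unit V))) (\<phi> (Term A c))) (\<phi> T) (Mu P f) (Mu Q (ArrMap F f))"
    using sq_mu[OF f] by simp
  show ?thesis unfolding mu_unit_right_map_def d
    by (rule P.sq_comp[OF P.sq_comp[OF P.sq_inv_runit[OF t] P.sq_ten[OF P.sq_inv_runit[OF t] sq_eta[OF c]]] m])
qed

end

section \<open>Restriction of operads\<close>

lemma is_operad_pre_operad: "is_operad V A P \<Longrightarrow> pre_operad V A P"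
  by (simp add: is_operad_iff)

lemma restrict_operad_sel:
  "T \<in> Obj A \<Longrightarrow> Op (restrict_operad A B F Q) T = Op Q (ObjMap F T)"
  "c \<in> pi0 A \<Longrightarrow> Eta (restrict_operad A B F Q) c = Eta Q (pi0_map B (ObjMap F) c)"
  "f \<in> Arr A \<Longrightarrow> Mu (restrict_operad A B F Q) f = Mu Q (ArrMap F f)"
  by (simp_all add: restrict_operad_def)

context operadic_functor
begin

lemma op_fib_restrict:
  assumes "f \<in> Hom A T S"
  shows "op_fib V A (restrict_operad A B F Q) f = op_fib V B Q (ArrMap F f)"
proof -
  have "fib_factors A (restrict_operad A B F Q) f = fib_factors B Q (ArrMap F f)"
    using assms arr_in[OF assms] pts_list_map[of S] dom_op.fib_obj[OF assms] map_fib[OF assms] dom_cat.cod_in[of f]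
    by (auto simp: fib_factors_def hom_iff restrict_operad_sel dom_op.set_pts_list)
  then show ?thesis by (simp add: op_fib_def)
qed

text \<open>Identity components form a map over \<open>F\<close> from the restriction of
  \<open>Q\<close> to \<open>Q\<close>. Applied to it, the general squares compute the axiom sides
  of the restricted operad.\<close>

lemma restrict_map_over:
  assumes "pre_operad V B Q"
  shows "operad_map_over V A B F (restrict_operad A B F Q) Q (\<lambda>T. Id V (Op Q (ObjMap F T)))"
proof -
  interpret Q: pre_operad V B Q by fact
  interpret P: pre_operad V A "restrict_operad A B F Q"
  proof
    show "Op (restrict_operad A B F Q) T \<in> Obj V" if "T \<in> Obj A" for T
      using that by (simp add: restrict_operad_sel Q.op_obj obj_in)
    show "Eta (restrict_operad A B F Q) c \<in> Hom V (Unit V) (Op (restrict_operad A B F Q) (Term A c))"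
      if "c \<in> pi0 A" for c
      using Q.eta_in[OF pi0_in[OF that]] that by (simp add: restrict_operad_sel dom_op.term_obj map_term)
    show "Mu (restrict_operad A B F Q) f \<in> Hom V (Ten V (op_fib V A (restrict_operad A B F Q) f)
        (Op (restrict_operad A B F Q) S)) (Op (restrict_operad A B F Q) T)"
      if "f \<in> Hom A T S" for f T S
    proof -
      have "f \<in> Arr A" "T \<in> Obj A" "S \<in> Obj A" using that by (auto simp: hom_iff dom_cat.dom_in dom_cat.cod_in)
      then show ?thesis
        using Q.mu_in[OF arr_in[OF that]] by (simp add: restrict_operad_sel op_fib_restrict[OF that])
    qed
  qed
  show ?thesis
  proof
    show "Id V (Op Q (ObjMap F T)) \<in> Hom V (Op (restrict_operad A B F Q) T) (Op Q (ObjMap F T))" if "T \<in> Obj A" for T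
      using that by (simp add: restrict_operad_sel Q.id_in Q.op_obj obj_in)
    show "Comp V (Id V (Op Q (ObjMap F (Term A c)))) (Eta (restrict_operad A B F Q) c) = Eta Q (pi0_map B (ObjMap F) c)"
      if "c \<in> pi0 A" for c
      using Q.comp_id_left[OF Q.eta_in[OF pi0_in[OF that]]] that by (simp add: restrict_operad_sel map_term)
    show "Comp V (Id V (Op Q (ObjMap F (Dom A f)))) (Mu (restrict_operad A B F Q) f)
      = Comp V (Mu Q (ArrMap F f)) (TenA V (tensA V (map (\<lambda>i. Id V (Op Q (ObjMap F (Fib A f i)))) (pts_list A (Cod A f))))
          (Id V (Op Q (ObjMap F (Cod A f)))))" if fa: "f \<in> Arr A" for f
    proof -
      define T S where "T = Dom A f" and "S = Cod A f"
      have f: "f \<in> Hom A T S" and o: "T \<in> Obj A" "S \<in> Obj A"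
        using fa by (auto simp: hom_iff dom_cat.dom_in dom_cat.cod_in T_def S_def)
      note m = Q.mu_in[OF arr_in[OF f]]
      have eq: "tens V (map (\<lambda>i. Op Q (ObjMap F (Fib A f i))) (pts_list A S)) = op_fib V B Q (ArrMap F f)"
        using arr_in[OF f] map_fib[OF f] pts_list_map[OF o(2)]
        by (auto simp: op_fib_def fib_factors_def hom_iff dom_op.set_pts_list intro!: arg_cong[where f = "tens V"])
      have "tensA V (map (\<lambda>i. Id V (Op Q (ObjMap F (Fib A f i)))) (pts_list A S)) = Id V (op_fib V B Q (ArrMap F f))"
        unfolding eq[symmetric]
        using dom_op.fib_obj[OF f] by (intro Q.tensA_map_id) (simp add: dom_op.set_pts_list Q.op_obj obj_in)
      moreover have "op_fib V B Q (ArrMap F f) \<in> Obj V"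
        unfolding eq[symmetric] using dom_op.fib_obj[OF f]
        by (intro Q.tens_obj) (auto simp: dom_op.set_pts_list Q.op_obj obj_in)
      ultimately show ?thesis unfolding S_def[symmetric] T_def[symmetric]
        using fa Q.comp_id_left[OF m] Q.comp_id_right[OF m] o
        by (simp add: restrict_operad_sel Q.ten_id Q.op_obj obj_in)
    qed
  qed
qed

text \<open>The squares for identity components turn each axiom at \<open>f\<close> into the axiom
  of \<open>Q\<close> at the image of \<open>f\<close>.\<close>

lemma restrict_operad_is_operad:
  assumes "is_operad V B Q" shows "is_operad V A (restrict_operad A B F Q)"
proof -
  interpret O: operad_map_over V A B F "restrict_operad A B F Q" Q "\<lambda>T. Id V (Op Q (ObjMap F T))"
    by (rule restrict_map_over[OF is_operad_pre_operad[OF assms]])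
  note q = assms[unfolded is_operad_iff]
  \<comment> \<open>Two structure maps over the same \<open>x\<close> and with the same source map
    \<open>a\<close> agree, since an identity on the target can be cancelled.\<close>
  have m: "u = v" if T: "T \<in> Obj A" and s: "sq V a (Id V (Op Q (ObjMap F T))) u x" "sq V a (Id V (Op Q (ObjMap F T))) v x" for a T u v x
  proof -
    have o: "Op Q (ObjMap F T) \<in> Obj V" using T by (simp add: O.Q.op_obj obj_in)
    have h: "u \<in> Hom V (Dom V a) (Op Q (ObjMap F T))" "v \<in> Hom V (Dom V a) (Op Q (ObjMap F T))"
      "Comp V (Id V (Op Q (ObjMap F T))) u = Comp V (Id V (Op Q (ObjMap F T))) v"
      using s by (auto simp: sq_def O.P.dom_id[OF o])
    then show ?thesis using O.P.comp_id_left by metis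
  qed
  show ?thesis
    unfolding is_operad_iff
  proof (intro conjI allI impI ballI)
    show "pre_operad V A (restrict_operad A B F Q)" by (rule O.P.pre_operad_axioms)
    fix T S R f g assume f: "f \<in> Hom A T S" and g: "g \<in> Hom A S R"
    then show "mu_assoc_lhs V A (restrict_operad A B F Q) f g = mu_assoc_rhs V A (restrict_operad A B F Q) f g"
      using m[OF _ O.sq_assoc_lhs[OF f g]] O.sq_assoc_rhs[OF f g] q arr_in[OF f] arr_in[OF g] O.hom_obj[OF f] by metis
  next
    fix T assume T: "T \<in> Obj A"
    have s: "sq V (Id V (Op Q (ObjMap F T))) (Id V (Op Q (ObjMap F T))) (mu_unit_left_map V A (restrict_operad A B F Q) T) (mu_unit_left_map V B Q (ObjMap F T))"
      by (rule O.sq_unit_left[OF T])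
    show "mu_unit_left_map V A (restrict_operad A B F Q) T = Id V (Op (restrict_operad A B F Q) T)"
      using O.P.sq_identities_eq[OF s] q T by (simp add: obj_in O.Q.op_obj restrict_operad_sel)
  next
    fix T c f assume c: "c \<in> pi0 A" and f: "f \<in> Hom A T (Term A c)"
    have T: "T \<in> Obj A" using O.hom_obj[OF f] by simp
    have Ff: "ArrMap F f \<in> Hom B (ObjMap F T) (Term B (pi0_map B (ObjMap F) c))" using arr_in[OF f] map_term[OF c] by simp
    have "mu_unit_right_map V A (restrict_operad A B F Q) c f = mu_unit_right_map V B Q (pi0_map B (ObjMap F) c) (ArrMap F f)"
      using O.P.sq_identities_eq[OF O.sq_unit_right[OF c f]] T by (simp add: obj_in O.Q.op_obj)
    then show "mu_unit_right_map V A (restrict_operad A B F Q) c f = Id V (Op (restrict_operad A B F Q) T)"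
      using q pi0_in[OF c] Ff T by (simp add: restrict_operad_sel)
  qed (auto simp: restrict_operad_def)
qed

lemma operad_map_over_iff:
  assumes "pre_operad V A P" "pre_operad V B Q"
  shows "is_operad_map V A P (restrict_operad A B F Q) \<phi> \<longleftrightarrow> \<phi> \<in> extensional (Obj A) \<and> operad_map_over V A B F P Q \<phi>"
proof -
  interpret P: pre_operad V A P by fact
  interpret Q: pre_operad V B Q by fact
  have "operad_map_over V A B F P Q \<phi> \<longleftrightarrow> operad_map_over_axioms V A B F P Q \<phi>"
    by (simp add: operad_map_over_def operadic_functor_axioms P.pre_operad_axioms Q.pre_operad_axioms)
  then show ?thesis
    unfolding is_operad_map_def operad_map_over_axioms_def
    by (auto simp: restrict_operad_sel)
qed

end

section \<open>The category of operads\<close>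

context pre_operad
begin

lemma is_operad_map_id: "is_operad_map V A P P (\<lambda>T\<in>Obj A. Id V (Op P T))"
  unfolding is_operad_map_def
proof (intro conjI ballI)
  show "Comp V ((\<lambda>T\<in>Obj A. Id V (Op P T)) (Term A c)) (Eta P c) = Eta P c" if "c \<in> pi0 A" for c
    using comp_id_left[OF eta_in[OF that]] base.term_obj[OF that] by simp
  fix f assume fa: "f \<in> Arr A"
  define T S where "T = Dom A f" and "S = Cod A f"
  have f: "f \<in> Hom A T S" and o: "T \<in> Obj A" "S \<in> Obj A"
    using fa by (auto simp: hom_iff base.dom_in base.cod_in T_def S_def)
  note m = mu_in[OF f]
  have "op_fib V A P f = tens V (map (\<lambda>i. Op P (Fib A f i)) (pts_list A S))"
    by (simp add: op_fib_def fib_factors_def S_def)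
  moreover have "map (\<lambda>i. (\<lambda>T\<in>Obj A. Id V (Op P T)) (Fib A f i)) (pts_list A S) = map (\<lambda>i. Id V (Op P (Fib A f i))) (pts_list A S)"
    using base.fib_obj[OF f] by (auto simp: base.set_pts_list)
  moreover have fo: "Op P (Fib A f i) \<in> Obj V" if "i \<in> set (pts_list A S)" for i
    using base.fib_obj[OF f] that by (simp add: base.set_pts_list op_obj)
  moreover have "tensA V (map (\<lambda>i. Id V (Op P (Fib A f i))) (pts_list A S)) = Id V (tens V (map (\<lambda>i. Op P (Fib A f i)) (pts_list A S)))"
    by (rule tensA_map_id[OF fo])
  moreover have "tens V (map (\<lambda>i. Op P (Fib A f i)) (pts_list A S)) \<in> Obj V"
    by (rule tens_obj) (use fo in auto)
  ultimately have "tensA V (map (\<lambda>i. (\<lambda>T\<in>Obj A. Id V (Op P T)) (Fib A f i)) (pts_list A S)) = Id V (op_fib V A P f)"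
    "op_fib V A P f \<in> Obj V"
    by (simp_all only:)
  then show "Comp V ((\<lambda>T\<in>Obj A. Id V (Op P T)) (Dom A f)) (Mu P f) = Comp V (Mu P f)
      (TenA V (tensA V (map (\<lambda>i. (\<lambda>T\<in>Obj A. Id V (Op P T)) (Fib A f i)) (pts_list A (Cod A f))))
         ((\<lambda>T\<in>Obj A. Id V (Op P T)) (Cod A f)))"
    unfolding T_def[symmetric] S_def[symmetric]
    using comp_id_left[OF m] comp_id_right[OF m] o by (simp add: ten_id op_obj)
qed (auto simp: id_in op_obj)

end

lemma is_operad_map_comp:
  assumes P: "pre_operad V A P" "pre_operad V A P'" "pre_operad V A P''"
    and p: "is_operad_map V A P P' \<phi>" "is_operad_map V A P' P'' \<psi>"
  shows "is_operad_map V A P P'' (\<lambda>T\<in>Obj A. Comp V (\<psi> T) (\<phi> T))"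
proof -
  interpret P: pre_operad V A P by fact
  interpret P': pre_operad V A P' by fact
  interpret P'': pre_operad V A P'' by fact
  have t: "\<phi> T \<in> Hom V (Op P T) (Op P' T)" "\<psi> T \<in> Hom V (Op P' T) (Op P'' T)" if "T \<in> Obj A" for T
    using p that by (auto simp: is_operad_map_def)
  show ?thesis
    unfolding is_operad_map_def
  proof (intro conjI ballI)
    show "(\<lambda>T\<in>Obj A. Comp V (\<psi> T) (\<phi> T)) T \<in> Hom V (Op P T) (Op P'' T)" if "T \<in> Obj A" for T
      using P.comp_in[OF t[OF that]] that by simp
    show "Comp V ((\<lambda>T\<in>Obj A. Comp V (\<psi> T) (\<phi> T)) (Term A c)) (Eta P c) = Eta P'' c" if c: "c \<in> pi0 A" for c
      using P.comp_assoc[OF P.eta_in[OF c] t[OF P.base.term_obj[OF c]]] p c P.base.term_obj[OF c]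
      by (simp add: is_operad_map_def)
    fix f assume fa: "f \<in> Arr A"
    define T S where "T = Dom A f" and "S = Cod A f"
    have f: "f \<in> Hom A T S" and o: "T \<in> Obj A" "S \<in> Obj A"
      using fa by (auto simp: hom_iff P.base.dom_in P.base.cod_in T_def S_def)
    let ?a = "tensA V (map (\<lambda>i. \<phi> (Fib A f i)) (pts_list A S))" and ?b = "tensA V (map (\<lambda>i. \<psi> (Fib A f i)) (pts_list A S))"
    have op: "op_fib V A Q f = tens V (map (\<lambda>i. Op Q (Fib A f i)) (pts_list A S))" for Q
      by (simp add: op_fib_def fib_factors_def S_def)
    have fo: "Fib A f i \<in> Obj A" if "i \<in> set (pts_list A S)" for i
      using P.base.fib_obj[OF f] that by (simp add: P.base.set_pts_list)
    have a: "?a \<in> Hom V (op_fib V A P f) (op_fib V A P' f)" and b: "?b \<in> Hom V (op_fib V A P' f) (op_fib V A P'' f)"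
      unfolding op using t fo by (auto intro!: P.tensA_map_in)
    have ab: "tensA V (map (\<lambda>i. (\<lambda>T\<in>Obj A. Comp V (\<psi> T) (\<phi> T)) (Fib A f i)) (pts_list A S)) = Comp V ?b ?a"
      using P.tensA_map_comp[of "pts_list A S" "\<lambda>i. \<phi> (Fib A f i)" "\<lambda>i. Op P (Fib A f i)" "\<lambda>i. Op P' (Fib A f i)"
          "\<lambda>i. \<psi> (Fib A f i)" "\<lambda>i. Op P'' (Fib A f i)"] t fo by (simp cong: map_cong)
    have "sq V (TenA V ?a (\<phi> S)) (\<phi> T) (Mu P f) (Mu P' f)"
      by (rule P.sqI[OF P.ten_arr[OF a t(1)[OF o(2)]] t(1)[OF o(1)] P.mu_in[OF f] P'.mu_in[OF f]])
        (use p(1) fa in \<open>auto simp: is_operad_map_def T_def S_def\<close>)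
    moreover have "sq V (TenA V ?b (\<psi> S)) (\<psi> T) (Mu P' f) (Mu P'' f)"
      by (rule P.sqI[OF P.ten_arr[OF b t(2)[OF o(2)]] t(2)[OF o(1)] P'.mu_in[OF f] P''.mu_in[OF f]])
        (use p(2) fa in \<open>auto simp: is_operad_map_def T_def S_def\<close>)
    ultimately have e: "Comp V (\<phi> T) (Mu P f) = Comp V (Mu P' f) (TenA V ?a (\<phi> S))"
      "Comp V (\<psi> T) (Mu P' f) = Comp V (Mu P'' f) (TenA V ?b (\<psi> S))" by (auto simp: sq_def)
    note m = P.mu_in[OF f] P'.mu_in[OF f] P''.mu_in[OF f]
    have "Comp V (Comp V (\<psi> T) (\<phi> T)) (Mu P f) = Comp V (\<psi> T) (Comp V (Mu P' f) (TenA V ?a (\<phi> S)))"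
      using P.comp_assoc[OF m(1) t[OF o(1)]] e(1) by simp
    also have "\<dots> = Comp V (Mu P'' f) (Comp V (TenA V ?b (\<psi> S)) (TenA V ?a (\<phi> S)))"
      using P.comp_assoc[OF P.ten_arr[OF a t(1)[OF o(2)]] m(2) t(2)[OF o(1)]] e(2)
        P.comp_assoc[OF P.ten_arr[OF a t(1)[OF o(2)]] P.ten_arr[OF b t(2)[OF o(2)]] m(3)] by simp
    also have "Comp V (TenA V ?b (\<psi> S)) (TenA V ?a (\<phi> S)) = TenA V (Comp V ?b ?a) (Comp V (\<psi> S) (\<phi> S))"
      using P.ten_comp[OF a b t[OF o(2)]] by simp
    finally show "Comp V ((\<lambda>T\<in>Obj A. Comp V (\<psi> T) (\<phi> T)) (Dom A f)) (Mu P f) = Comp V (Mu P'' f)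
      (TenA V (tensA V (map (\<lambda>i. (\<lambda>T\<in>Obj A. Comp V (\<psi> T) (\<phi> T)) (Fib A f i)) (pts_list A (Cod A f))))
        ((\<lambda>T\<in>Obj A. Comp V (\<psi> T) (\<phi> T)) (Cod A f)))"
      unfolding T_def[symmetric] S_def[symmetric] ab using o by simp
  qed simp
qed

lemma operad_cat_hom:
  "x \<in> Hom (operad_cat V A) P P' \<longleftrightarrow> is_operad V A P \<and> is_operad V A P' \<and> (\<exists>\<phi>. x = (P, \<phi>, P') \<and> is_operad_map V A P P' \<phi>)"
  by (auto simp: operad_cat_def hom_iff)

lemma operad_cat_sel: "Obj (operad_cat V A) = {P. is_operad V A P}"
  "Id (operad_cat V A) P = (P, \<lambda>T\<in>Obj A. Id V (Op P T), P)"
  "Comp (operad_cat V A) (P', \<psi>, P'') (P, \<phi>, Q) = (P, \<lambda>T\<in>Obj A. Comp V (\<psi> T) (\<phi> T), P'')"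
  by (simp_all add: operad_cat_def)

lemma category_operad_cat:
  assumes "symmetric_monoidal_category V" shows "category (operad_cat V A)"
proof -
  interpret symmetric_monoidal_category V by fact
  \<comment> \<open>Composites of operad maps are cut down to \<open>Obj A\<close>; extensionality
    of operad maps makes the unit laws hold as equalities of functions.\<close>
  have ext: "(\<lambda>T\<in>Obj A. f T) = \<phi>" if "\<phi> \<in> extensional (Obj A)" "\<And>T. T \<in> Obj A \<Longrightarrow> f T = \<phi> T" for f \<phi>
    using that by (auto simp: extensional_def fun_eq_iff)
  note pre = is_operad_pre_operad
  show ?thesis
  proof
    show "Dom (operad_cat V A) f \<in> Obj (operad_cat V A)" "Cod (operad_cat V A) f \<in> Obj (operad_cat V A)"
      if "f \<in> Arr (operad_cat V A)" for f using that by (auto simp: operad_cat_def)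
    show "Id (operad_cat V A) P \<in> Hom (operad_cat V A) P P" if "P \<in> Obj (operad_cat V A)" for P
      using that pre_operad.is_operad_map_id[OF pre] by (auto simp: operad_cat_sel operad_cat_hom)
    show "Comp (operad_cat V A) g f \<in> Hom (operad_cat V A) x z"
      if "f \<in> Hom (operad_cat V A) x y" "g \<in> Hom (operad_cat V A) y z" for f g x y z
      using that is_operad_map_comp[OF pre pre pre, of V A x y z] by (auto simp: operad_cat_sel operad_cat_hom)
    show "Comp (operad_cat V A) (Id (operad_cat V A) y) f = f" "Comp (operad_cat V A) f (Id (operad_cat V A) x) = f"
      if hyp: "f \<in> Hom (operad_cat V A) x y" for f x y
    proof -
      obtain \<phi> where f: "f = (x, \<phi>, y)" "is_operad_map V A x y \<phi>" using hyp by (auto simp: operad_cat_hom)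
      then have e: "\<phi> \<in> extensional (Obj A)" and t: "\<And>T. T \<in> Obj A \<Longrightarrow> \<phi> T \<in> Hom V (Op x T) (Op y T)"
        by (auto simp: is_operad_map_def)
      show "Comp (operad_cat V A) (Id (operad_cat V A) y) f = f" "Comp (operad_cat V A) f (Id (operad_cat V A) x) = f"
        unfolding f(1) operad_cat_sel using comp_id_left[OF t] comp_id_right[OF t] by (auto intro!: ext[OF e])
    qed
    show "Comp (operad_cat V A) h (Comp (operad_cat V A) g f) = Comp (operad_cat V A) (Comp (operad_cat V A) h g) f"
      if hyp: "f \<in> Hom (operad_cat V A) w x" "g \<in> Hom (operad_cat V A) x y" "h \<in> Hom (operad_cat V A) y z" for f g h w x y z
    proof -
      obtain \<phi> \<psi> \<chi> where e: "f = (w, \<phi>, x)" "g = (x, \<psi>, y)" "h = (y, \<chi>, z)"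
        and "is_operad_map V A w x \<phi>" "is_operad_map V A x y \<psi>" "is_operad_map V A y z \<chi>"
        using hyp by (auto simp: operad_cat_hom)
      then have "\<And>T. T \<in> Obj A \<Longrightarrow> Comp V (\<chi> T) (Comp V (\<psi> T) (\<phi> T)) = Comp V (Comp V (\<chi> T) (\<psi> T)) (\<phi> T)"
        using comp_assoc unfolding is_operad_map_def by blast
      then show ?thesis unfolding e operad_cat_sel by (simp cong: restrict_cong)
    qed
  qed
qed

context operadic_functor
begin

lemma restrict_operad_map:
  assumes Q: "is_operad V B Q" "is_operad V B Q'" and p: "is_operad_map V B Q Q' \<phi>"
  shows "is_operad_map V A (restrict_operad A B F Q) (restrict_operad A B F Q') (\<lambda>T\<in>Obj A. \<phi> (ObjMap F T))"
  unfolding is_operad_map_def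
proof (intro conjI ballI)
  show "(\<lambda>T\<in>Obj A. \<phi> (ObjMap F T)) T \<in> Hom V (Op (restrict_operad A B F Q) T) (Op (restrict_operad A B F Q') T)"
    if "T \<in> Obj A" for T using that p obj_in by (simp add: restrict_operad_sel is_operad_map_def)
  show "Comp V ((\<lambda>T\<in>Obj A. \<phi> (ObjMap F T)) (Term A c)) (Eta (restrict_operad A B F Q) c) = Eta (restrict_operad A B F Q') c"
    if "c \<in> pi0 A" for c
    using that p dom_op.term_obj[OF that] pi0_in[OF that] by (simp add: restrict_operad_sel is_operad_map_def map_term)
  fix f assume fa: "f \<in> Arr A"
  define T S where "T = Dom A f" and "S = Cod A f"
  have f: "f \<in> Hom A T S" and o: "T \<in> Obj A" "S \<in> Obj A"
    using fa by (auto simp: hom_iff dom_cat.dom_in dom_cat.cod_in T_def S_def)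
  have Ff: "ArrMap F f \<in> Arr B" "Dom B (ArrMap F f) = ObjMap F T" "Cod B (ArrMap F f) = ObjMap F S"
    using arr_in[OF f] by (auto simp: hom_iff)
  have "map (\<lambda>i. (\<lambda>T\<in>Obj A. \<phi> (ObjMap F T)) (Fib A f i)) (pts_list A S) = map (\<lambda>i. \<phi> (Fib B (ArrMap F f) i)) (pts_list B (ObjMap F S))"
    using dom_op.fib_obj[OF f] map_fib[OF f] pts_list_map[OF o(2)] by (simp add: dom_op.set_pts_list)
  moreover have "Comp V (\<phi> (ObjMap F T)) (Mu Q (ArrMap F f)) = Comp V (Mu Q' (ArrMap F f))
      (TenA V (tensA V (map (\<lambda>i. \<phi> (Fib B (ArrMap F f) i)) (pts_list B (ObjMap F S)))) (\<phi> (ObjMap F S)))"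
    using p Ff unfolding is_operad_map_def by metis
  ultimately show "Comp V ((\<lambda>T\<in>Obj A. \<phi> (ObjMap F T)) (Dom A f)) (Mu (restrict_operad A B F Q) f)
    = Comp V (Mu (restrict_operad A B F Q') f)
      (TenA V (tensA V (map (\<lambda>i. (\<lambda>T\<in>Obj A. \<phi> (ObjMap F T)) (Fib A f i)) (pts_list A (Cod A f))))
        ((\<lambda>T\<in>Obj A. \<phi> (ObjMap F T)) (Cod A f)))"
    unfolding T_def[symmetric] S_def[symmetric] using o fa by (simp add: restrict_operad_sel)
qed simp

lemma restriction_functor:
  assumes "symmetric_monoidal_category V"
  shows "cat_functor (operad_cat V B) (operad_cat V A) (restriction A B F)"
proof -
  interpret OA: category "operad_cat V A" using assms by (rule category_operad_cat)
  interpret OB: category "operad_cat V B" using assms by (rule category_operad_cat)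
  show ?thesis
  proof
    show "ObjMap (restriction A B F) P \<in> Obj (operad_cat V A)" if "P \<in> Obj (operad_cat V B)" for P
      using that restrict_operad_is_operad by (simp add: restriction_def operad_cat_sel)
    show "ArrMap (restriction A B F) f \<in> Hom (operad_cat V A) (ObjMap (restriction A B F) x) (ObjMap (restriction A B F) y)"
      if "f \<in> Hom (operad_cat V B) x y" for f x y
      using that restrict_operad_is_operad restrict_operad_map by (auto simp: restriction_def operad_cat_hom)
    show "ArrMap (restriction A B F) (Id (operad_cat V B) x) = Id (operad_cat V A) (ObjMap (restriction A B F) x)"
      if "x \<in> Obj (operad_cat V B)" for x
      by (auto simp: restriction_def operad_cat_sel restrict_operad_sel obj_in fun_eq_iff)
    show "ArrMap (restriction A B F) (Comp (operad_cat V B) g f)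
      = Comp (operad_cat V A) (ArrMap (restriction A B F) g) (ArrMap (restriction A B F) f)"
      if "f \<in> Hom (operad_cat V B) x y" "g \<in> Hom (operad_cat V B) y z" for f g x y z
      using that by (auto simp: restriction_def operad_cat_sel operad_cat_hom obj_in fun_eq_iff)
  qed
qed

end

lemma (in operadic_category) operadic_functor_id: "operadic_functor A A id_ftor"
proof -
  have pi0: "pi0_map A (\<lambda>x. x) c = c" if c: "c \<in> pi0 A" for c
  proof -
    interpret cat_functor A A id_ftor by unfold_locales (auto simp: id_ftor_def)
    show ?thesis using pi0_map_component[OF c term_in[OF c]] component_term[OF c] by (simp add: id_ftor_def)
  qed
  show ?thesis by unfold_locales (auto simp: id_ftor_def pi0)
qed

lemma (in operad_map_over) assoc_map_in:
  assumes f: "f \<in> Hom A T S" and g: "g \<in> Hom A S R"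
  shows "assoc_map f g \<in> Hom V
    (Ten V (Ten V (tens V (map (\<lambda>i. op_fib V A P (FibMap A f g i)) (pts_list A R))) (op_fib V A P g)) (Op P R))
    (Ten V (Ten V (tens V (map (\<lambda>i. op_fib V B Q (ArrMap F (FibMap A f g i))) (pts_list A R))) (op_fib V B Q (ArrMap F g))) (Op Q (ObjMap F R)))"
proof -
  have "Cod A g = R" "R \<in> Obj A" using g hom_obj[OF g] by (auto simp: hom_iff)
  then show ?thesis unfolding assoc_map_def
    using fib_map_in[OF dom_op.fibmap_in[OF f g]] fib_map_in[OF g] over_in
    by (auto intro!: P.ten_arr P.tensA_map_in simp: dom_op.set_pts_list)
qed

context pre_operad
begin

context
  assumes ext: "Op P \<in> extensional (Obj A)" "Eta P \<in> extensional (pi0 A)" "Mu P \<in> extensional (Arr A)"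
begin

text \<open>Extensionality makes restriction along the identity functor return \<open>P\<close>
  itself. The squares for this identity map yield the sources and targets of both sides of every
  axiom, in the absence of the axioms.\<close>

lemma identity_map_over: "operad_map_over V A A id_ftor P P (\<lambda>T. Id V (Op P T))"
proof -
  interpret i: operadic_functor A A id_ftor by (rule base.operadic_functor_id)
  have pi0: "pi0_map A (\<lambda>x. x) c = c" if c: "c \<in> pi0 A" for c
    using i.pi0_map_component[OF c base.term_in[OF c]] base.component_term[OF c] by (simp add: id_ftor_def)
  have "restrict_operad A A id_ftor P = P"
    by (rule operad.equality) (use ext pi0 in \<open>auto simp: restrict_operad_def id_ftor_def fun_eq_iff extensional_def\<close>)
  then show ?thesis using i.restrict_map_over[OF pre_operad_axioms] by (simp add: id_ftor_def)
qed

lemma mu_assoc_in: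
  assumes f: "f \<in> Hom A T S" and g: "g \<in> Hom A S R"
  shows "mu_assoc_lhs V A P f g \<in> Hom V
      (Ten V (Ten V (tens V (map (\<lambda>i. op_fib V A P (FibMap A f g i)) (pts_list A R))) (op_fib V A P g)) (Op P R)) (Op P T)"
    "mu_assoc_rhs V A P f g \<in> Hom V
      (Ten V (Ten V (tens V (map (\<lambda>i. op_fib V A P (FibMap A f g i)) (pts_list A R))) (op_fib V A P g)) (Op P R)) (Op P T)"
proof -
  interpret i: operad_map_over V A A id_ftor P P "\<lambda>T. Id V (Op P T)" by (rule identity_map_over)
  show "mu_assoc_lhs V A P f g \<in> Hom V
      (Ten V (Ten V (tens V (map (\<lambda>i. op_fib V A P (FibMap A f g i)) (pts_list A R))) (op_fib V A P g)) (Op P R)) (Op P T)"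
    "mu_assoc_rhs V A P f g \<in> Hom V
      (Ten V (Ten V (tens V (map (\<lambda>i. op_fib V A P (FibMap A f g i)) (pts_list A R))) (op_fib V A P g)) (Op P R)) (Op P T)"
    using i.sq_assoc_lhs[OF f g] i.sq_assoc_rhs[OF f g] i.assoc_map_in[OF f g] i.over_in i.hom_obj[OF f]
    unfolding sq_def by (auto simp: hom_iff)
qed

lemma mu_unit_left_in: assumes "T \<in> Obj A" shows "mu_unit_left_map V A P T \<in> Hom V (Op P T) (Op P T)"
proof -
  interpret i: operad_map_over V A A id_ftor P P "\<lambda>T. Id V (Op P T)" by (rule identity_map_over)
  show ?thesis using i.sq_unit_left[OF assms] i.over_in[OF assms] unfolding sq_def by (auto simp: hom_iff)
qed

lemma mu_unit_right_in:
  assumes c: "c \<in> pi0 A" and f: "f \<in> Hom A T (Term A c)"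
  shows "mu_unit_right_map V A P c f \<in> Hom V (Op P T) (Op P T)"
proof -
  interpret i: operad_map_over V A A id_ftor P P "\<lambda>T. Id V (Op P T)" by (rule identity_map_over)
  show ?thesis using i.sq_unit_right[OF c f] i.over_in i.hom_obj[OF f] unfolding sq_def by (auto simp: hom_iff)
qed

end

end

section \<open>Discrete operadic fibrations\<close>

text \<open>For a lift \<open>\<sigma>\<close> of \<open>f\<close> with codomain \<open>s\<close>,
  the injection of \<open>P(\<sigma>)\<close> tensored with \<open>P(s)\<close> into
  \<open>Q(f)\<close> tensored with \<open>Q(S)\<close>.\<close>

definition lift_map :: "('v, 'w, 'y) smcat_scheme \<Rightarrow> ('o, 'a, 'z) opcat_scheme \<Rightarrow> ('o \<Rightarrow> 'w) \<Rightarrow> 'a \<Rightarrow> 'w" where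
  "lift_map V A \<phi> \<sigma> = TenA V (tensA V (map (\<lambda>i. \<phi> (Fib A \<sigma> i)) (pts_list A (Cod A \<sigma>)))) (\<phi> (Cod A \<sigma>))"

definition fiberwise_coprod :: "('v, 'w, 'x) smcat_scheme \<Rightarrow> ('o, 'a, 'y) opcat_scheme
    \<Rightarrow> ('p, 'b, 'z) opcat_scheme \<Rightarrow> ('o, 'a, 'p, 'b) ftor \<Rightarrow> ('p, 'b, 'v, 'w) operad \<Rightarrow> ('o \<Rightarrow> 'w) \<Rightarrow> bool" where
  "fiberwise_coprod V A B F Q \<phi> \<longleftrightarrow> (\<forall>T\<in>Obj B. is_coprod V {t \<in> Obj A. ObjMap F t = T} \<phi> (Op Q T))"

context discrete_operadic_fibration
begin

text \<open>The identity of the common image \<open>U\<close> of the two chosen terminal objects has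
  \<open>U\<close> as its only fiber. It is lifted with codomain the terminal object of
  \<open>c\<close> and fiber that of \<open>d\<close>; the domain of the lift equals its fiber, so
  the lift joins the two components.\<close>

lemma pi0_map_inj: assumes c: "c \<in> pi0 A" and d: "d \<in> pi0 A" and eq: "pi0_map B (ObjMap F) c = pi0_map B (ObjMap F) d"
  shows "c = d"
proof -
  define e where "e = pi0_map B (ObjMap F) c"
  define U where "U = Term B e"
  have e: "e \<in> pi0 B" using pi0_in[OF c] by (simp add: e_def)
  have U: "U \<in> Obj B" "ObjMap F (Term A c) = U" "ObjMap F (Term A d) = U"
    using cod_op.term_obj[OF e] map_term[OF c] map_term[OF d] eq by (auto simp: U_def e_def)
  have i: "Id B U \<in> Hom B U U" using U(1) by (rule cod_cat.id_in)
  have fib: "Fib B (Id B U) 1 = U" using cod_op.fib_term[OF e, of "Id B U" U] i by (simp add: U_def)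
  have pts: "pts B U = {1}" using cod_op.pts_term[OF e] by (simp add: U_def)
  have "\<exists>!\<sigma>. \<sigma> \<in> Arr A \<and> Cod A \<sigma> = Term A c \<and> ArrMap F \<sigma> = Id B U \<and> (\<forall>i \<in> pts B U. Fib A \<sigma> i = (\<lambda>_. Term A d) i)"
    by (rule unique_lift[OF i]) (use U fib pts dom_op.term_obj[OF c] dom_op.term_obj[OF d] in auto)
  then obtain \<sigma> where s: "\<sigma> \<in> Arr A" "Cod A \<sigma> = Term A c" "Fib A \<sigma> 1 = Term A d" using pts by auto
  then have "\<sigma> \<in> Hom A (Dom A \<sigma>) (Term A c)" by (simp add: hom_iff)
  then have "\<sigma> \<in> Hom A (Term A d) (Term A c)" using dom_op.fib_term[OF c] s(3) by simp
  then show ?thesis using dom_cat.pi0_hom_eq[OF d c _ dom_op.term_in[OF d] dom_op.term_in[OF c]] by blast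
qed

lemma pi0_lift: assumes "c \<in> pi0 B" obtains d where "d \<in> pi0 A" "pi0_map B (ObjMap F) d = c"
proof -
  have "c \<in> pi0_map B (ObjMap F) ` pi0 A" using assms by (simp only: pi0_surj)
  then show ?thesis using that by blast
qed

text \<open>For a map to a chosen terminal object the only fiber is the domain, so prescribing the
  fiber of the lift prescribes its domain.\<close>

lemma lift_unit:
  assumes c: "c \<in> pi0 A" and f: "f \<in> Hom B T (Term B (pi0_map B (ObjMap F) c))" and t: "t \<in> Obj A" "ObjMap F t = T"
  obtains \<sigma> where "\<sigma> \<in> Hom A t (Term A c)" "ArrMap F \<sigma> = f"
proof -
  define e where "e = pi0_map B (ObjMap F) c"
  have e: "e \<in> pi0 B" using pi0_in[OF c] by (simp add: e_def)
  note f = f[folded e_def]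
  have fib: "Fib B f 1 = T" using cod_op.fib_term[OF e f] .
  have pts: "pts B (Term B e) = {1}" using cod_op.pts_term[OF e] .
  have "\<exists>!\<sigma>. \<sigma> \<in> Arr A \<and> Cod A \<sigma> = Term A c \<and> ArrMap F \<sigma> = f \<and> (\<forall>i \<in> pts B (Term B e). Fib A \<sigma> i = (\<lambda>_. t) i)"
    by (rule unique_lift[OF f]) (use fib pts t map_term[OF c] dom_op.term_obj[OF c] in \<open>auto simp: e_def\<close>)
  then obtain \<sigma> where s: "\<sigma> \<in> Arr A" "Cod A \<sigma> = Term A c" "ArrMap F \<sigma> = f" "Fib A \<sigma> 1 = t" using pts by auto
  then have "\<sigma> \<in> Hom A (Dom A \<sigma>) (Term A c)" by (simp add: hom_iff)
  then have "\<sigma> \<in> Hom A t (Term A c)" using dom_op.fib_term[OF c] s(4) by simp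
  then show ?thesis using that s(3) by blast
qed

lemma lift_obtain:
  assumes f: "f \<in> Hom B T S" and s: "s \<in> Obj A" "ObjMap F s = S"
    and t: "\<And>i. i \<in> pts B S \<Longrightarrow> t i \<in> Obj A \<and> ObjMap F (t i) = Fib B f i"
  obtains \<sigma> where "\<sigma> \<in> Arr A" "Cod A \<sigma> = s" "ArrMap F \<sigma> = f" "\<forall>i\<in>pts B S. Fib A \<sigma> i = t i"
proof -
  have "\<exists>!\<sigma>. \<sigma> \<in> Arr A \<and> Cod A \<sigma> = s \<and> ArrMap F \<sigma> = f \<and> (\<forall>i \<in> pts B S. Fib A \<sigma> i = t i)"
    by (rule unique_lift[OF f s t])
  then show ?thesis using that by blast
qed

lemma over_hom:
  assumes "\<sigma> \<in> Arr A" "ArrMap F \<sigma> \<in> Hom B T S"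
  shows "ObjMap F (Cod A \<sigma>) = S" "ObjMap F (Dom A \<sigma>) = T" "Cod A \<sigma> \<in> Obj A" "Dom A \<sigma> \<in> Obj A"
    "\<sigma> \<in> Hom A (Dom A \<sigma>) (Cod A \<sigma>)" "pts_list A (Cod A \<sigma>) = pts_list B S" "pts A (Cod A \<sigma>) = pts B S"
proof -
  show h: "\<sigma> \<in> Hom A (Dom A \<sigma>) (Cod A \<sigma>)" using assms by (simp add: hom_iff)
  show 1: "ObjMap F (Cod A \<sigma>) = S" "ObjMap F (Dom A \<sigma>) = T" using arr_in[OF h] assms(2) by (auto simp: hom_iff)
  show 2: "Cod A \<sigma> \<in> Obj A" "Dom A \<sigma> \<in> Obj A" using assms(1) by (auto simp: dom_cat.dom_in dom_cat.cod_in)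
  show "pts_list A (Cod A \<sigma>) = pts_list B S" using pts_list_map[OF 2(1)] 1 by simp
  show "pts A (Cod A \<sigma>) = pts B S" using pts_map[OF 2(1)] 1 by simp
qed

text \<open>Unique lifting as a bijection: existence is surjectivity, uniqueness is injectivity.
  Families of fibers are restricted to the points of \<open>S\<close> so that they are elements of a
  \<open>PiE\<close>, the index set produced by distributivity.\<close>

lemma bij_betw_lifts:
  assumes f: "f \<in> Hom B T S"
  shows "bij_betw (\<lambda>\<sigma>. (\<lambda>i\<in>pts B S. Fib A \<sigma> i, Cod A \<sigma>)) {\<sigma> \<in> Arr A. ArrMap F \<sigma> = f}
    (PiE (pts B S) (\<lambda>i. {t \<in> Obj A. ObjMap F t = Fib B f i}) \<times> {s \<in> Obj A. ObjMap F s = S})"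
  (is "bij_betw ?b ?L ?R")
proof -
  have fibs: "Fib A \<sigma> i \<in> Obj A" "ObjMap F (Fib A \<sigma> i) = Fib B f i" if s: "\<sigma> \<in> ?L" and i: "i \<in> pts B S" for \<sigma> i
    using s over_hom[of \<sigma> T S] f dom_op.fib_obj[of \<sigma> "Dom A \<sigma>" "Cod A \<sigma>"] map_fib[of \<sigma> "Dom A \<sigma>" "Cod A \<sigma>"] i by auto
  have ex: "\<exists>!\<sigma>. \<sigma> \<in> Arr A \<and> Cod A \<sigma> = s \<and> ArrMap F \<sigma> = f \<and> (\<forall>i \<in> pts B S. Fib A \<sigma> i = t i)"
    if "s \<in> Obj A" "ObjMap F s = S" "\<And>i. i \<in> pts B S \<Longrightarrow> t i \<in> Obj A \<and> ObjMap F (t i) = Fib B f i" for s t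
    by (rule unique_lift[OF f that])
  show ?thesis
    unfolding bij_betw_def
  proof (intro conjI inj_onI set_eqI iffI)
    fix \<sigma> \<tau> assume s: "\<sigma> \<in> ?L" and t: "\<tau> \<in> ?L" and eq: "?b \<sigma> = ?b \<tau>"
    have "Fib A \<sigma> i = Fib A \<tau> i" if "i \<in> pts B S" for i
      using eq that by (metis (no_types, lifting) fst_conv restrict_apply')
    then have "\<tau> \<in> Arr A \<and> Cod A \<tau> = Cod A \<sigma> \<and> ArrMap F \<tau> = f \<and> (\<forall>i \<in> pts B S. Fib A \<tau> i = Fib A \<sigma> i)"
      using t eq by simp
    moreover have "\<sigma> \<in> Arr A \<and> Cod A \<sigma> = Cod A \<sigma> \<and> ArrMap F \<sigma> = f \<and> (\<forall>i \<in> pts B S. Fib A \<sigma> i = Fib A \<sigma> i)"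
      using s by simp
    moreover have "\<exists>!\<rho>. \<rho> \<in> Arr A \<and> Cod A \<rho> = Cod A \<sigma> \<and> ArrMap F \<rho> = f \<and> (\<forall>i \<in> pts B S. Fib A \<rho> i = Fib A \<sigma> i)"
      by (rule ex) (use s f over_hom[of \<sigma> T S] fibs[OF s] in auto)
    ultimately show "\<sigma> = \<tau>" by blast
  next
    fix p assume "p \<in> ?b ` ?L"
    then obtain \<sigma> where s: "\<sigma> \<in> ?L" and p: "p = ?b \<sigma>" by blast
    show "p \<in> ?R" unfolding p using fibs[OF s] over_hom(1,3)[of \<sigma> T S] s f by auto
  next
    fix p assume p: "p \<in> ?R"
    obtain t s where ts: "p = (t, s)" by fastforce
    have "\<exists>!\<sigma>. \<sigma> \<in> Arr A \<and> Cod A \<sigma> = s \<and> ArrMap F \<sigma> = f \<and> (\<forall>i \<in> pts B S. Fib A \<sigma> i = t i)"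
      by (rule ex) (use p ts in auto)
    then obtain \<sigma> where s: "\<sigma> \<in> Arr A" "Cod A \<sigma> = s" "ArrMap F \<sigma> = f" "\<And>i. i \<in> pts B S \<Longrightarrow> Fib A \<sigma> i = t i" by blast
    moreover have "(\<lambda>i\<in>pts B S. Fib A \<sigma> i) = t"
      using p ts s(4) by (auto simp: fun_eq_iff PiE_def extensional_def)
    ultimately show "p \<in> ?b ` ?L" using ts by force
  qed
qed

section \<open>Coproduct decompositions over lifts of arrows\<close>

context
  fixes V :: "('v, 'w, 'x) smcat_scheme" and Q :: "('p, 'b, 'v, 'w) operad" and \<phi> :: "'o \<Rightarrow> 'w"
  assumes V: "symmetric_monoidal_category V" and closed: "closed_monoidal V"
    and coprod: "fiberwise_coprod V A B F Q \<phi>"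
begin

interpretation symmetric_monoidal_category V by (rule V)

lemma coprod_over: "T \<in> Obj B \<Longrightarrow> is_coprod V {t \<in> Obj A. ObjMap F t = T} \<phi> (Op Q T)"
  using coprod by (simp add: fiberwise_coprod_def)

lemma is_coprod_fib_factors:
  assumes f: "f \<in> Hom B T S"
  shows "is_coprod V (PiE (pts B S) (\<lambda>i. {t \<in> Obj A. ObjMap F t = Fib B f i}))
    (\<lambda>t. tensA V (map (\<lambda>i. \<phi> (t i)) (pts_list B S))) (op_fib V B Q f)"
  using is_coprod_tensA[OF closed cod_op.distinct_pts_list[of S], of "\<lambda>i. {t \<in> Obj A. ObjMap F t = Fib B f i}" "\<lambda>_. \<phi>" "\<lambda>i. Op Q (Fib B f i)"]
    coprod_over cod_op.fib_obj[OF f] f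
  by (simp add: cod_op.set_pts_list op_fib_def fib_factors_def hom_iff)

lemma is_coprod_lifts:
  assumes f: "f \<in> Hom B T S"
  shows "is_coprod V {\<sigma> \<in> Arr A. ArrMap F \<sigma> = f} (lift_map V A \<phi>) (Ten V (op_fib V B Q f) (Op Q S))"
proof (rule is_coprod_reindex[OF is_coprod_ten[OF closed is_coprod_fib_factors[OF f] coprod_over] bij_betw_lifts[OF f]])
  show "S \<in> Obj B" using f by (auto simp: hom_iff cod_cat.cod_in)
  fix \<sigma> assume "\<sigma> \<in> {\<sigma> \<in> Arr A. ArrMap F \<sigma> = f}"
  then have "pts_list A (Cod A \<sigma>) = pts_list B S" using over_hom(6)[of \<sigma> T S] f by simp
  then show "lift_map V A \<phi> \<sigma> = (case (\<lambda>i\<in>pts B S. Fib A \<sigma> i, Cod A \<sigma>) of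
      (t, s) \<Rightarrow> TenA V (tensA V (map (\<lambda>i. \<phi> (t i)) (pts_list B S))) (\<phi> s))"
    by (auto simp: lift_map_def cod_op.set_pts_list intro!: arg_cong2[where f = "TenA V"] arg_cong[where f = "tensA V"])
qed

text \<open>The source of the associativity equation is a coproduct over independent choices:
  \<open>r\<close> above \<open>R\<close>, \<open>s i\<close> above the fibers of \<open>g\<close>,
  and \<open>t i k\<close> above the fibers of the \<open>f_i\<close>. Every choice arises from
  composable lifts: \<open>r\<close> and \<open>s\<close> determine \<open>\<tau>\<close>, and since
  fibers of the \<open>f_i\<close> are fibers of \<open>f\<close>, the family \<open>t\<close> then
  determines \<open>\<sigma>\<close> ending at the domain of \<open>\<tau>\<close>.\<close>

lemma composable_lifts_epic:
  assumes f: "f \<in> Hom B T S" and g: "g \<in> Hom B S R"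
    and h: "h \<in> Hom V (Ten V (Ten V (tens V (map (\<lambda>i. op_fib V B Q (FibMap B f g i)) (pts_list B R))) (op_fib V B Q g)) (Op Q R)) z"
      "h' \<in> Hom V (Ten V (Ten V (tens V (map (\<lambda>i. op_fib V B Q (FibMap B f g i)) (pts_list B R))) (op_fib V B Q g)) (Op Q R)) z"
    and eq: "\<And>\<sigma> \<tau> t s r. \<lbrakk>\<sigma> \<in> Hom A t s; \<tau> \<in> Hom A s r; ArrMap F \<sigma> = f; ArrMap F \<tau> = g\<rbrakk> \<Longrightarrow>
      Comp V h (TenA V (TenA V (tensA V (map (\<lambda>i. tensA V (map (\<lambda>k. \<phi> (Fib A (FibMap A \<sigma> \<tau> i) k)) (pts_list A (Cod A (FibMap A \<sigma> \<tau> i)))))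
          (pts_list A (Cod A \<tau>)))) (tensA V (map (\<lambda>i. \<phi> (Fib A \<tau> i)) (pts_list A (Cod A \<tau>))))) (\<phi> (Cod A \<tau>)))
      = Comp V h' (TenA V (TenA V (tensA V (map (\<lambda>i. tensA V (map (\<lambda>k. \<phi> (Fib A (FibMap A \<sigma> \<tau> i) k)) (pts_list A (Cod A (FibMap A \<sigma> \<tau> i)))))
          (pts_list A (Cod A \<tau>)))) (tensA V (map (\<lambda>i. \<phi> (Fib A \<tau> i)) (pts_list A (Cod A \<tau>))))) (\<phi> (Cod A \<tau>)))"
  shows "h = h'"
proof -
  have R: "R \<in> Obj B" using g by (auto simp: hom_iff cod_cat.cod_in)
  define fg where "fg i = FibMap B f g i" for i
  define gi where "gi i = Fib B g i" for i
  have fm: "fg i \<in> Hom B (Fib B (Comp B g f) i) (gi i)" if "i \<in> set (pts_list B R)" for i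
    using cod_op.fibmap_in[OF f g] that by (simp add: fg_def gi_def cod_op.set_pts_list)
  define I where "I i = PiE (pts B (gi i)) (\<lambda>k. {t \<in> Obj A. ObjMap F t = Fib B (fg i) k})" for i
  have 1: "is_coprod V (PiE (set (pts_list B R)) I)
     (\<lambda>t. tensA V (map (\<lambda>i. tensA V (map (\<lambda>k. \<phi> (t i k)) (pts_list B (gi i)))) (pts_list B R)))
     (tens V (map (\<lambda>i. op_fib V B Q (fg i)) (pts_list B R)))"
    by (rule is_coprod_tensA[OF closed cod_op.distinct_pts_list, of R I "\<lambda>i t. tensA V (map (\<lambda>k. \<phi> (t k)) (pts_list B (gi i)))"])
      (use is_coprod_fib_factors[OF fm] in \<open>simp add: I_def\<close>)
  show ?thesis
  proof (rule coprod_eqI[OF is_coprod_ten[OF closed is_coprod_ten[OF closed 1[unfolded fg_def] is_coprod_fib_factors[OF g]] coprod_over[OF R]] h])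
    fix p assume p: "p \<in> ((PiE (set (pts_list B R)) I) \<times> (PiE (pts B R) (\<lambda>i. {t \<in> Obj A. ObjMap F t = Fib B g i}))) \<times> {t \<in> Obj A. ObjMap F t = R}"
    obtain t s r where tsr: "p = ((t, s), r)" by (metis surj_pair)
    have t: "t i k \<in> Obj A \<and> ObjMap F (t i k) = Fib B (fg i) k" if "i \<in> pts B R" "k \<in> pts B (gi i)" for i k
    proof -
      have "t i \<in> I i" using p tsr that(1) by (auto simp: cod_op.set_pts_list)
      then show ?thesis using that(2) by (auto simp: I_def)
    qed
    have s: "s i \<in> Obj A \<and> ObjMap F (s i) = Fib B g i" if "i \<in> pts B R" for i using p tsr that by auto
    have r: "r \<in> Obj A" "ObjMap F r = R" using p tsr by auto
    obtain \<tau> where \<tau>: "\<tau> \<in> Arr A" "Cod A \<tau> = r" "ArrMap F \<tau> = g" "\<forall>i\<in>pts B R. Fib A \<tau> i = s i"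
      by (rule lift_obtain[OF g r s])
    note \<tau>o = over_hom[OF \<tau>(1), unfolded \<tau>(3), OF g]
    have card: "pt_map A \<tau> = pt_map B g" "pt_pos A \<tau> = pt_pos B g"
      using over_arr[OF \<tau>(1)] \<tau>(3) by (simp_all add: pt_map_def pt_pos_def)
    \<comment> \<open>The fiber of \<open>f\<close> over \<open>j\<close> is a fiber of the
      \<open>f_i\<close> with \<open>i\<close> the image of \<open>j\<close>, at the rank of
      \<open>j\<close>; the object chosen there is the prescribed fiber of
      \<open>\<sigma>\<close>.\<close>
    have fj: "t (pt_map B g j) (pt_pos B g j) \<in> Obj A \<and> ObjMap F (t (pt_map B g j) (pt_pos B g j)) = Fib B f j"
      if j: "j \<in> pts B S" for j
      using t[OF cod_op.pt_map_in[OF g j]] cod_op.pt_pos_in[OF g j] cod_op.fib_fib[OF f g j] by (simp add: gi_def fg_def)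
    obtain \<sigma> where \<sigma>: "\<sigma> \<in> Arr A" "Cod A \<sigma> = Dom A \<tau>" "ArrMap F \<sigma> = f"
      "\<forall>j\<in>pts B S. Fib A \<sigma> j = t (pt_map B g j) (pt_pos B g j)"
      by (rule lift_obtain[OF f \<tau>o(4,2) fj])
    have \<sigma>h: "\<sigma> \<in> Hom A (Dom A \<sigma>) (Dom A \<tau>)" and \<tau>h: "\<tau> \<in> Hom A (Dom A \<tau>) r" using \<sigma> \<tau> by (auto simp: hom_iff)
    have pR: "pts_list A r = pts_list B R" "pts A r = pts B R" using \<tau>o(6,7) \<tau>(2) by auto
    have cf: "Cod A (FibMap A \<sigma> \<tau> i) = s i" "pts_list A (s i) = pts_list B (gi i)" if "i \<in> pts B R" for i
      using dom_op.fibmap_in[OF \<sigma>h \<tau>h, of i] that \<tau>(4)[rule_format, OF that] pR s[OF that] pts_list_map[of "s i"] by (auto simp: hom_iff gi_def)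
    \<comment> \<open>Conversely every pair \<open>(i, k)\<close> is the position of some
      \<open>j\<close>, so the fibers of the map induced by \<open>\<sigma>\<close> and
      \<open>\<tau>\<close> are the objects chosen at the outset.\<close>
    have ff: "Fib A (FibMap A \<sigma> \<tau> i) k = t i k" if i: "i \<in> pts B R" and k: "k \<in> pts B (gi i)" for i k
    proof -
      obtain j where j: "j \<in> pts B S" "pt_map B g j = i" "pt_pos B g j = k"
        by (rule cod_op.fib_position[OF g i k[unfolded gi_def]])
      have "j \<in> pts A (Dom A \<tau>)" using j(1) pts_map[OF \<tau>o(4)] \<tau>o(2) by simp
      from dom_op.fib_fib[OF \<sigma>h \<tau>h this] show ?thesis using \<sigma>(4)[rule_format, OF j(1)] j card by simp
    qed
    have a: "tensA V (map (\<lambda>i. tensA V (map (\<lambda>k. \<phi> (Fib A (FibMap A \<sigma> \<tau> i) k)) (pts_list A (Cod A (FibMap A \<sigma> \<tau> i))))) (pts_list A (Cod A \<tau>)))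
      = tensA V (map (\<lambda>i. tensA V (map (\<lambda>k. \<phi> (t i k)) (pts_list B (gi i)))) (pts_list B R))"
      unfolding \<tau>(2) pR(1)
      by (intro arg_cong[where f = "tensA V"] map_cong refl) (auto simp: cod_op.set_pts_list cf ff)
    have b: "tensA V (map (\<lambda>i. \<phi> (Fib A \<tau> i)) (pts_list A (Cod A \<tau>))) = tensA V (map (\<lambda>i. \<phi> (s i)) (pts_list B R))"
      unfolding \<tau>(2) pR(1)
      by (intro arg_cong[where f = "tensA V"] map_cong refl) (auto simp: cod_op.set_pts_list \<tau>(4))
    show "Comp V h (case p of (q, j) \<Rightarrow> TenA V (case q of (t, s) \<Rightarrow>
        TenA V (tensA V (map (\<lambda>i. tensA V (map (\<lambda>k. \<phi> (t i k)) (pts_list B (gi i)))) (pts_list B R))) (tensA V (map (\<lambda>i. \<phi> (s i)) (pts_list B R)))) (\<phi> j))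
      = Comp V h' (case p of (q, j) \<Rightarrow> TenA V (case q of (t, s) \<Rightarrow>
        TenA V (tensA V (map (\<lambda>i. tensA V (map (\<lambda>k. \<phi> (t i k)) (pts_list B (gi i)))) (pts_list B R))) (tensA V (map (\<lambda>i. \<phi> (s i)) (pts_list B R)))) (\<phi> j))"
      using eq[OF \<sigma>h \<tau>h \<sigma>(3) \<tau>(3)] unfolding a b tsr by (simp add: \<tau>(2))
  qed
qed

end

text \<open>Each axiom of \<open>Q\<close> is tested on coproduct injections. There the naturality
  squares replace it by the axiom of \<open>P\<close> at a lift of the arrows, objects or components
  involved.\<close>

lemma is_operad_lifts:
  assumes "closed_monoidal V" and P: "is_operad V A P" and Q: "operad_map_over V A B F P Q \<phi>"
    and coprod: "fiberwise_coprod V A B F Q \<phi>"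
    and ext: "Op Q \<in> extensional (Obj B)" "Eta Q \<in> extensional (pi0 B)" "Mu Q \<in> extensional (Arr B)"
  shows "is_operad V B Q"
proof -
  interpret O: operad_map_over V A B F P Q \<phi> by fact
  have V: "symmetric_monoidal_category V" by unfold_locales
  note P = P[unfolded is_operad_iff]
  note epic = O.P.coprod_eqI[OF coprod_over[OF V assms(1) coprod]]
  show ?thesis
    unfolding is_operad_iff
  proof (intro conjI allI impI ballI)
    show "pre_operad V B Q" by (rule O.Q.pre_operad_axioms)
    fix T S R f g assume f: "f \<in> Hom B T S" and g: "g \<in> Hom B S R"
    let ?X = "Ten V (Ten V (tens V (map (\<lambda>i. op_fib V B Q (FibMap B f g i)) (pts_list B R))) (op_fib V B Q g)) (Op Q R)"
    show "mu_assoc_lhs V B Q f g = mu_assoc_rhs V B Q f g"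
    proof (rule composable_lifts_epic[OF V assms(1) coprod f g, of _ "Op Q T"])
      show "mu_assoc_lhs V B Q f g \<in> Hom V ?X (Op Q T)" "mu_assoc_rhs V B Q f g \<in> Hom V ?X (Op Q T)"
        by (rule O.Q.mu_assoc_in[OF ext f g])+
      fix \<sigma> \<tau> t s r assume \<sigma>: "\<sigma> \<in> Hom A t s" and \<tau>: "\<tau> \<in> Hom A s r" and e: "ArrMap F \<sigma> = f" "ArrMap F \<tau> = g"
      \<comment> \<open>By the two squares both composites equal \<open>\<phi>\<close> after the
        corresponding side for \<open>P\<close>, and those sides agree.\<close>
      have "Comp V (mu_assoc_lhs V B Q f g) (O.assoc_map \<sigma> \<tau>) = Comp V (mu_assoc_rhs V B Q f g) (O.assoc_map \<sigma> \<tau>)"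
        using O.sq_assoc_lhs[OF \<sigma> \<tau>] O.sq_assoc_rhs[OF \<sigma> \<tau>] P \<sigma> \<tau> unfolding sq_def e by metis
      then show "Comp V (mu_assoc_lhs V B Q f g) (TenA V (TenA V (tensA V (map (\<lambda>i. tensA V (map (\<lambda>k. \<phi> (Fib A (FibMap A \<sigma> \<tau> i) k)) (pts_list A (Cod A (FibMap A \<sigma> \<tau> i)))))
          (pts_list A (Cod A \<tau>)))) (tensA V (map (\<lambda>i. \<phi> (Fib A \<tau> i)) (pts_list A (Cod A \<tau>))))) (\<phi> (Cod A \<tau>)))
        = Comp V (mu_assoc_rhs V B Q f g) (TenA V (TenA V (tensA V (map (\<lambda>i. tensA V (map (\<lambda>k. \<phi> (Fib A (FibMap A \<sigma> \<tau> i) k)) (pts_list A (Cod A (FibMap A \<sigma> \<tau> i)))))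
          (pts_list A (Cod A \<tau>)))) (tensA V (map (\<lambda>i. \<phi> (Fib A \<tau> i)) (pts_list A (Cod A \<tau>))))) (\<phi> (Cod A \<tau>)))"
        by (simp add: O.assoc_map_def O.fib_map_def)
    qed
  next
    fix T assume T: "T \<in> Obj B"
    have o: "Op Q T \<in> Obj V" using T by (rule O.Q.op_obj)
    show "mu_unit_left_map V B Q T = Id V (Op Q T)"
    proof (rule epic[OF T O.Q.mu_unit_left_in[OF ext T] O.P.id_in[OF o]])
      fix t assume "t \<in> {t \<in> Obj A. ObjMap F t = T}"
      then have t: "t \<in> Obj A" and Ft: "ObjMap F t = T" by auto
      have i: "\<phi> t \<in> Hom V (Op P t) (Op Q T)" using O.over_in[OF t] Ft by simp
      have "mu_unit_left_map V A P t = Id V (Op P t)" using P t by blast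
      then show "Comp V (mu_unit_left_map V B Q T) (\<phi> t) = Comp V (Id V (Op Q T)) (\<phi> t)"
        using O.sq_unit_left[OF t] Ft O.P.comp_id_left[OF i] O.P.comp_id_right[OF i] by (simp add: sq_def)
    qed
  next
    fix T c f assume c: "c \<in> pi0 B" and f: "f \<in> Hom B T (Term B c)"
    have T: "T \<in> Obj B" using f by (auto simp: hom_iff cod_cat.dom_in)
    have o: "Op Q T \<in> Obj V" using T by (rule O.Q.op_obj)
    obtain d where d: "d \<in> pi0 A" "pi0_map B (ObjMap F) d = c" using pi0_lift[OF c] .
    show "mu_unit_right_map V B Q c f = Id V (Op Q T)"
    proof (rule epic[OF T O.Q.mu_unit_right_in[OF ext c f] O.P.id_in[OF o]])
      fix t assume "t \<in> {t \<in> Obj A. ObjMap F t = T}"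
      then have t: "t \<in> Obj A" and Ft: "ObjMap F t = T" by auto
      obtain \<sigma> where \<sigma>: "\<sigma> \<in> Hom A t (Term A d)" "ArrMap F \<sigma> = f" by (rule lift_unit[OF d(1) f[folded d(2)] t Ft])
      have i: "\<phi> t \<in> Hom V (Op P t) (Op Q T)" using O.over_in[OF t] Ft by simp
      have "mu_unit_right_map V A P d \<sigma> = Id V (Op P t)" using P d(1) \<sigma>(1) by blast
      then show "Comp V (mu_unit_right_map V B Q c f) (\<phi> t) = Comp V (Id V (Op Q T)) (\<phi> t)"
        using O.sq_unit_right[OF d(1) \<sigma>(1)] d(2) \<sigma>(2) O.P.comp_id_left[OF i] O.P.comp_id_right[OF i] by (simp add: sq_def)
    qed
  qed (use ext in auto)
qed

text \<open>The induced map of operads is forced componentwise by the coproducts. Its compatibility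
  with multiplication is an equation out of a coproduct over lifts, and compatibility with units
  holds because every component of \<open>B\<close> is the image of one of \<open>A\<close>.\<close>

lemma fiberwise_coprod_universal:
  assumes closed: "closed_monoidal V" and P: "is_operad V A P" and Q: "is_operad V B Q"
    and p: "is_operad_map V A P (restrict_operad A B F Q) \<phi>" and coprod: "fiberwise_coprod V A B F Q \<phi>"
  shows "universal_arrow (operad_cat V A) (operad_cat V B) (restriction A B F) P Q (P, \<phi>, restrict_operad A B F Q)"
proof -
  note pre = is_operad_pre_operad
  interpret O: operad_map_over V A B F P Q \<phi>
    using p operad_map_over_iff[OF pre[OF P] pre[OF Q]] by blast
  have V: "symmetric_monoidal_category V" by unfold_locales
  note co = coprod_over[OF V closed coprod] and lifts = is_coprod_lifts[OF V closed coprod]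
  have "\<exists>!g. g \<in> Hom (operad_cat V B) Q Q' \<and> Comp (operad_cat V A) (ArrMap (restriction A B F) g) (P, \<phi>, restrict_operad A B F Q) = x"
    if Q': "is_operad V B Q'" and x: "x \<in> Hom (operad_cat V A) P (restrict_operad A B F Q')" for Q' x
  proof -
    obtain \<psi> where \<psi>: "x = (P, \<psi>, restrict_operad A B F Q')" "is_operad_map V A P (restrict_operad A B F Q') \<psi>"
      using x by (auto simp: operad_cat_hom)
    interpret N: operad_map_over V A B F P Q' \<psi>
      using \<psi>(2) operad_map_over_iff[OF pre[OF P] pre[OF Q']] by blast
    have "\<exists>h. h \<in> Hom V (Op Q T) (Op Q' T) \<and> (\<forall>t\<in>{t \<in> Obj A. ObjMap F t = T}. Comp V h (\<phi> t) = \<psi> t)" if T: "T \<in> Obj B" for T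
      by (rule coprod_map[OF co[OF T] N.Q.op_obj[OF T]]) (use O.over_in N.over_in in \<open>force simp: hom_iff\<close>)
    then obtain h0 where h0: "\<And>T. T \<in> Obj B \<Longrightarrow> h0 T \<in> Hom V (Op Q T) (Op Q' T)"
      "\<And>T t. \<lbrakk>T \<in> Obj B; t \<in> Obj A; ObjMap F t = T\<rbrakk> \<Longrightarrow> Comp V (h0 T) (\<phi> t) = \<psi> t"
      by (metis (mono_tags, lifting) mem_Collect_eq)
    \<comment> \<open>The components found so far are arbitrary off \<open>Obj B\<close>, whereas
      operad maps are extensional.\<close>
    define h where "h = restrict h0 (Obj B)"
    have h: "h T \<in> Hom V (Op Q T) (Op Q' T)" if "T \<in> Obj B" for T using that h0(1) by (simp add: h_def)
    have hp: "Comp V (h (ObjMap F t)) (\<phi> t) = \<psi> t" if "t \<in> Obj A" for t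
      using h0(2)[OF obj_in[OF that] that refl] obj_in[OF that] by (simp add: h_def)
    have hmap: "is_operad_map V B Q Q' h"
      unfolding is_operad_map_def
    proof (intro conjI ballI)
      show "h \<in> extensional (Obj B)" by (simp add: h_def)
      show "h T \<in> Hom V (Op Q T) (Op Q' T)" if "T \<in> Obj B" for T using h[OF that] .
      fix c assume c: "c \<in> pi0 B"
      obtain d where d: "d \<in> pi0 A" "pi0_map B (ObjMap F) d = c" using pi0_lift[OF c] .
      define t where "t = Term A d"
      have t: "t \<in> Obj A" "ObjMap F t = Term B c" using dom_op.term_obj[OF d(1)] map_term[OF d(1)] d(2) by (auto simp: t_def)
      note e = O.P.eta_in[OF d(1), folded t_def] and o = O.over_in[OF t(1)] and ht = h[OF obj_in[OF t(1)]]
      have "Comp V (h (ObjMap F t)) (Comp V (\<phi> t) (Eta P d)) = Comp V (\<psi> t) (Eta P d)"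
        using O.P.comp_assoc[OF e o ht] hp[OF t(1)] by simp
      then show "Comp V (h (Term B c)) (Eta Q c) = Eta Q' c"
        using O.over_eta[OF d(1)] N.over_eta[OF d(1)] d(2) t(2) by (simp add: t_def)
    next
      fix f assume fa: "f \<in> Arr B"
      define T S where "T = Dom B f" and "S = Cod B f"
      have f: "f \<in> Hom B T S" and o: "T \<in> Obj B" "S \<in> Obj B"
        using fa by (auto simp: hom_iff cod_cat.dom_in cod_cat.cod_in T_def S_def)
      let ?hh = "tensA V (map (\<lambda>i. h (Fib B f i)) (pts_list B S))"
      have op: "op_fib V B X f = tens V (map (\<lambda>i. Op X (Fib B f i)) (pts_list B S))" for X
        by (simp add: op_fib_def fib_factors_def S_def)
      have hh: "?hh \<in> Hom V (op_fib V B Q f) (op_fib V B Q' f)"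
        unfolding op using h cod_op.fib_obj[OF f] by (auto intro!: O.P.tensA_map_in simp: cod_op.set_pts_list)
      note hS = h[OF o(2)] and hT = h[OF o(1)]
      note hten = O.P.ten_arr[OF hh hS] and m = O.Q.mu_in[OF f] and m' = N.Q.mu_in[OF f]
      have "Comp V (h T) (Mu Q f) = Comp V (Mu Q' f) (TenA V ?hh (h S))"
      \<comment> \<open>On the injection of a lift \<open>\<sigma>\<close>, both sides become
        \<open>\<psi>\<close> after \<open>Mu P \<sigma>\<close>, as both \<open>\<phi>\<close> and
        \<open>\<psi>\<close> respect multiplication.\<close>
      proof (rule O.P.coprod_eqI[OF lifts[OF f] O.P.comp_in[OF m hT] O.P.comp_in[OF hten m']])
        fix \<sigma> assume "\<sigma> \<in> {\<sigma> \<in> Arr A. ArrMap F \<sigma> = f}"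
        then have sa: "\<sigma> \<in> Arr A" and sf: "ArrMap F \<sigma> = f" by auto
        define t s where "t = Dom A \<sigma>" and "s = Cod A \<sigma>"
        note so = over_hom[OF sa, unfolded sf, OF f, folded t_def s_def]
        note s = so(5)
        have a: "lift_map V A \<phi> \<sigma> = TenA V (O.fib_map \<sigma>) (\<phi> s)" by (simp add: lift_map_def O.fib_map_def s_def)
        have fo: "O.fib_map \<sigma> \<in> Hom V (op_fib V A P \<sigma>) (op_fib V B Q f)" using O.fib_map_in[OF s] sf by simp
        have ps: "\<phi> s \<in> Hom V (Op P s) (Op Q S)" and pt: "\<phi> t \<in> Hom V (Op P t) (Op Q T)" using O.over_in so(1-4) by metis+
        note ah = O.P.ten_arr[OF fo ps] and mp = O.P.mu_in[OF s]
        have "Comp V (Comp V (h T) (Mu Q f)) (lift_map V A \<phi> \<sigma>) = Comp V (h T) (Comp V (\<phi> t) (Mu P \<sigma>))"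
          unfolding a using O.P.comp_assoc[OF ah m hT] O.sq_mu[OF s] sf by (simp add: sq_def)
        also have "\<dots> = Comp V (\<psi> t) (Mu P \<sigma>)"
          using O.P.comp_assoc[OF mp pt hT] hp[OF so(4)] so(2) by simp
        also have "\<dots> = Comp V (Mu Q' f) (TenA V (N.fib_map \<sigma>) (\<psi> s))"
          using N.sq_mu[OF s] sf by (simp add: sq_def)
        also have "N.fib_map \<sigma> = Comp V ?hh (O.fib_map \<sigma>)"
        proof -
          have fi: "Fib A \<sigma> i \<in> Obj A" "ObjMap F (Fib A \<sigma> i) = Fib B f i" if "i \<in> set (pts_list B S)" for i
            using dom_op.fib_obj[OF s] map_fib[OF s] that so(7) sf by (auto simp: cod_op.set_pts_list)
          have c: "Comp V (h (Fib B f i)) (\<phi> (Fib A \<sigma> i)) = \<psi> (Fib A \<sigma> i)" if "i \<in> set (pts_list B S)" for i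
            using hp[OF fi(1)[OF that]] fi(2)[OF that] by simp
          have "tensA V (map (\<lambda>i. Comp V (h (Fib B f i)) (\<phi> (Fib A \<sigma> i))) (pts_list B S))
            = Comp V ?hh (tensA V (map (\<lambda>i. \<phi> (Fib A \<sigma> i)) (pts_list B S)))"
          proof (rule O.P.tensA_map_comp[of _ _ "\<lambda>i. Op P (Fib A \<sigma> i)" "\<lambda>i. Op Q (Fib B f i)" _ "\<lambda>i. Op Q' (Fib B f i)"])
            fix i assume i: "i \<in> set (pts_list B S)"
            show "\<phi> (Fib A \<sigma> i) \<in> Hom V (Op P (Fib A \<sigma> i)) (Op Q (Fib B f i))" using O.over_in[OF fi(1)[OF i]] fi(2)[OF i] by simp
            show "h (Fib B f i) \<in> Hom V (Op Q (Fib B f i)) (Op Q' (Fib B f i))" using h[OF obj_in[OF fi(1)[OF i]]] fi(2)[OF i] by simp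
          qed
          moreover have "map (\<lambda>i. Comp V (h (Fib B f i)) (\<phi> (Fib A \<sigma> i))) (pts_list B S) = map (\<lambda>i. \<psi> (Fib A \<sigma> i)) (pts_list B S)"
            using c by simp
          ultimately show ?thesis unfolding N.fib_map_def O.fib_map_def s_def[symmetric] so(6) by (simp only:)
        qed
        also have "\<psi> s = Comp V (h S) (\<phi> s)" using hp[OF so(3)] so(1) by simp
        also have "TenA V (Comp V ?hh (O.fib_map \<sigma>)) (Comp V (h S) (\<phi> s)) = Comp V (TenA V ?hh (h S)) (TenA V (O.fib_map \<sigma>) (\<phi> s))"
          by (rule O.P.ten_comp[OF fo hh ps hS])
        also have "Comp V (Mu Q' f) \<dots> = Comp V (Comp V (Mu Q' f) (TenA V ?hh (h S))) (lift_map V A \<phi> \<sigma>)"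
          unfolding a by (rule O.P.comp_assoc[OF ah hten m'])
        finally show "Comp V (Comp V (h T) (Mu Q f)) (lift_map V A \<phi> \<sigma>)
          = Comp V (Comp V (Mu Q' f) (TenA V ?hh (h S))) (lift_map V A \<phi> \<sigma>)" .
      qed
      then show "Comp V (h (Dom B f)) (Mu Q f) = Comp V (Mu Q' f) (TenA V (tensA V (map (\<lambda>i. h (Fib B f i)) (pts_list B (Cod B f)))) (h (Cod B f)))"
        by (simp add: T_def S_def)
    qed
    have comp: "Comp (operad_cat V A) (ArrMap (restriction A B F) (Q, k, Q')) (P, \<phi>, restrict_operad A B F Q) = x
      \<longleftrightarrow> (\<forall>t\<in>Obj A. Comp V (k (ObjMap F t)) (\<phi> t) = \<psi> t)" for k
    proof -
      have "\<psi> \<in> extensional (Obj A)" using \<psi>(2) by (simp add: is_operad_map_def)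
      then have "(\<lambda>t\<in>Obj A. Comp V (k (ObjMap F t)) (\<phi> t)) = \<psi> \<longleftrightarrow> (\<forall>t\<in>Obj A. Comp V (k (ObjMap F t)) (\<phi> t) = \<psi> t)"
        by (auto simp: fun_eq_iff extensional_def)
      moreover have "(\<lambda>t\<in>Obj A. Comp V ((\<lambda>t\<in>Obj A. k (ObjMap F t)) t) (\<phi> t)) = (\<lambda>t\<in>Obj A. Comp V (k (ObjMap F t)) (\<phi> t))"
        by (auto simp: fun_eq_iff)
      ultimately show ?thesis by (simp add: restriction_def operad_cat_sel \<psi>(1))
    qed
    show ?thesis
    proof (rule ex1I[of _ "(Q, h, Q')"])
      show "(Q, h, Q') \<in> Hom (operad_cat V B) Q Q' \<and> Comp (operad_cat V A) (ArrMap (restriction A B F) (Q, h, Q')) (P, \<phi>, restrict_operad A B F Q) = x"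
        using hmap Q Q' hp comp by (auto simp: operad_cat_hom)
      fix g assume g: "g \<in> Hom (operad_cat V B) Q Q' \<and> Comp (operad_cat V A) (ArrMap (restriction A B F) g) (P, \<phi>, restrict_operad A B F Q) = x"
      then obtain k where k: "g = (Q, k, Q')" "is_operad_map V B Q Q' k" by (auto simp: operad_cat_hom)
      have kp: "Comp V (k (ObjMap F t)) (\<phi> t) = \<psi> t" if "t \<in> Obj A" for t using g comp k(1) that by simp
      have "k T = h T" if T: "T \<in> Obj B" for T
        by (rule O.P.coprod_eqI[OF co[OF T] _ h[OF T]]) (use k(2) T kp hp in \<open>auto simp: is_operad_map_def\<close>)
      moreover have "k \<in> extensional (Obj B)" using k(2) by (simp add: is_operad_map_def)
      ultimately have "k = h" by (auto simp: fun_eq_iff extensional_def h_def)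
      then show "g = (Q, h, Q')" using k(1) by simp
    qed
  qed
  then show ?thesis
    unfolding universal_arrow_def
    using P Q p restrict_operad_is_operad[OF Q] by (auto simp: operad_cat_sel operad_cat_hom restriction_def)
qed

text \<open>Multiplications on the coproducts are induced by those of \<open>P\<close> over all
  lifts; units come from the bijection on components. Existence of coproducts over the fibers is
  assumed in the form \<open>ex\<close>, which abstracts from how the fibers are indexed in a
  universe.\<close>

lemma ex_fiberwise_coprod:
  fixes V :: "('v, 'w, 'x) smcat_scheme"
  assumes closed: "closed_monoidal V" and P: "is_operad V A P"
    and ex: "\<And>T X. \<lbrakk>T \<in> Obj B; \<forall>t\<in>{t \<in> Obj A. ObjMap F t = T}. X t \<in> Obj V\<rbrakk> \<Longrightarrow>
      \<exists>\<iota> y. is_coprod V {t \<in> Obj A. ObjMap F t = T} \<iota> y \<and> (\<forall>t\<in>{t \<in> Obj A. ObjMap F t = T}. Dom V (\<iota> t) = X t)"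
  shows "\<exists>Q \<phi>. is_operad V B Q \<and> is_operad_map V A P (restrict_operad A B F Q) \<phi> \<and> fiberwise_coprod V A B F Q \<phi>"
proof -
  interpret P: pre_operad V A P using P by (rule is_operad_pre_operad)
  have V: "symmetric_monoidal_category V" by unfold_locales
  define G where "G T \<iota> y \<longleftrightarrow> is_coprod V {t \<in> Obj A. ObjMap F t = T} \<iota> y \<and> (\<forall>t\<in>{t \<in> Obj A. ObjMap F t = T}. Dom V (\<iota> t) = Op P t)" for T \<iota> y
  have "\<exists>\<iota> y. G T \<iota> y" if "T \<in> Obj B" for T unfolding G_def by (rule ex[OF that]) (simp add: P.op_obj)
  then obtain \<iota> Y where GY: "\<And>T. T \<in> Obj B \<Longrightarrow> G T (\<iota> T) (Y T)" by metis
  have Y: "is_coprod V {t \<in> Obj A. ObjMap F t = T} (\<iota> T) (Y T)"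
    "\<forall>t\<in>{t \<in> Obj A. ObjMap F t = T}. Dom V (\<iota> T t) = Op P t" if "T \<in> Obj B" for T
    using GY[OF that] unfolding G_def by blast+
  \<comment> \<open>Each \<open>t\<close> lies over exactly one object, so the injections for all
    \<open>T\<close> fit together into one function.\<close>
  define \<phi> where "\<phi> = (\<lambda>t\<in>Obj A. \<iota> (ObjMap F t) t)"
  define Y' where "Y' = restrict Y (Obj B)"
  have coprod: "fiberwise_coprod V A B F Q \<phi>" if "Op Q = Y'" for Q
    unfolding fiberwise_coprod_def that
  proof
    fix T assume T: "T \<in> Obj B"
    show "is_coprod V {t \<in> Obj A. ObjMap F t = T} \<phi> (Y' T)"
      using is_coprod_cong[OF Y(1)[OF T], of \<phi>] T by (auto simp: \<phi>_def Y'_def)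
  qed
  have p: "\<phi> t \<in> Hom V (Op P t) (Y' (ObjMap F t))" if t: "t \<in> Obj A" for t
    using coprod_in[OF Y(1)[OF obj_in[OF t]], of t] Y(2)[OF obj_in[OF t]] t obj_in[OF t] by (simp add: \<phi>_def Y'_def)
  \<comment> \<open>A placeholder: \<open>op_fib\<close> reads only the objects of an operad, so the
    sources of the multiplications can be written before any multiplication exists.\<close>
  define Q0 :: "('p, 'b, 'v, 'w) operad" where "Q0 = \<lparr>Op = Y', Eta = undefined, Mu = undefined\<rparr>"
  have Q0: "Op Q0 = Y'" by (simp add: Q0_def)
  have opf: "op_fib V B Q f = op_fib V B Q0 f" if "Op Q = Y'" for Q f
    using that by (simp add: op_fib_def fib_factors_def Q0)
  have yo: "Y' T \<in> Obj V" if "T \<in> Obj B" for T using coprod_obj[OF Y(1)[OF that]] that by (simp add: Y'_def)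
  have lm: "Dom V (lift_map V A \<phi> \<sigma>) = Ten V (op_fib V A P \<sigma>) (Op P s)" if s: "\<sigma> \<in> Hom A t s" for \<sigma> t s
  proof -
    have c: "Cod A \<sigma> = s" "s \<in> Obj A" using s by (auto simp: hom_iff dom_cat.cod_in)
    have "tensA V (map (\<lambda>i. \<phi> (Fib A \<sigma> i)) (pts_list A s)) \<in> Hom V (op_fib V A P \<sigma>) (tens V (map (\<lambda>i. Y' (ObjMap F (Fib A \<sigma> i))) (pts_list A s)))"
      unfolding op_fib_def fib_factors_def c(1)
      by (rule P.tensA_map_in) (use p dom_op.fib_obj[OF s] in \<open>simp add: dom_op.set_pts_list\<close>)
    from P.ten_arr[OF this p[OF c(2)]] show ?thesis by (simp add: lift_map_def c hom_iff)
  qed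
  \<comment> \<open>The defining property of the multiplication at \<open>f\<close>, which is
    precisely compatibility of \<open>\<phi>\<close> with multiplication at every lift of
    \<open>f\<close>.\<close>
  define H where "H f h \<longleftrightarrow> h \<in> Hom V (Ten V (op_fib V B Q0 f) (Op Q0 (Cod B f))) (Y' (Dom B f)) \<and>
    (\<forall>\<sigma>\<in>{\<sigma> \<in> Arr A. ArrMap F \<sigma> = f}. Comp V h (lift_map V A \<phi> \<sigma>) = Comp V (\<phi> (Dom A \<sigma>)) (Mu P \<sigma>))" for f h
  have "\<exists>h. H f h" if fa: "f \<in> Arr B" for f
    unfolding H_def
  proof (rule coprod_map)
    have f: "f \<in> Hom B (Dom B f) (Cod B f)" using fa by (simp add: hom_iff)
    show "is_coprod V {\<sigma> \<in> Arr A. ArrMap F \<sigma> = f} (lift_map V A \<phi>) (Ten V (op_fib V B Q0 f) (Op Q0 (Cod B f)))"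
      by (rule is_coprod_lifts[OF V closed coprod[OF Q0] f])
    show "Y' (Dom B f) \<in> Obj V" using fa by (simp add: yo cod_cat.dom_in)
    show "\<forall>\<sigma>\<in>{\<sigma> \<in> Arr A. ArrMap F \<sigma> = f}. Comp V (\<phi> (Dom A \<sigma>)) (Mu P \<sigma>) \<in> Hom V (Dom V (lift_map V A \<phi> \<sigma>)) (Y' (Dom B f))"
    proof
      fix \<sigma> assume "\<sigma> \<in> {\<sigma> \<in> Arr A. ArrMap F \<sigma> = f}"
      then have sa: "\<sigma> \<in> Arr A" and sf: "ArrMap F \<sigma> = f" by auto
      note so = over_hom[OF sa, unfolded sf, OF f]
      show "Comp V (\<phi> (Dom A \<sigma>)) (Mu P \<sigma>) \<in> Hom V (Dom V (lift_map V A \<phi> \<sigma>)) (Y' (Dom B f))"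
        using P.comp_in[OF P.mu_in[OF so(5)] p[OF so(4)]] lm[OF so(5)] so(2) by simp
    qed
  qed
  then obtain M where HM: "\<And>f. f \<in> Arr B \<Longrightarrow> H f (M f)" by metis
  have M: "M f \<in> Hom V (Ten V (op_fib V B Q0 f) (Op Q0 (Cod B f))) (Y' (Dom B f))"
    "\<forall>\<sigma>\<in>{\<sigma> \<in> Arr A. ArrMap F \<sigma> = f}. Comp V (M f) (lift_map V A \<phi> \<sigma>) = Comp V (\<phi> (Dom A \<sigma>)) (Mu P \<sigma>)"
    if "f \<in> Arr B" for f using HM[OF that] unfolding H_def by blast+
  \<comment> \<open>The inverse of the bijection on components; \<open>pi0_map_inj\<close> makes it
    a left inverse too, so that \<open>\<phi>\<close> respects every unit of
    \<open>P\<close>.\<close>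
  let ?d = "inv_into (pi0 A) (pi0_map B (ObjMap F))"
  define Q where "Q = \<lparr>Op = Y', Eta = (\<lambda>c\<in>pi0 B. Comp V (\<phi> (Term A (?d c))) (Eta P (?d c))), Mu = restrict M (Arr B)\<rparr>"
  have Op: "Op Q = Y'" by (simp add: Q_def)
  have d: "?d c \<in> pi0 A" "pi0_map B (ObjMap F) (?d c) = c" if "c \<in> pi0 B" for c
    using that pi0_surj by (auto simp: inv_into_into f_inv_into_f)
  have dF: "?d (pi0_map B (ObjMap F) c) = c" if "c \<in> pi0 A" for c
    using pi0_map_inj[OF d(1)[OF pi0_in[OF that]] that d(2)[OF pi0_in[OF that]]] .
  have preQ: "pre_operad V B Q"
  proof
    show "Op Q T \<in> Obj V" if "T \<in> Obj B" for T using yo[OF that] by (simp add: Op)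
    show "Eta Q c \<in> Hom V (Unit V) (Op Q (Term B c))" if c: "c \<in> pi0 B" for c
      using P.comp_in[OF P.eta_in[OF d(1)[OF c]] p[OF dom_op.term_obj[OF d(1)[OF c]]]] map_term[OF d(1)[OF c]] d(2)[OF c] c
      by (simp add: Q_def)
    show "Mu Q f \<in> Hom V (Ten V (op_fib V B Q f) (Op Q S)) (Op Q T)" if f: "f \<in> Hom B T S" for f T S
      using M(1)[of f] f by (simp add: opf[OF Op] Op Q0) (simp add: Q_def hom_iff)
  qed
  have over: "operad_map_over V A B F P Q \<phi>"
  proof -
    interpret Q: pre_operad V B Q by (rule preQ)
    show ?thesis
    proof
      show "\<phi> T \<in> Hom V (Op P T) (Op Q (ObjMap F T))" if "T \<in> Obj A" for T using p[OF that] by (simp add: Op)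
      show "Comp V (\<phi> (Term A c)) (Eta P c) = Eta Q (pi0_map B (ObjMap F) c)" if c: "c \<in> pi0 A" for c
        using dF[OF c] pi0_in[OF c] by (simp add: Q_def)
      show "Comp V (\<phi> (Dom A f)) (Mu P f) = Comp V (Mu Q (ArrMap F f))
        (TenA V (tensA V (map (\<lambda>i. \<phi> (Fib A f i)) (pts_list A (Cod A f)))) (\<phi> (Cod A f)))" if fa: "f \<in> Arr A" for f
      proof -
        have "ArrMap F f \<in> Arr B" using arr_in[of f "Dom A f" "Cod A f"] fa by (simp add: hom_iff)
        then show ?thesis using M(2)[of "ArrMap F f"] fa by (simp add: Q_def lift_map_def)
      qed
    qed
  qed
  have "is_operad V B Q"
    by (rule is_operad_lifts[OF closed P over coprod[OF Op]]) (auto simp: Q_def Y'_def)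
  moreover have "is_operad_map V A P (restrict_operad A B F Q) \<phi>"
    using over operad_map_over_iff[OF P.pre_operad_axioms preQ] by (simp add: \<phi>_def)
  ultimately show ?thesis using coprod[OF Op] by blast
qed

end

lemma operad_iso_component:
  assumes "symmetric_monoidal_category V" and iso: "iso_arrow (operad_cat V A) (P, k, P')" and T: "T \<in> Obj A"
  shows "iso_arrow V (k T)" "Dom V (k T) = Op P T" "Cod V (k T) = Op P' T"
proof -
  interpret symmetric_monoidal_category V by fact
  have sel: "Dom (operad_cat V A) (P, k, P') = P" "Cod (operad_cat V A) (P, k, P') = P'" by (simp_all add: operad_cat_def)
  obtain g where g: "(P, k, P') \<in> Hom (operad_cat V A) P P'" "g \<in> Hom (operad_cat V A) P' P"
    "Comp (operad_cat V A) g (P, k, P') = Id (operad_cat V A) P" "Comp (operad_cat V A) (P, k, P') g = Id (operad_cat V A) P'"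
    using iso unfolding iso_arrow_def inverse_arrows_def sel by blast
  obtain l where l: "g = (P', l, P)" "is_operad_map V A P' P l" and k: "is_operad_map V A P P' k"
    using g(1,2) by (auto simp: operad_cat_hom)
  have e: "(\<lambda>T\<in>Obj A. Comp V (l T) (k T)) = (\<lambda>T\<in>Obj A. Id V (Op P T))"
    "(\<lambda>T\<in>Obj A. Comp V (k T) (l T)) = (\<lambda>T\<in>Obj A. Id V (Op P' T))"
    using g(3,4) unfolding l(1) operad_cat_sel by auto
  have "Comp V (l T) (k T) = Id V (Op P T)" "Comp V (k T) (l T) = Id V (Op P' T)"
    using fun_cong[OF e(1), of T] fun_cong[OF e(2), of T] T by simp_all
  moreover have "k T \<in> Hom V (Op P T) (Op P' T)" "l T \<in> Hom V (Op P' T) (Op P T)"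
    using k l(2) T by (auto simp: is_operad_map_def)
  ultimately show "iso_arrow V (k T)" "Dom V (k T) = Op P T" "Cod V (k T) = Op P' T"
    unfolding iso_arrow_def inverse_arrows_def by (auto simp: hom_iff)
qed

section \<open>The chosen left adjoint and its unit\<close>

context discrete_operadic_fibration
begin

context
  fixes V :: "('v, 'w, 'x) smcat_scheme"
  assumes V: "symmetric_monoidal_category V" and closed: "closed_monoidal V"
    and ex: "\<And>T X. \<lbrakk>T \<in> Obj B; \<forall>t\<in>{t \<in> Obj A. ObjMap F t = T}. X t \<in> Obj V\<rbrakk> \<Longrightarrow>
      \<exists>\<iota> y. is_coprod V {t \<in> Obj A. ObjMap F t = T} \<iota> y \<and> (\<forall>t\<in>{t \<in> Obj A. ObjMap F t = T}. Dom V (\<iota> t) = X t)"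
begin

lemma shriek_adjunction:
  "adjunction (operad_cat V A) (operad_cat V B) (shriek V A B F) (restriction A B F)
     (shriek_unit V A B F) (shriek_counit V A B F)"
proof -
  have "\<exists>y \<eta>. universal_arrow (operad_cat V A) (operad_cat V B) (restriction A B F) P y \<eta>"
    if P: "P \<in> Obj (operad_cat V A)" for P
  proof -
    have P: "is_operad V A P" using P by (simp add: operad_cat_sel)
    show ?thesis using ex_fiberwise_coprod[OF closed P ex] fiberwise_coprod_universal[OF closed P] by blast
  qed
  then obtain L \<eta> \<epsilon> where "adjunction (operad_cat V A) (operad_cat V B) L (restriction A B F) \<eta> \<epsilon>"
    using universal_arrows_adjunction[OF restriction_functor[OF V]] by blast
  then show ?thesis
    by (rule left_adjoint_adjunction) (simp add: shriek_def shriek_unit_def shriek_counit_def shriek_data_def)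
qed

text \<open>The chosen adjoint has no formula, but its unit is universal, as is the map into the
  explicit operad \<open>Q\<close> of coproducts. The comparison of the two is an isomorphism of
  operads, hence an isomorphism in every component, and coproducts are carried along it.\<close>

lemma shriek_unit_fiberwise_coprod:
  assumes P: "is_operad V A P"
  obtains \<eta> where "shriek_unit V A B F P = (P, \<eta>, restrict_operad A B F (ObjMap (shriek V A B F) P))"
    "is_operad_map V A P (restrict_operad A B F (ObjMap (shriek V A B F) P)) \<eta>"
    "is_operad V B (ObjMap (shriek V A B F) P)"
    "fiberwise_coprod V A B F (ObjMap (shriek V A B F) P) \<eta>"
proof -
  interpret symmetric_monoidal_category V by (rule V)
  define L where "L = ObjMap (shriek V A B F) P"
  have u: "universal_arrow (operad_cat V A) (operad_cat V B) (restriction A B F) P L (shriek_unit V A B F P)"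
    using adjunction_universal[OF shriek_adjunction, of P] P by (simp add: L_def operad_cat_sel)
  then have h: "shriek_unit V A B F P \<in> Hom (operad_cat V A) P (restrict_operad A B F L)" and L: "is_operad V B L"
    unfolding universal_arrow_def by (simp_all add: restriction_def operad_cat_sel)
  obtain \<eta> where \<eta>: "shriek_unit V A B F P = (P, \<eta>, restrict_operad A B F L)" "is_operad_map V A P (restrict_operad A B F L) \<eta>"
    using h by (auto simp: operad_cat_hom)
  obtain Q \<phi> where Q: "is_operad V B Q" "is_operad_map V A P (restrict_operad A B F Q) \<phi>" "fiberwise_coprod V A B F Q \<phi>"
    using ex_fiberwise_coprod[OF closed P ex] by blast
  note uQ = fiberwise_coprod_universal[OF closed P Q]
  have LO: "L \<in> Obj (operad_cat V B)" using L by (simp add: operad_cat_sel)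
  have hO: "shriek_unit V A B F P \<in> Hom (operad_cat V A) P (ObjMap (restriction A B F) L)" using h by (simp add: restriction_def)
  obtain g where g: "g \<in> Hom (operad_cat V B) Q L"
    "Comp (operad_cat V A) (ArrMap (restriction A B F) g) (P, \<phi>, restrict_operad A B F Q) = shriek_unit V A B F P"
    using uQ LO hO unfolding universal_arrow_def by blast
  have iso: "iso_arrow (operad_cat V B) g"
    by (rule universal_arrow_comparison_iso[OF restriction_functor[OF V] uQ u g])
  obtain k where k: "g = (Q, k, L)" using g(1) by (auto simp: operad_cat_hom)
  have "\<eta> = (\<lambda>t\<in>Obj A. Comp V ((\<lambda>t\<in>Obj A. k (ObjMap F t)) t) (\<phi> t))"
    using g(2) unfolding k \<eta>(1) by (simp add: restriction_def operad_cat_sel)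
  then have e: "\<eta> t = Comp V (k (ObjMap F t)) (\<phi> t)" if "t \<in> Obj A" for t using that by simp
  have "fiberwise_coprod V A B F L \<eta>"
    unfolding fiberwise_coprod_def
  proof
    fix T assume T: "T \<in> Obj B"
    note i = operad_iso_component[OF V iso[unfolded k] T]
    have "is_coprod V {t \<in> Obj A. ObjMap F t = T} \<phi> (Op Q T)" using Q(3) T by (simp add: fiberwise_coprod_def)
    from is_coprod_post_iso[OF this i(1,2), of \<eta>] show "is_coprod V {t \<in> Obj A. ObjMap F t = T} \<eta> (Op L T)"
      using e i(3) by auto
  qed
  then show ?thesis using that \<eta> L unfolding L_def by blast
qed

end

end

section \<open>Pullbacks of discrete operadic fibrations\<close>

locale fibration_pullback =
  fixes \<R> :: "('r, 'd) opcat" and A :: "('o, 'a) opcat" and B :: "('q, 'c) opcat" and P :: "('p, 'b) opcat"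
    and r :: "('r, 'd, 'o, 'a) ftor" and s :: "('r, 'd, 'q, 'c) ftor"
    and F :: "('o, 'a, 'p, 'b) ftor" and G :: "('q, 'c, 'p, 'b) ftor"
  assumes square: "pullback_square \<R> A B P r s F G" and fib: "discrete_operadic_fibration A P F"
begin

sublocale r: operadic_functor \<R> A r using square by (simp add: pullback_square_def)
sublocale s: operadic_functor \<R> B s using square by (simp add: pullback_square_def)
sublocale F: discrete_operadic_fibration A P F by (rule fib)
sublocale G: operadic_functor B P G using square by (simp add: pullback_square_def)

lemma square_obj: "x \<in> Obj \<R> \<Longrightarrow> ObjMap F (ObjMap r x) = ObjMap G (ObjMap s x)"
  and square_arr: "f \<in> Arr \<R> \<Longrightarrow> ArrMap F (ArrMap r f) = ArrMap G (ArrMap s f)"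
  using square by (auto simp: pullback_square_def)

lemma obj_eqI: "\<lbrakk>x \<in> Obj \<R>; y \<in> Obj \<R>; ObjMap r x = ObjMap r y; ObjMap s x = ObjMap s y\<rbrakk> \<Longrightarrow> x = y"
  using square by (auto simp: pullback_square_def operadic_iso_def pair_ftor_def bij_betw_def inj_on_def)

lemma arr_eqI: "\<lbrakk>f \<in> Arr \<R>; g \<in> Arr \<R>; ArrMap r f = ArrMap r g; ArrMap s f = ArrMap s g\<rbrakk> \<Longrightarrow> f = g"
  using square by (auto simp: pullback_square_def operadic_iso_def pair_ftor_def bij_betw_def inj_on_def)

lemma ex_obj:
  assumes "a \<in> Obj A" "b \<in> Obj B" "ObjMap F a = ObjMap G b"
  shows "\<exists>x \<in> Obj \<R>. ObjMap r x = a \<and> ObjMap s x = b"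
proof -
  have "(\<lambda>x. (ObjMap r x, ObjMap s x)) ` Obj \<R> = Obj (opcat_pullback A B F G)"
    using square by (auto simp: pullback_square_def operadic_iso_def pair_ftor_def bij_betw_def)
  moreover have "(a, b) \<in> Obj (opcat_pullback A B F G)" using assms by (simp add: opcat_pullback_def)
  ultimately have "(a, b) \<in> (\<lambda>x. (ObjMap r x, ObjMap s x)) ` Obj \<R>" by (simp only:)
  then show ?thesis by auto
qed

lemma ex_arr:
  assumes "a \<in> Arr A" "b \<in> Arr B" "ArrMap F a = ArrMap G b"
  shows "\<exists>x \<in> Arr \<R>. ArrMap r x = a \<and> ArrMap s x = b"
proof -
  have "(\<lambda>x. (ArrMap r x, ArrMap s x)) ` Arr \<R> = Arr (opcat_pullback A B F G)"
    using square by (auto simp: pullback_square_def operadic_iso_def pair_ftor_def bij_betw_def)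
  moreover have "(a, b) \<in> Arr (opcat_pullback A B F G)" using assms by (simp add: opcat_pullback_def)
  ultimately have "(a, b) \<in> (\<lambda>x. (ArrMap r x, ArrMap s x)) ` Arr \<R>" by (simp only:)
  then show ?thesis by auto
qed

text \<open>A lift of \<open>f\<close> to the pullback consists of \<open>f\<close> together with a
  lift to \<open>A\<close> of its image under \<open>G\<close>, with fibers projected along
  \<open>r\<close>.\<close>

sublocale s: discrete_operadic_fibration \<R> B s
proof
  show "pi0_map B (ObjMap s) ` pi0 \<R> = pi0 B"
  proof (intro equalityI subsetI)
    fix c assume "c \<in> pi0_map B (ObjMap s) ` pi0 \<R>"
    then show "c \<in> pi0 B" using s.pi0_in by blast
  next
    fix c assume c: "c \<in> pi0 B"
    obtain d where d: "d \<in> pi0 A" "pi0_map P (ObjMap F) d = pi0_map P (ObjMap G) c"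
      using F.pi0_lift[OF G.pi0_in[OF c]] .
    \<comment> \<open>Operadic functors preserve chosen terminal objects, so these two have the same
      image in \<open>P\<close> and form an object of the pullback in the component sought.\<close>
    have "ObjMap F (Term A d) = ObjMap G (Term B c)" using F.map_term[OF d(1)] G.map_term[OF c] d(2) by simp
    then obtain x where x: "x \<in> Obj \<R>" "ObjMap s x = Term B c"
      using ex_obj[OF r.cod_op.term_obj[OF d(1)] s.cod_op.term_obj[OF c]] by blast
    define e where "e = connected_rel \<R> `` {x}"
    have e: "e \<in> pi0 \<R>" "x \<in> e"
      using x(1) r.dom_cat.component_in_pi0 r.dom_cat.connected_refl by (auto simp: e_def)
    have "pi0_map B (ObjMap s) e = c"
      using s.pi0_map_component[OF e] x(2) s.cod_op.component_term[OF c] by simp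
    then show "c \<in> pi0_map B (ObjMap s) ` pi0 \<R>" using e(1) by blast
  qed
next
  fix f T S x t
  assume f: "f \<in> Hom B T S" and x: "x \<in> Obj \<R>" "ObjMap s x = S"
    and t: "\<And>i. i \<in> pts B S \<Longrightarrow> t i \<in> Obj \<R> \<and> ObjMap s (t i) = Fib B f i"
  have S: "S \<in> Obj B" using x s.obj_in by blast
  note Gf = G.arr_in[OF f]
  have p: "pts P (ObjMap G S) = pts B S" using G.pts_map[OF S] .
  have rx: "ObjMap r x \<in> Obj A" "ObjMap F (ObjMap r x) = ObjMap G S" using x r.obj_in square_obj by auto
  have rt: "ObjMap r (t i) \<in> Obj A \<and> ObjMap F (ObjMap r (t i)) = Fib P (ArrMap G f) i" if "i \<in> pts P (ObjMap G S)" for i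
    using t[of i] that p r.obj_in square_obj[of "t i"] G.map_fib[OF f, of i] by simp
  obtain \<sigma> where \<sigma>: "\<sigma> \<in> Arr A" "Cod A \<sigma> = ObjMap r x" "ArrMap F \<sigma> = ArrMap G f"
    "\<forall>i\<in>pts P (ObjMap G S). Fib A \<sigma> i = ObjMap r (t i)"
    by (rule F.lift_obtain[OF Gf rx rt])
  have fa: "f \<in> Arr B" "Cod B f = S" using f by (auto simp: hom_iff)
  \<comment> \<open>The conditions on codomain and fibers become conditions on the two projections,
    which determine an arrow; uniqueness of \<open>\<sigma>\<close> handles the projection to
    \<open>A\<close>.\<close>
  have key: "\<rho> \<in> Arr \<R> \<and> Cod \<R> \<rho> = x \<and> ArrMap s \<rho> = f \<and> (\<forall>i \<in> pts B S. Fib \<R> \<rho> i = t i)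
     \<longleftrightarrow> \<rho> \<in> Arr \<R> \<and> ArrMap r \<rho> = \<sigma> \<and> ArrMap s \<rho> = f" for \<rho>
  proof (intro iffI conjI; (elim conjE)?; assumption?)
    assume \<rho>: "\<rho> \<in> Arr \<R>" "Cod \<R> \<rho> = x" "ArrMap s \<rho> = f" "\<forall>i \<in> pts B S. Fib \<R> \<rho> i = t i"
    have h: "\<rho> \<in> Hom \<R> (Dom \<R> \<rho>) x" using \<rho> by (simp add: hom_iff)
    have "ArrMap r \<rho> \<in> Arr A \<and> Cod A (ArrMap r \<rho>) = ObjMap r x \<and> ArrMap F (ArrMap r \<rho>) = ArrMap G f
      \<and> (\<forall>i\<in>pts P (ObjMap G S). Fib A (ArrMap r \<rho>) i = ObjMap r (t i))"
    proof (intro conjI ballI)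
      show "ArrMap r \<rho> \<in> Arr A" "Cod A (ArrMap r \<rho>) = ObjMap r x" using r.arr_in[OF h] by (auto simp: hom_iff)
      show "ArrMap F (ArrMap r \<rho>) = ArrMap G f" using square_arr[OF \<rho>(1)] \<rho>(3) by simp
      fix i assume "i \<in> pts P (ObjMap G S)"
      then have i: "i \<in> pts B S" using p by simp
      moreover have "i \<in> pts \<R> x" using i s.pts_map[OF x(1)] x(2) by simp
      ultimately show "Fib A (ArrMap r \<rho>) i = ObjMap r (t i)" using r.map_fib[OF h] \<rho>(4) by metis
    qed
    moreover have "\<exists>!\<sigma>. \<sigma> \<in> Arr A \<and> Cod A \<sigma> = ObjMap r x \<and> ArrMap F \<sigma> = ArrMap G f
      \<and> (\<forall>i\<in>pts P (ObjMap G S). Fib A \<sigma> i = ObjMap r (t i))"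
      by (rule F.unique_lift[OF Gf rx rt])
    ultimately show "ArrMap r \<rho> = \<sigma>" using \<sigma> by blast
  next
    assume \<rho>: "\<rho> \<in> Arr \<R>" "ArrMap r \<rho> = \<sigma>" "ArrMap s \<rho> = f"
    have h: "\<rho> \<in> Hom \<R> (Dom \<R> \<rho>) (Cod \<R> \<rho>)" using \<rho> by (simp add: hom_iff)
    have co: "Cod \<R> \<rho> \<in> Obj \<R>" using \<rho>(1) by (rule r.dom_cat.cod_in)
    have "ObjMap r (Cod \<R> \<rho>) = ObjMap r x" "ObjMap s (Cod \<R> \<rho>) = ObjMap s x"
      using r.arr_in[OF h] s.arr_in[OF h] \<rho> \<sigma>(2) x(2) fa(2) by (auto simp: hom_iff)
    then show cx: "Cod \<R> \<rho> = x" by (rule obj_eqI[OF co x(1)])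
    show "\<forall>i \<in> pts B S. Fib \<R> \<rho> i = t i"
    proof
      fix i assume i: "i \<in> pts B S"
      have ix: "i \<in> pts \<R> x" using i s.pts_map[OF x(1)] x(2) by simp
      note h = h[unfolded cx]
      show "Fib \<R> \<rho> i = t i"
      proof (rule obj_eqI)
        show "Fib \<R> \<rho> i \<in> Obj \<R>" using r.dom_op.fib_obj[OF h ix] .
        show "t i \<in> Obj \<R>" using t[OF i] by simp
        show "ObjMap r (Fib \<R> \<rho> i) = ObjMap r (t i)" using r.map_fib[OF h ix] \<rho>(2) \<sigma>(4) i p by simp
        show "ObjMap s (Fib \<R> \<rho> i) = ObjMap s (t i)" using s.map_fib[OF h ix] \<rho>(3) t[OF i] by simp
      qed
    qed
  qed
  obtain \<rho> where \<rho>: "\<rho> \<in> Arr \<R>" "ArrMap r \<rho> = \<sigma>" "ArrMap s \<rho> = f" using ex_arr[OF \<sigma>(1) fa(1) \<sigma>(3)] by blast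
  show "\<exists>!\<rho>. \<rho> \<in> Arr \<R> \<and> Cod \<R> \<rho> = x \<and> ArrMap s \<rho> = f \<and> (\<forall>i \<in> pts B S. Fib \<R> \<rho> i = t i)"
    unfolding key by (rule ex1I[of _ \<rho>]) (use \<rho> arr_eqI in auto)
qed

text \<open>In a pullback a fiber of \<open>s\<close> is a fiber of \<open>F\<close>. This gives
  stability of fiberwise coproducts, and it also embeds the fibers of \<open>s\<close> into the
  object type of \<open>A\<close>, so that their coproducts exist.\<close>

lemma bij_betw_fibers:
  assumes T: "T \<in> Obj B"
  shows "bij_betw (ObjMap r) {x \<in> Obj \<R>. ObjMap s x = T} {t \<in> Obj A. ObjMap F t = ObjMap G T}"
  unfolding bij_betw_def
proof (intro conjI inj_onI equalityI subsetI)
  show "x = y" if "x \<in> {x \<in> Obj \<R>. ObjMap s x = T}" "y \<in> {x \<in> Obj \<R>. ObjMap s x = T}" "ObjMap r x = ObjMap r y" for x y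
    using that by (auto intro: obj_eqI)
  show "a \<in> {t \<in> Obj A. ObjMap F t = ObjMap G T}" if "a \<in> ObjMap r ` {x \<in> Obj \<R>. ObjMap s x = T}" for a
    using that r.obj_in square_obj by auto
  show "a \<in> ObjMap r ` {x \<in> Obj \<R>. ObjMap s x = T}" if "a \<in> {t \<in> Obj A. ObjMap F t = ObjMap G T}" for a
    using that ex_obj[of a T] T by auto
qed

lemma fiberwise_coprod_pullback:
  assumes "fiberwise_coprod V A P F Q \<phi>"
  shows "fiberwise_coprod V \<R> B s (restrict_operad B P G Q) (\<lambda>x\<in>Obj \<R>. \<phi> (ObjMap r x))"
  unfolding fiberwise_coprod_def
proof
  fix T assume T: "T \<in> Obj B"
  have "is_coprod V {t \<in> Obj A. ObjMap F t = ObjMap G T} \<phi> (Op Q (ObjMap G T))"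
    using assms G.obj_in[OF T] by (simp add: fiberwise_coprod_def)
  from is_coprod_reindex[OF this bij_betw_fibers[OF T]]
  show "is_coprod V {x \<in> Obj \<R>. ObjMap s x = T} (\<lambda>x\<in>Obj \<R>. \<phi> (ObjMap r x)) (Op (restrict_operad B P G Q) T)"
    using T by (simp add: restrict_operad_sel)
qed

text \<open>The two operads are equal, not merely isomorphic, because values off the domains are
  fixed. The actions on components are compared at the chosen terminal object.\<close>

lemma restrict_square: "restrict_operad \<R> A r (restrict_operad A P F Q) = restrict_operad \<R> B s (restrict_operad B P G Q)"
proof -
  have "pi0_map P (ObjMap F) (pi0_map A (ObjMap r) c) = pi0_map P (ObjMap G) (pi0_map B (ObjMap s) c)" if c: "c \<in> pi0 \<R>" for c
  proof -
    define x where "x = Term \<R> c"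
    have x: "x \<in> c" "x \<in> Obj \<R>" using r.dom_op.term_in[OF c] r.dom_op.term_obj[OF c] by (auto simp: x_def)
    show ?thesis
      using F.pi0_map_component[OF r.pi0_in[OF c] r.map_in_pi0_map[OF c x(1)]]
        G.pi0_map_component[OF s.pi0_in[OF c] s.map_in_pi0_map[OF c x(1)]] square_obj[OF x(2)] by simp
  qed
  moreover have "ArrMap r f \<in> Arr A" "ArrMap s f \<in> Arr B" if "f \<in> Arr \<R>" for f
    using r.arr_in[of f "Dom \<R> f" "Cod \<R> f"] s.arr_in[of f "Dom \<R> f" "Cod \<R> f"] that by (auto simp: hom_iff)
  ultimately show ?thesis
    unfolding restrict_operad_def
    by (auto simp: fun_eq_iff r.obj_in s.obj_in square_obj r.pi0_in s.pi0_in square_arr)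
qed

lemma restriction_square_arr:
  "ArrMap (restriction \<R> A r) (ArrMap (restriction A P F) h) = ArrMap (restriction \<R> B s) (ArrMap (restriction B P G) h)"
  by (cases h) (auto simp: restriction_def restrict_square fun_eq_iff r.obj_in s.obj_in square_obj)

end

theorem proposition2p8:
  fixes V :: "('v, 'w) smcat"
    and \<O> \<P> \<Q> :: "('u, 'u) opcat"
    and \<R> :: "('x, 'y) opcat"
    and r :: "('x, 'y, 'u, 'u) ftor"
    and varpi :: "('x, 'y, 'u, 'u) ftor"
    and \<pi> p :: "('u, 'u, 'u, 'u) ftor"
  assumes "symmetric_monoidal_category V"
    and "closed_monoidal V"
    and "complete_cat TYPE('u) V"
    and "cocomplete_cat TYPE('u) V"
    and "pullback_square \<R> \<O> \<Q> \<P> r varpi \<pi> p"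
    and "discrete_operadic_fibration \<O> \<P> \<pi>"
  shows "nat_iso (operad_cat V \<O>) (operad_cat V \<Q>)
           (comp_ftor (shriek V \<R> \<Q> varpi) (restriction \<R> \<O> r))
           (comp_ftor (restriction \<Q> \<P> p) (shriek V \<O> \<P> \<pi>))
           (beck_chevalley V \<R> \<O> \<Q> \<P> r varpi \<pi> p)"
proof -
  interpret fibration_pullback \<R> \<O> \<Q> \<P> r varpi \<pi> p
    using assms by (simp add: fibration_pullback_def)
  interpret V: symmetric_monoidal_category V by fact
  have ex1: "\<exists>\<iota> y. is_coprod V {t \<in> Obj \<O>. ObjMap \<pi> t = T} \<iota> y \<and> (\<forall>t\<in>{t \<in> Obj \<O>. ObjMap \<pi> t = T}. Dom V (\<iota> t) = X t)"
    if "T \<in> Obj \<P>" "\<forall>t\<in>{t \<in> Obj \<O>. ObjMap \<pi> t = T}. X t \<in> Obj V" for T X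
    by (rule V.ex_coprod[OF assms(4) inj_on_id2]) (use that(2) in blast)
  \<comment> \<open>The objects of \<open>\<R>\<close> are not elements of \<open>'u\<close>; the
    object map of \<open>r\<close>, injective on each fiber of \<open>varpi\<close>, supplies the
    indexing.\<close>
  have ex2: "\<exists>\<iota> y. is_coprod V {x \<in> Obj \<R>. ObjMap varpi x = T} \<iota> y \<and> (\<forall>x\<in>{x \<in> Obj \<R>. ObjMap varpi x = T}. Dom V (\<iota> x) = X x)"
    if "T \<in> Obj \<Q>" "\<forall>x\<in>{x \<in> Obj \<R>. ObjMap varpi x = T}. X x \<in> Obj V" for T X
    by (rule V.ex_coprod[OF assms(4) bij_betw_imp_inj_on[OF bij_betw_fibers[OF that(1)]]]) (use that(2) in blast)
  note adj1 = F.shriek_adjunction[OF assms(1,2) ex1] and adj2 = s.shriek_adjunction[OF assms(1,2) ex2]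
  show ?thesis
    unfolding beck_chevalley_def[abs_def]
  proof (rule mate_nat_iso[OF adj1 adj2 r.restriction_functor[OF assms(1)] G.restriction_functor[OF assms(1)]])
    show "ObjMap (restriction \<R> \<O> r) (ObjMap (restriction \<O> \<P> \<pi>) Q) = ObjMap (restriction \<R> \<Q> varpi) (ObjMap (restriction \<Q> \<P> p) Q)" for Q
      by (simp add: restriction_def restrict_square)
    show "ArrMap (restriction \<R> \<O> r) (ArrMap (restriction \<O> \<P> \<pi>) h) = ArrMap (restriction \<R> \<Q> varpi) (ArrMap (restriction \<Q> \<P> p) h)" for h
      by (rule restriction_square_arr)
    fix P assume "P \<in> Obj (operad_cat V \<O>)"
    then have P: "is_operad V \<O> P" by (simp add: operad_cat_sel)
    define L where "L = ObjMap (shriek V \<O> \<P> \<pi>) P"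
    obtain \<eta> where \<eta>: "shriek_unit V \<O> \<P> \<pi> P = (P, \<eta>, restrict_operad \<O> \<P> \<pi> L)"
      "is_operad_map V \<O> P (restrict_operad \<O> \<P> \<pi> L) \<eta>" "is_operad V \<P> L" "fiberwise_coprod V \<O> \<P> \<pi> L \<eta>"
      unfolding L_def by (rule F.shriek_unit_fiberwise_coprod[OF assms(1,2) ex1 P])
    \<comment> \<open>The unit restricted along \<open>r\<close> still has coproduct injections as
      components, hence is universal for \<open>varpi\<close>; equality of the two restrictions
      around the square supplies its target.\<close>
    have "universal_arrow (operad_cat V \<R>) (operad_cat V \<Q>) (restriction \<R> \<Q> varpi) (restrict_operad \<R> \<O> r P)
       (restrict_operad \<Q> \<P> p L) (restrict_operad \<R> \<O> r P, \<lambda>x\<in>Obj \<R>. \<eta> (ObjMap r x), restrict_operad \<R> \<Q> varpi (restrict_operad \<Q> \<P> p L))"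
    proof (rule s.fiberwise_coprod_universal[OF assms(2) r.restrict_operad_is_operad[OF P] G.restrict_operad_is_operad[OF \<eta>(3)]
          _ fiberwise_coprod_pullback[OF \<eta>(4)]])
      show "is_operad_map V \<R> (restrict_operad \<R> \<O> r P) (restrict_operad \<R> \<Q> varpi (restrict_operad \<Q> \<P> p L)) (\<lambda>x\<in>Obj \<R>. \<eta> (ObjMap r x))"
        using r.restrict_operad_map[OF P F.restrict_operad_is_operad[OF \<eta>(3)] \<eta>(2)] by (simp add: restrict_square)
    qed
    then show "universal_arrow (operad_cat V \<R>) (operad_cat V \<Q>) (restriction \<R> \<Q> varpi) (ObjMap (restriction \<R> \<O> r) P)
       (ObjMap (restriction \<Q> \<P> p) (ObjMap (shriek V \<O> \<P> \<pi>) P)) (ArrMap (restriction \<R> \<O> r) (shriek_unit V \<O> \<P> \<pi> P))"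
      by (simp add: \<eta>(1) L_def[symmetric] restrict_square) (simp add: restriction_def restrict_square)
  qed
qed

end
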